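(* Assume the resolution condition $H_1\kappa\le\pi/\sqrt2$. Let $k,\ell\in\{1,\dots,L\}$ with $k\ne\ell$. Then for all $\tilde\varphi_k\in\widetilde\Phi_k$ and $\tilde\psi_\ell\in\widetilde\Psi_\ell$, $$a(\tilde\varphi_k,\tilde\psi_\ell)=0 .$$
   Context: Let $d\in\{1,2,3\}$ and let $D\subset\mathbb R^d$ be a bounded Lipschitz domain scaled to unit size, whose boundary is decomposed into closed components $\partial D=\Gamma_{\mathrm D}\cup\Gamma_{\mathrm N}\cup\Gamma_{\mathrm R}$ with pairwise disjoint interiors; $\Gamma_{\mathrm D},\Gamma_{\mathrm N}$ may be empty and $\Gamma_{\mathrm R}$ has positive surface measure. Let $\kappa>\kappa_0>0$ be the wave number. All functions are complex-valued; $(u,v)_{L^2(D)}=\int_D u\cdot\overline v\,dx$ and $(u,v)_{L^2(\Gamma_{\mathrm R})}=\int_{\Gamma_{\mathrm R}}u\overline v\,ds$. $\mathcal V:=\{v\in W^{1,2}(D): v|_{\Gamma_{\mathrm D}}=0\}$ and $$a(u,v):=(\nabla u,\nabla v)_{L^2(D)}-\kappa^2(u,v)_{L^2(D)}-i\kappa(u,v)_{L^2(\Gamma_{\mathrm R})},\quad u,v\in\mathcal V.$$ Meshes: $\mathcal T_1$ is a Cartesian mesh of $D$ (closed axis-parallel cubes of side length $H_1$), and $\mathcal T_1,\dots,\mathcal T_L$ is obtained by successive uniform refinement, $H_\ell=2^{-\ell+1}H_1$. $\mathbb Q_0(\mathcal T_\ell)$ is the space of $\mathcal T_\ell$-piecewise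 constants, $\Pi_\ell:L^2(D)\to\mathbb Q_0(\mathcal T_\ell)$ the $L^2$-orthogonal projection, $\mathcal W_\ell:=\{w\in\mathcal V:\Pi_\ell w=0\}$. Haar basis: $\chi^{(0)}=\mathbf 1_{[0,1]}$, $\chi^{(1)}(x)=\chi^{(0)}(2x)-\chi^{(0)}(2x-1)$; $\mathcal H_1=\{|T|^{-1/2}\mathbf 1_T:T\in\mathcal T_1\}$ and, for $\ell\ge2$, $\mathcal H_\ell=\{|T|^{-1/2}\prod_{k=1}^d\chi^{(j_k)}(H_{\ell-1}^{-1}(x_k-a_{T,k})):T\in\mathcal T_{\ell-1},\,j\in\{0,1\}^d\setminus\{\mathbf 0\}\}$, where $a_{T,k}$ is the $k$-th coordinate of the bottom, front, left corner of $T$. Write $\mathcal H_\ell=\{\phi_{\ell,j}:j=1,\dots,N_\ell\}$. Bubbles: for $T\in\mathcal T_\ell$, $b_T(x)=\prod_{k=1}^d b(H_\ell^{-1}(x_k-a_{T,k}))$ with $b(t)=6t(1-t)\mathbf 1_{[0,1]}(t)$; $\widetilde\Pi_\ell:\mathbb Q_0(\mathcal T_\ell)\to\mathcal V$ is linear with $\widetilde\Pi_\ell\mathbf 1_T=b_T$. Correctors (well-defined under the resolution condition): $\mathcal C_\ell,\mathcal C_\ell^*:\mathcal V\to\mathcal W_\ell$ with $a(\mathcal C_\ell v,w)=a(v,w)$ and $a(w,\mathcal C_\ell^*v)=a(w,v)$ for all $w\in\mathcal W_\ell$. Trial and test spaces: $\widetilde\Phi_\ell:=\mathrm{span}\{(1-\mathcal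 C_\ell)\widetilde\Pi_\ell\phi_{\ell,j}:j=1,\dots,N_\ell\}$ and $\widetilde\Psi_\ell:=\mathrm{span}\{(1-\mathcal C_\ell^* )\widetilde\Pi_\ell\phi_{\ell,j}:j=1,\dots,N_\ell\}$. *)

theory Defs
  imports "HOL-Analysis.Analysis"
begin

section \<open>Hausdorff measure, surface measure, Lipschitz domains\<close>

(* The empty set is treated separately because 0 ^ 0 = 1: this makes the
   zero-dimensional measure the counting measure, as needed for intervals. *)
definition hausdorff_content :: "nat \<Rightarrow> real \<Rightarrow> 'a::metric_space set \<Rightarrow> ennreal" where
  "hausdorff_content s \<delta> A =
     (INF C \<in> {C :: nat \<Rightarrow> 'a set. A \<subseteq> (\<Union>n. C n) \<and> (\<forall>n. bounded (C n) \<and> diameter (C n) \<le> \<delta>)}.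
        \<Sum>n. if C n = {} then 0 else ennreal (unit_ball_vol (real s) * (diameter (C n) / 2) ^ s))"

definition hausdorff_outer :: "nat \<Rightarrow> 'a::metric_space set \<Rightarrow> ennreal" where
  "hausdorff_outer s A = (SUP \<delta>\<in>{0<..}. hausdorff_content s \<delta> A)"

definition hausdorff_measure :: "nat \<Rightarrow> 'a::metric_space measure" where
  "hausdorff_measure s = measure_of UNIV (sets borel) (hausdorff_outer s)"

definition surface_measure :: "(real^'n) set \<Rightarrow> (real^'n) measure" where
  "surface_measure \<Gamma> = restrict_space (hausdorff_measure (CARD('n) - 1)) \<Gamma>"

(* Near each boundary point, D is the strict epigraph of a Lipschitz function in the
   direction of a unit vector e; the function is evaluated only at points orthogonal to e. *)
definition bounded_lipschitz_domain :: "(real^'n) set \<Rightarrow> bool" where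
  "bounded_lipschitz_domain D \<longleftrightarrow>
     open D \<and> connected D \<and> D \<noteq> {} \<and> bounded D \<and>
     (\<forall>p\<in>frontier D. \<exists>e r C. \<exists>\<gamma> :: real^'n \<Rightarrow> real.
        norm e = 1 \<and> r > 0 \<and> C-lipschitz_on UNIV \<gamma> \<and>
        (\<forall>x\<in>ball p r. x \<in> D \<longleftrightarrow> \<gamma> (x - (x \<bullet> e) *\<^sub>R e) < x \<bullet> e))"

definition boundary_decomposition ::
  "(real^'n) set \<Rightarrow> (real^'n) set \<Rightarrow> (real^'n) set \<Rightarrow> (real^'n) set \<Rightarrow> bool" where
  "boundary_decomposition D \<Gamma>D \<Gamma>N \<Gamma>R \<longleftrightarrow>
     frontier D = \<Gamma>D \<union> \<Gamma>N \<union> \<Gamma>R \<and> closed \<Gamma>D \<and> closed \<Gamma>N \<and> closed \<Gamma>R \<and>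
     (let X = top_of_set (frontier D) in
        (X interior_of \<Gamma>D) \<inter> (X interior_of \<Gamma>N) = {} \<and>
        (X interior_of \<Gamma>D) \<inter> (X interior_of \<Gamma>R) = {} \<and>
        (X interior_of \<Gamma>N) \<inter> (X interior_of \<Gamma>R) = {}) \<and>
     emeasure (surface_measure \<Gamma>R) \<Gamma>R > 0"


section \<open>Square-integrable functions\<close>

(* Elements of Lebesgue and Sobolev spaces are represented by functions on the whole
   space; only the values almost everywhere with respect to the measure matter. *)
definition sqnorm :: "'a measure \<Rightarrow> ('a \<Rightarrow> 'b::real_normed_vector) \<Rightarrow> ennreal" where
  "sqnorm M f = (\<integral>\<^sup>+ x. ennreal ((norm (f x))\<^sup>2) \<partial>M)"

definition L2 :: "'a measure \<Rightarrow> ('a \<Rightarrow> 'b::real_normed_vector) set" where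
  "L2 M = {f \<in> borel_measurable M. sqnorm M f < \<infinity>}"

definition l2_inner :: "'a measure \<Rightarrow> ('a \<Rightarrow> complex) \<Rightarrow> ('a \<Rightarrow> complex) \<Rightarrow> complex" where
  "l2_inner M u v = (LINT x|M. u x * cnj (v x))"

definition l2_inner_vec ::
  "'a measure \<Rightarrow> ('a \<Rightarrow> complex^'n) \<Rightarrow> ('a \<Rightarrow> complex^'n) \<Rightarrow> complex" where
  "l2_inner_vec M F G = (LINT x|M. (\<Sum>k\<in>UNIV. F x $ k * cnj (G x $ k)))"

definition l2_projection ::
  "'a measure \<Rightarrow> ('a \<Rightarrow> complex) set \<Rightarrow> ('a \<Rightarrow> complex) \<Rightarrow> ('a \<Rightarrow> complex)" where
  "l2_projection M S u = (SOME p. p \<in> S \<and> (\<forall>q\<in>S. l2_inner M (\<lambda>x. u x - p x) q = 0))"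

definition cspan :: "('a \<Rightarrow> complex) set \<Rightarrow> ('a \<Rightarrow> complex) set" where
  "cspan B = {f. \<exists>A c. finite A \<and> A \<subseteq> B \<and> f = (\<lambda>x. \<Sum>g\<in>A. c g * g x)}"


section \<open>The Sobolev space, traces, and the Helmholtz form\<close>

definition test_function ::
  "(real^'n) set \<Rightarrow> (real^'n \<Rightarrow> real) \<Rightarrow> (real^'n \<Rightarrow> real^'n) \<Rightarrow> bool" where
  "test_function D \<phi> \<phi>' \<longleftrightarrow>
     (\<forall>x. (\<phi> has_derivative (\<lambda>h. \<phi>' x \<bullet> h)) (at x)) \<and> continuous_on UNIV \<phi>' \<and>
     compact (closure {x. \<phi> x \<noteq> 0}) \<and> closure {x. \<phi> x \<noteq> 0} \<subseteq> D"

definition has_weak_gradient ::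
  "(real^'n) set \<Rightarrow> (real^'n \<Rightarrow> complex) \<Rightarrow> (real^'n \<Rightarrow> complex^'n) \<Rightarrow> bool" where
  "has_weak_gradient D u g \<longleftrightarrow>
     (\<forall>\<phi> \<phi>' k. test_function D \<phi> \<phi>' \<longrightarrow>
        (LINT x|lebesgue_on D. u x * complex_of_real (\<phi>' x $ k)) =
        - (LINT x|lebesgue_on D. g x $ k * complex_of_real (\<phi> x)))"

definition W12 :: "(real^'n) set \<Rightarrow> (real^'n \<Rightarrow> complex) set" where
  "W12 D = {u \<in> L2 (lebesgue_on D). \<exists>g \<in> L2 (lebesgue_on D). has_weak_gradient D u g}"

definition weak_gradient ::
  "(real^'n) set \<Rightarrow> (real^'n \<Rightarrow> complex) \<Rightarrow> (real^'n \<Rightarrow> complex^'n)" where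
  "weak_gradient D u = (SOME g. g \<in> L2 (lebesgue_on D) \<and> has_weak_gradient D u g)"

(* The trace operator is the continuous extension of the restriction map from the
   W12 functions that are continuous up to the boundary (a dense subspace). *)
definition has_trace ::
  "(real^'n) set \<Rightarrow> (real^'n \<Rightarrow> complex) \<Rightarrow> (real^'n \<Rightarrow> complex) \<Rightarrow> bool" where
  "has_trace D u g \<longleftrightarrow>
     u \<in> W12 D \<and> g \<in> L2 (surface_measure (frontier D)) \<and>
     (\<exists>w :: nat \<Rightarrow> real^'n \<Rightarrow> complex.
        (\<forall>n. w n \<in> W12 D \<and> continuous_on (closure D) (w n)) \<and>
        (\<lambda>n. sqnorm (lebesgue_on D) (\<lambda>x. w n x - u x)) \<longlonglongrightarrow> 0 \<and>
        (\<lambda>n. sqnorm (lebesgue_on D) (\<lambda>x. weak_gradient D (w n) x - weak_gradient D u x)) \<longlonglongrightarrow> 0 \<and>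
        (\<lambda>n. sqnorm (surface_measure (frontier D)) (\<lambda>x. w n x - g x)) \<longlonglongrightarrow> 0)"

definition boundary_trace :: "(real^'n) set \<Rightarrow> (real^'n \<Rightarrow> complex) \<Rightarrow> (real^'n \<Rightarrow> complex)" where
  "boundary_trace D u = (SOME g. has_trace D u g)"

definition V_space :: "(real^'n) set \<Rightarrow> (real^'n) set \<Rightarrow> (real^'n \<Rightarrow> complex) set" where
  "V_space D \<Gamma>D =
     {v \<in> W12 D. \<exists>g. has_trace D v g \<and> (AE x in surface_measure \<Gamma>D. g x = 0)}"

definition helmholtz_form ::
  "(real^'n) set \<Rightarrow> (real^'n) set \<Rightarrow> real \<Rightarrow> (real^'n \<Rightarrow> complex) \<Rightarrow> (real^'n \<Rightarrow> complex) \<Rightarrow> complex"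
  where
  "helmholtz_form D \<Gamma>R \<kappa> u v =
     l2_inner_vec (lebesgue_on D) (weak_gradient D u) (weak_gradient D v)
     - (complex_of_real \<kappa>)\<^sup>2 * l2_inner (lebesgue_on D) u v
     - \<i> * complex_of_real \<kappa> * l2_inner (surface_measure \<Gamma>R) (boundary_trace D u) (boundary_trace D v)"


section \<open>Cartesian meshes\<close>

definition cube :: "real^'n \<Rightarrow> real \<Rightarrow> (real^'n) set" where
  "cube a H = cbox a (\<chi> k. a $ k + H)"

definition corner :: "(real^'n) set \<Rightarrow> real^'n" where
  "corner T = (\<chi> k. Inf ((\<lambda>x. x $ k) ` T))"

definition cartesian_mesh :: "(real^'n) set \<Rightarrow> real \<Rightarrow> (real^'n) set set \<Rightarrow> bool" where
  "cartesian_mesh D H \<T> \<longleftrightarrow>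
     H > 0 \<and> finite \<T> \<and> \<Union>\<T> = closure D \<and>
     (\<exists>a. \<forall>T\<in>\<T>. \<exists>z :: 'n \<Rightarrow> int. T = cube (\<chi> k. a $ k + H * real_of_int (z k)) H)"

definition uniform_refinement :: "real \<Rightarrow> (real^'n) set set \<Rightarrow> (real^'n) set set" where
  "uniform_refinement H \<T> =
     {cube (\<chi> k. corner T $ k + H / 2 * real (j k)) (H / 2) | T j. T \<in> \<T> \<and> range j \<subseteq> {0, 1}}"

(* Levels are counted from 1, so that level 1 is the initial mesh. *)
definition mesh_size :: "real \<Rightarrow> nat \<Rightarrow> real" where
  "mesh_size H1 l = H1 / 2 ^ (l - 1)"

primrec refine_times :: "real \<Rightarrow> (real^'n) set set \<Rightarrow> nat \<Rightarrow> (real^'n) set set" where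
  "refine_times H1 \<T>1 0 = \<T>1"
| "refine_times H1 \<T>1 (Suc m) = uniform_refinement (mesh_size H1 (Suc m)) (refine_times H1 \<T>1 m)"

definition mesh :: "real \<Rightarrow> (real^'n) set set \<Rightarrow> nat \<Rightarrow> (real^'n) set set" where
  "mesh H1 \<T>1 l = refine_times H1 \<T>1 (l - 1)"

(* Coefficients instead of values: neighbouring closed cubes overlap in a null set. *)
definition Q0 :: "(real^'n) set \<Rightarrow> (real^'n) set set \<Rightarrow> (real^'n \<Rightarrow> complex) set" where
  "Q0 D \<T> = {q. \<exists>c. AE x in lebesgue_on D. q x = (\<Sum>T\<in>\<T>. c T * indicator T x)}"

definition W_space ::
  "(real^'n) set \<Rightarrow> (real^'n) set \<Rightarrow> (real^'n) set set \<Rightarrow> (real^'n \<Rightarrow> complex) set" where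
  "W_space D \<Gamma>D \<T> =
     {w \<in> V_space D \<Gamma>D. AE x in lebesgue_on D. l2_projection (lebesgue_on D) (Q0 D \<T>) w x = 0}"


section \<open>Haar functions and bubbles\<close>

definition haar1d :: "nat \<Rightarrow> real \<Rightarrow> real" where
  "haar1d j x =
     (if j = 0 then indicator {0..1} x
      else indicator {0..1} (2 * x) - indicator {0..1} (2 * x - 1))"

definition haar_basis ::
  "real \<Rightarrow> (real^'n) set set \<Rightarrow> nat \<Rightarrow> (real^'n \<Rightarrow> complex) set" where
  "haar_basis H1 \<T>1 l =
     (if l = 1 then
        {(\<lambda>x. complex_of_real (indicator T x / sqrt (measure lebesgue T))) | T. T \<in> mesh H1 \<T>1 1}
      else
        {(\<lambda>x. complex_of_real
             ((\<Prod>k\<in>UNIV. haar1d (j k) ((x $ k - corner T $ k) / mesh_size H1 (l - 1)))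
               / sqrt (measure lebesgue T))) | T j.
           T \<in> mesh H1 \<T>1 (l - 1) \<and> range j \<subseteq> {0, 1} \<and> j \<noteq> (\<lambda>_. 0)})"

definition bubble1d :: "real \<Rightarrow> real" where
  "bubble1d t = 6 * t * (1 - t) * indicator {0..1} t"

definition bubble :: "real \<Rightarrow> (real^'n) set \<Rightarrow> real^'n \<Rightarrow> complex" where
  "bubble H T x = complex_of_real (\<Prod>k\<in>UNIV. bubble1d ((x $ k - corner T $ k) / H))"

(* The coefficients of q are unique, as all mesh cells have positive measure in D. *)
definition bubble_operator ::
  "(real^'n) set \<Rightarrow> real \<Rightarrow> (real^'n) set set \<Rightarrow> (real^'n \<Rightarrow> complex) \<Rightarrow> (real^'n \<Rightarrow> complex)" where
  "bubble_operator D H \<T> q =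
     (THE v. \<exists>c. (AE x in lebesgue_on D. q x = (\<Sum>T\<in>\<T>. c T * indicator T x)) \<and>
                 v = (\<lambda>x. \<Sum>T\<in>\<T>. c T * bubble H T x))"


section \<open>Correctors, trial and test spaces\<close>

(* A corrector image is an element of a Sobolev space, that is, a class of functions that
   agree almost everywhere; it is represented by the set of all members of that class. *)
definition corrector ::
  "(real^'n) set \<Rightarrow> (real^'n) set \<Rightarrow> (real^'n) set \<Rightarrow> real \<Rightarrow> (real^'n) set set \<Rightarrow>
   (real^'n \<Rightarrow> complex) \<Rightarrow> (real^'n \<Rightarrow> complex) set" where
  "corrector D \<Gamma>D \<Gamma>R \<kappa> \<T> v =
     {c \<in> W_space D \<Gamma>D \<T>. \<forall>w \<in> W_space D \<Gamma>D \<T>.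
        helmholtz_form D \<Gamma>R \<kappa> c w = helmholtz_form D \<Gamma>R \<kappa> v w}"

definition adjoint_corrector ::
  "(real^'n) set \<Rightarrow> (real^'n) set \<Rightarrow> (real^'n) set \<Rightarrow> real \<Rightarrow> (real^'n) set set \<Rightarrow>
   (real^'n \<Rightarrow> complex) \<Rightarrow> (real^'n \<Rightarrow> complex) set" where
  "adjoint_corrector D \<Gamma>D \<Gamma>R \<kappa> \<T> v =
     {c \<in> W_space D \<Gamma>D \<T>. \<forall>w \<in> W_space D \<Gamma>D \<T>.
        helmholtz_form D \<Gamma>R \<kappa> w c = helmholtz_form D \<Gamma>R \<kappa> w v}"

definition trial_space ::
  "(real^'n) set \<Rightarrow> (real^'n) set \<Rightarrow> (real^'n) set \<Rightarrow> real \<Rightarrow> real \<Rightarrow> (real^'n) set set \<Rightarrow> nat \<Rightarrow>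
   (real^'n \<Rightarrow> complex) set" where
  "trial_space D \<Gamma>D \<Gamma>R \<kappa> H1 \<T>1 l =
     cspan {(\<lambda>x. v x - c x) | \<phi> v c.
       \<phi> \<in> haar_basis H1 \<T>1 l \<and> v = bubble_operator D (mesh_size H1 l) (mesh H1 \<T>1 l) \<phi> \<and>
       c \<in> corrector D \<Gamma>D \<Gamma>R \<kappa> (mesh H1 \<T>1 l) v}"

definition test_space ::
  "(real^'n) set \<Rightarrow> (real^'n) set \<Rightarrow> (real^'n) set \<Rightarrow> real \<Rightarrow> real \<Rightarrow> (real^'n) set set \<Rightarrow> nat \<Rightarrow>
   (real^'n \<Rightarrow> complex) set" where
  "test_space D \<Gamma>D \<Gamma>R \<kappa> H1 \<T>1 l =
     cspan {(\<lambda>x. v x - c x) | \<phi> v c.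
       \<phi> \<in> haar_basis H1 \<T>1 l \<and> v = bubble_operator D (mesh_size H1 l) (mesh H1 \<T>1 l) \<phi> \<and>
       c \<in> adjoint_corrector D \<Gamma>D \<Gamma>R \<kappa> (mesh H1 \<T>1 l) v}"

end

theory Submission
  imports Defs
begin

text \<open>
  Let \<open>k < l\<close>; the other case is symmetric. A generator of the test space of level \<open>l\<close> is
  \<open>\<psi> = w - d\<close>, where \<open>w\<close> is the bubble function of a Haar function of level \<open>l\<close> and
  \<open>d\<close> is its adjoint corrector. The corrector has mean zero on the cells of level \<open>l\<close>, hence on
  the larger cells of level \<open>k\<close>. On each cell of level \<open>l\<close> the mean of \<open>w\<close> is a fixed multiple
  of the mean of the Haar function, and a Haar function of level \<open>l\<close> has mean zero on all coarser
  cells. So \<open>\<psi>\<close> lies in the kernel \<open>W_k\<close> of the projection of level \<open>k\<close>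
  (\<open>corrected_bubble_in_coarse_W\<close>), and a generator \<open>v - c\<close> of the trial space of level \<open>k\<close>
  satisfies \<open>a (v - c, \<psi>) = 0\<close> by the definition of the corrector
  (\<open>generators_orthogonal\<close>). Sesquilinearity extends this to the spans.

  This short argument presupposes facts that are usually taken for granted. Weak gradients, traces
  and projections are chosen representatives, so they respect linear combinations only because they
  are unique up to null sets.

  \<^item> Weak gradients are unique by the fundamental lemma of the calculus of variations.

  \<^item> Traces are unique because restriction to the boundary is closable: if continuous \<open>w\<^sub>n\<close>
    tend to \<open>0\<close> in \<open>W12\<close> and to \<open>g\<close> in \<open>L2\<close> of the boundary, then \<open>g = 0\<close>. The closure of the
    domain is a union of lattice cubes, so cube faces cover the boundary. Covering by small
    faces the set where \<open>\<bar>w\<bar>\<close> exceeds \<open>\<epsilon>\<close>, and testing the weak gradient in the column behind each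
    small face, bounds the Hausdorff measure of this set by the \<open>W12\<close> norm of \<open>w\<close>
    (\<open>weak_trace_inequality\<close>).

  \<^item> Bubble functions lie in the energy space: integration by parts against them is the statement
    that a directional derivative of a compactly supported Lipschitz function has integral zero
    (\<open>integral_directional_derivative_eq_0\<close>).

  \<^item> Membership in \<open>W_l\<close> means vanishing integrals over all cells (\<open>W_space_iff\<close>), which turns
    the comparison of levels into the nesting of lattice cells.
\<close>

section \<open>Square-integrable functions\<close>

lemma sqnorm_cong_AE:
  "(AE x in M. f x = g x) \<Longrightarrow> sqnorm M f = sqnorm M g"
  unfolding sqnorm_def by (rule nn_integral_cong_AE) auto

lemma sqnorm_add_le:
  fixes f g :: "'a \<Rightarrow> 'b::{real_normed_vector, second_countable_topology}"
  assumes [measurable]: "f \<in> borel_measurable M" "g \<in> borel_measurable M"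
  shows "sqnorm M (\<lambda>x. f x + g x) \<le> 2 * sqnorm M f + 2 * sqnorm M g"
proof -
  have pt: "ennreal ((norm (a + b))\<^sup>2) \<le> 2 * ennreal ((norm a)\<^sup>2) + 2 * ennreal ((norm b)\<^sup>2)" for a b :: 'b
  proof -
    have "(norm (a + b))\<^sup>2 \<le> (norm a + norm b)\<^sup>2"
      by (intro power_mono norm_triangle_ineq) auto
    also have "\<dots> \<le> 2 * (norm a)\<^sup>2 + 2 * (norm b)\<^sup>2"
      using zero_le_power2[of "norm a - norm b"] by (simp add: power2_eq_square algebra_simps)
    finally have "ennreal ((norm (a + b))\<^sup>2) \<le> ennreal (2 * (norm a)\<^sup>2 + 2 * (norm b)\<^sup>2)"
      by (rule ennreal_leI)
    then show ?thesis
      by (simp add: ennreal_plus ennreal_mult)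
  qed
  have "sqnorm M (\<lambda>x. f x + g x) \<le> (\<integral>\<^sup>+ x. 2 * ennreal ((norm (f x))\<^sup>2) + 2 * ennreal ((norm (g x))\<^sup>2) \<partial>M)"
    unfolding sqnorm_def by (intro nn_integral_mono pt)
  also have "\<dots> = 2 * sqnorm M f + 2 * sqnorm M g"
    unfolding sqnorm_def by (subst nn_integral_add) (auto simp: nn_integral_cmult)
  finally show ?thesis .
qed

lemma norm_vector_scalar_mult: "norm (\<alpha> *s v) = norm \<alpha> * norm (v :: complex^'n)"
  by (simp add: norm_vec_def norm_mult L2_set_right_distrib)

lemma measurable_vector_scalar_mult [measurable]:
  fixes g :: "'a \<Rightarrow> complex^'n"
  assumes [measurable]: "g \<in> borel_measurable M"
  shows "(\<lambda>x. \<alpha> *s g x) \<in> borel_measurable M"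
proof -
  have "continuous_on UNIV (\<lambda>v :: complex^'n. \<alpha> *s v)"
    unfolding vector_scalar_mult_def by (intro continuous_intros)
  then have [measurable]: "(\<lambda>v :: complex^'n. \<alpha> *s v) \<in> borel_measurable borel"
    by (rule borel_measurable_continuous_onI)
  show ?thesis by measurable
qed

lemma measurable_vec_component [measurable]:
  fixes g :: "'a \<Rightarrow> 'b::euclidean_space^'n"
  assumes [measurable]: "g \<in> borel_measurable M"
  shows "(\<lambda>x. g x $ k) \<in> borel_measurable M"
proof -
  have "continuous_on UNIV (\<lambda>v :: 'b^'n. v $ k)"
    by (intro continuous_intros)
  then have [measurable]: "(\<lambda>v :: 'b^'n. v $ k) \<in> borel_measurable borel"
    by (rule borel_measurable_continuous_onI)
  show ?thesis by measurable
qed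

lemma sqnorm_cmult:
  fixes f :: "'a \<Rightarrow> complex"
  assumes [measurable]: "f \<in> borel_measurable M"
  shows "sqnorm M (\<lambda>x. \<alpha> * f x) = ennreal ((norm \<alpha>)\<^sup>2) * sqnorm M f"
  unfolding sqnorm_def
  by (subst nn_integral_cmult[symmetric]) (auto simp: norm_mult power_mult_distrib ennreal_mult)

lemma sqnorm_vec_cmult:
  fixes f :: "'a \<Rightarrow> complex^'n"
  assumes [measurable]: "f \<in> borel_measurable M"
  shows "sqnorm M (\<lambda>x. \<alpha> *s f x) = ennreal ((norm \<alpha>)\<^sup>2) * sqnorm M f"
  unfolding sqnorm_def
  by (subst nn_integral_cmult[symmetric])
     (auto simp: norm_vector_scalar_mult power_mult_distrib ennreal_mult)

lemma L2_measurable [measurable_dest]: "f \<in> L2 M \<Longrightarrow> f \<in> borel_measurable M"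
  by (simp add: L2_def)

lemma L2_add:
  fixes f g :: "'a \<Rightarrow> 'b::{real_normed_vector, second_countable_topology}"
  assumes f: "f \<in> L2 M" and g: "g \<in> L2 M"
  shows "(\<lambda>x. f x + g x) \<in> L2 M"
proof -
  have [measurable]: "f \<in> borel_measurable M" "g \<in> borel_measurable M"
    using f g by auto
  have "sqnorm M (\<lambda>x. f x + g x) \<le> 2 * sqnorm M f + 2 * sqnorm M g"
    by (rule sqnorm_add_le) auto
  also have "\<dots> < \<infinity>"
    using f g by (auto simp: L2_def ennreal_mult_less_top)
  finally show ?thesis by (simp add: L2_def)
qed

lemma L2_lincomb:
  fixes f g :: "'a \<Rightarrow> complex"
  assumes f: "f \<in> L2 M" and g: "g \<in> L2 M"
  shows "(\<lambda>x. f x + \<alpha> * g x) \<in> L2 M"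
  using assms by (intro L2_add) (auto simp: L2_def sqnorm_cmult ennreal_mult_less_top)

lemma L2_vec_lincomb:
  fixes f g :: "'a \<Rightarrow> complex^'n"
  assumes f: "f \<in> L2 M" and g: "g \<in> L2 M"
  shows "(\<lambda>x. f x + \<alpha> *s g x) \<in> L2 M"
  using assms by (intro L2_add) (auto simp: L2_def sqnorm_vec_cmult ennreal_mult_less_top)

lemma L2_bound:
  fixes f :: "'a \<Rightarrow> 'b::real_normed_vector" and g :: "'a \<Rightarrow> 'c::real_normed_vector"
  assumes g: "g \<in> L2 M" and f: "f \<in> borel_measurable M"
    and le: "AE x in M. norm (f x) \<le> norm (g x)"
  shows "f \<in> L2 M"
proof -
  have "sqnorm M f \<le> sqnorm M g"
    unfolding sqnorm_def using le
    by (intro nn_integral_mono_AE) (auto elim!: eventually_mono intro!: ennreal_leI power_mono)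
  also have "\<dots> < \<infinity>" using g by (simp add: L2_def)
  finally show ?thesis using f by (simp add: L2_def)
qed

lemma L2_component:
  fixes f :: "'a \<Rightarrow> complex^'n"
  assumes "f \<in> L2 M"
  shows "(\<lambda>x. f x $ k) \<in> L2 M"
  using assms by (intro L2_bound[OF assms]) (auto simp: L2_def Finite_Cartesian_Product.norm_nth_le)

lemma measurable_cnj [measurable]:
  assumes [measurable]: "f \<in> borel_measurable M"
  shows "(\<lambda>x. cnj (f x)) \<in> borel_measurable M"
proof -
  have [measurable]: "cnj \<in> borel_measurable borel"
    by (intro borel_measurable_continuous_onI continuous_intros)
  show ?thesis by measurable
qed

lemma L2_cnj: "f \<in> L2 M \<Longrightarrow> (\<lambda>x. cnj (f x)) \<in> L2 M"
  by (rule L2_bound) (auto simp: L2_def)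

lemma L2_mult_integrable:
  fixes f g :: "'a \<Rightarrow> complex"
  assumes f: "f \<in> L2 M" and g: "g \<in> L2 M"
  shows "integrable M (\<lambda>x. f x * g x)"
proof (rule integrableI_bounded)
  have [measurable]: "f \<in> borel_measurable M" "g \<in> borel_measurable M"
    using f g by auto
  show "(\<lambda>x. f x * g x) \<in> borel_measurable M" by measurable
  have pt: "ennreal (norm (a * b)) \<le> ennreal ((norm a)\<^sup>2) + ennreal ((norm b)\<^sup>2)" for a b :: complex
  proof -
    have "norm (a * b) \<le> (norm a)\<^sup>2 + (norm b)\<^sup>2"
    proof -
      have "0 \<le> norm a * norm b" "2 * (norm a * norm b) \<le> (norm a)\<^sup>2 + (norm b)\<^sup>2"
        using zero_le_power2[of "norm a - norm b"] by (auto simp: power2_diff)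
      then show ?thesis unfolding norm_mult by linarith
    qed
    then have "ennreal (norm (a * b)) \<le> ennreal ((norm a)\<^sup>2 + (norm b)\<^sup>2)"
      by (rule ennreal_leI)
    then show ?thesis by (simp add: ennreal_plus)
  qed
  have "(\<integral>\<^sup>+ x. ennreal (norm (f x * g x)) \<partial>M) \<le> (\<integral>\<^sup>+ x. ennreal ((norm (f x))\<^sup>2) + ennreal ((norm (g x))\<^sup>2) \<partial>M)"
    by (intro nn_integral_mono pt)
  also have "\<dots> = sqnorm M f + sqnorm M g"
    unfolding sqnorm_def by (rule nn_integral_add) auto
  also have "\<dots> < \<infinity>"
    using f g by (auto simp: L2_def)
  finally show "(\<integral>\<^sup>+ x. ennreal (norm (f x * g x)) \<partial>M) < \<infinity>" .
qed

lemma L2_bounded: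
  fixes f :: "'a \<Rightarrow> 'b::real_normed_vector"
  assumes fin: "emeasure M (space M) < \<infinity>" and f: "f \<in> borel_measurable M"
    and le: "\<And>x. x \<in> space M \<Longrightarrow> norm (f x) \<le> B"
  shows "f \<in> L2 M"
proof -
  have "sqnorm M f \<le> (\<integral>\<^sup>+ x. ennreal (B\<^sup>2) \<partial>M)"
    unfolding sqnorm_def using le
    by (intro nn_integral_mono) (auto intro!: ennreal_leI power_mono)
  also have "\<dots> < \<infinity>" using fin by (simp add: ennreal_mult_less_top)
  finally show ?thesis using f by (simp add: L2_def)
qed

lemma L2_integrable:
  fixes f :: "'a \<Rightarrow> complex"
  assumes fin: "emeasure M (space M) < \<infinity>" and f: "f \<in> L2 M"
  shows "integrable M f"
  using L2_mult_integrable[OF f L2_bounded[OF fin, of "\<lambda>_. 1" 1]] by simp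

lemma L2_restrict:
  fixes f :: "'a \<Rightarrow> 'b::{real_normed_vector, second_countable_topology}"
  assumes f: "f \<in> L2 (restrict_space M A)" and A: "A \<in> sets M" and B: "B \<in> sets M" and sub: "B \<subseteq> A"
  shows "f \<in> L2 (restrict_space M B)"
proof -
  have "restrict_space M B = restrict_space (restrict_space M A) B"
    using A B sub sets.sets_into_space[OF A]
    by (subst restrict_restrict_space) (auto simp: Int_absorb1 inf.absorb2)
  moreover have "f \<in> borel_measurable (restrict_space (restrict_space M A) B)"
    by (intro measurable_restrict_space1 L2_measurable f)
  moreover have "sqnorm (restrict_space M B) f \<le> sqnorm (restrict_space M A) f"
    using A B sub unfolding sqnorm_def
    by (subst (1 2) nn_integral_restrict_space) (auto intro!: nn_integral_mono split: split_indicator)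
  ultimately show ?thesis
    using f by (auto simp: L2_def)
qed

lemma l2_inner_lincomb_left:
  assumes "u \<in> L2 M" "v \<in> L2 M" "w \<in> L2 M"
  shows "l2_inner M (\<lambda>x. u x + \<alpha> * v x) w = l2_inner M u w + \<alpha> * l2_inner M v w"
  using L2_mult_integrable[OF assms(1) L2_cnj[OF assms(3)]] L2_mult_integrable[OF assms(2) L2_cnj[OF assms(3)]]
  by (simp add: l2_inner_def distrib_right mult.assoc)

lemma l2_inner_lincomb_right:
  assumes "u \<in> L2 M" "v \<in> L2 M" "w \<in> L2 M"
  shows "l2_inner M w (\<lambda>x. u x + \<alpha> * v x) = l2_inner M w u + cnj \<alpha> * l2_inner M w v"
  using L2_mult_integrable[OF assms(3) L2_cnj[OF assms(1)]] L2_mult_integrable[OF assms(3) L2_cnj[OF assms(2)]]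
  by (simp add: l2_inner_def distrib_left mult.left_commute[of _ "cnj \<alpha>"])

lemma l2_inner_vec_sum:
  assumes "F \<in> L2 M" "G \<in> L2 M"
  shows "l2_inner_vec M F G = (\<Sum>k\<in>UNIV. l2_inner M (\<lambda>x. F x $ k) (\<lambda>x. G x $ k))"
  unfolding l2_inner_vec_def l2_inner_def
  using L2_mult_integrable[OF L2_component[OF assms(1)] L2_cnj[OF L2_component[OF assms(2)]]]
  by (intro Bochner_Integration.integral_sum) auto

lemma l2_inner_vec_lincomb_left:
  assumes "u \<in> L2 M" "v \<in> L2 M" "w \<in> L2 M"
  shows "l2_inner_vec M (\<lambda>x. u x + \<alpha> *s v x) w = l2_inner_vec M u w + \<alpha> * l2_inner_vec M v w"
  using assms
  by (simp add: l2_inner_vec_sum L2_vec_lincomb l2_inner_lincomb_left L2_component sum.distrib sum_distrib_left)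

lemma l2_inner_vec_lincomb_right:
  assumes "u \<in> L2 M" "v \<in> L2 M" "w \<in> L2 M"
  shows "l2_inner_vec M w (\<lambda>x. u x + \<alpha> *s v x) = l2_inner_vec M w u + cnj \<alpha> * l2_inner_vec M w v"
  using assms
  by (simp add: l2_inner_vec_sum L2_vec_lincomb l2_inner_lincomb_right L2_component sum.distrib sum_distrib_left)

lemma l2_inner_cong_AE:
  assumes "AE x in M. u x = u' x" "AE x in M. v x = v' x"
    and [measurable]: "u \<in> borel_measurable M" "u' \<in> borel_measurable M" "v \<in> borel_measurable M" "v' \<in> borel_measurable M"
  shows "l2_inner M u v = l2_inner M u' v'"
  unfolding l2_inner_def using assms(1,2) by (intro integral_cong_AE) auto

lemma l2_inner_vec_cong_AE:
  assumes "AE x in M. u x = u' x" "AE x in M. v x = v' x"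
    and [measurable]: "u \<in> borel_measurable M" "u' \<in> borel_measurable M" "v \<in> borel_measurable M" "v' \<in> borel_measurable M"
  shows "l2_inner_vec M u v = l2_inner_vec M u' v'"
  unfolding l2_inner_vec_def using assms(1,2) by (intro integral_cong_AE) auto

section \<open>Test functions and weak gradients\<close>

text \<open>A \<open>C\<^sup>1\<close> transition from \<open>0\<close> to \<open>1\<close> across \<open>[0, 1]\<close>: it equals \<open>3 t\<^sup>2 - 2 t\<^sup>3\<close> there.
  Writing it with squares of positive parts makes the differentiability at the two joints a consequence
  of \<open>DERIV_max_square\<close>.\<close>

definition smoothstep :: "real \<Rightarrow> real" where
  "smoothstep t = (3 - 2 * t) * (max 0 t)\<^sup>2 + (2 * t + 1) * (max 0 (t - 1))\<^sup>2"

definition smoothstep_deriv :: "real \<Rightarrow> real" where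
  "smoothstep_deriv t = 6 * max 0 (min 1 t) * (1 - max 0 (min 1 t))"

lemma DERIV_max_square: "((\<lambda>t. (max 0 t)\<^sup>2) has_real_derivative 2 * max 0 t) (at t)"
proof -
  consider "t < 0" | "t = 0" | "t > 0" by linarith
  then show ?thesis
  proof cases
    case 1
    have "\<forall>\<^sub>F x in nhds t. x \<in> {..<0}"
      using 1 by (intro eventually_nhds_in_open) auto
    then have ev: "\<forall>\<^sub>F x in nhds t. (max 0 x)\<^sup>2 = 0"
      by eventually_elim (auto simp: max_def)
    show ?thesis
      using 1 by (subst DERIV_cong_ev[OF refl ev refl]) auto
  next
    case 2
    have "((\<lambda>h. (max 0 h)\<^sup>2 / h) \<longlongrightarrow> 0) (at (0::real))"
    proof (rule Lim_null_comparison)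
      show "\<forall>\<^sub>F h in at 0. norm ((max 0 h)\<^sup>2 / h) \<le> \<bar>h\<bar>"
        by (intro always_eventually) (auto simp: max_def power2_eq_square)
    qed (auto intro!: tendsto_eq_intros)
    then show ?thesis
      using 2 by (simp add: has_field_derivative_iff)
  next
    case 3
    have "\<forall>\<^sub>F x in nhds t. x \<in> {0<..}"
      using 3 by (intro eventually_nhds_in_open) auto
    then have ev: "\<forall>\<^sub>F x in nhds t. (max 0 x)\<^sup>2 = x\<^sup>2"
      by eventually_elim (auto simp: max_def)
    show ?thesis
      using 3 by (subst DERIV_cong_ev[OF refl ev refl]) (auto intro!: derivative_eq_intros)
  qed
qed

lemma smoothstep_simps:
  "t \<le> 0 \<Longrightarrow> smoothstep t = 0"
  "0 \<le> t \<Longrightarrow> t \<le> 1 \<Longrightarrow> smoothstep t = 3 * t\<^sup>2 - 2 * t ^ 3"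
  "1 \<le> t \<Longrightarrow> smoothstep t = 1"
  by (auto simp: smoothstep_def max_def power2_eq_square power3_eq_cube algebra_simps)

lemma DERIV_smoothstep: "(smoothstep has_real_derivative smoothstep_deriv t) (at t)"
proof -
  note [derivative_intros] = DERIV_chain'[OF _ DERIV_max_square]
  have "(smoothstep has_real_derivative
          (- 2 * (max 0 t)\<^sup>2 + (3 - 2 * t) * (2 * max 0 t) + 2 * (max 0 (t - 1))\<^sup>2 + (2 * t + 1) * (2 * max 0 (t - 1)))) (at t)"
    unfolding smoothstep_def by (auto intro!: derivative_eq_intros)
  moreover have "- 2 * (max 0 t)\<^sup>2 + (3 - 2 * t) * (2 * max 0 t) + 2 * (max 0 (t - 1))\<^sup>2 + (2 * t + 1) * (2 * max 0 (t - 1))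
      = smoothstep_deriv t"
    by (auto simp: smoothstep_deriv_def max_def min_def power2_eq_square algebra_simps)
  ultimately show ?thesis by simp
qed

lemma continuous_smoothstep_deriv [continuous_intros]:
  "continuous_on A f \<Longrightarrow> continuous_on A (\<lambda>x. smoothstep_deriv (f x))"
  unfolding smoothstep_deriv_def by (intro continuous_intros)

lemma continuous_smoothstep [continuous_intros]:
  "continuous_on A f \<Longrightarrow> continuous_on A (\<lambda>x. smoothstep (f x))"
  unfolding smoothstep_def by (intro continuous_intros)

lemma smoothstep_deriv_nonneg: "0 \<le> smoothstep_deriv t"
  by (auto simp: smoothstep_deriv_def)

lemma smoothstep_deriv_le: "smoothstep_deriv t \<le> 3 / 2"
  using zero_le_power2[of "2 * max 0 (min 1 t) - 1"]
  by (simp add: smoothstep_deriv_def power2_eq_square algebra_simps)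

lemma smoothstep_deriv_ge:
  assumes "1/4 \<le> t" "t \<le> 3/4"
  shows "1 \<le> smoothstep_deriv t"
proof -
  have "0 \<le> (t - 1/4) * (3/4 - t)" using assms by simp
  moreover have "6 * t * (1 - t) = 6 * ((t - 1/4) * (3/4 - t)) + 9/8"
    by (simp add: field_simps)
  ultimately have "1 \<le> 6 * t * (1 - t)" by linarith
  then show ?thesis
    using assms by (simp add: smoothstep_deriv_def max_def min_def)
qed

lemma smoothstep_deriv_eq_0: "t \<le> 0 \<or> 1 \<le> t \<Longrightarrow> smoothstep_deriv t = 0"
  by (auto simp: smoothstep_deriv_def max_def min_def)

lemma smoothstep_mono: "mono smoothstep"
  by (intro monoI DERIV_nonneg_imp_nondecreasing[where f = smoothstep])
     (use DERIV_smoothstep smoothstep_deriv_nonneg in blast)+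

lemma smoothstep_bounds: "0 \<le> smoothstep t" "smoothstep t \<le> 1"
  using monoD[OF smoothstep_mono, of "min 0 t" t] monoD[OF smoothstep_mono, of t "max 1 t"]
    smoothstep_simps(1)[of "min 0 t"] smoothstep_simps(3)[of "max 1 t"] by auto

text \<open>All test functions constructed below are products of this kind.\<close>

lemma test_function_prod:
  fixes a b :: "real^'n"
  assumes der: "\<And>k t. (f k has_real_derivative f' k t) (at t)"
    and cont: "\<And>k. continuous_on UNIV (f' k)"
    and supp: "\<And>k t. f k t \<noteq> 0 \<Longrightarrow> a $ k \<le> t \<and> t \<le> b $ k"
    and sub: "cbox a b \<subseteq> D"
  shows "test_function D (\<lambda>x. \<Prod>k\<in>UNIV. f k (x $ k))
           (\<lambda>x. \<chi> k. f' k (x $ k) * (\<Prod>j\<in>UNIV - {k}. f j (x $ j)))"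
proof -
  have contf: "continuous_on UNIV (f k)" for k
    using der DERIV_continuous_on by blast
  have compf: "continuous_on UNIV (\<lambda>x :: real^'n. f k (x $ k))" for k
    by (intro continuous_on_compose2[OF contf]) (auto intro!: continuous_intros)
  have compf': "continuous_on UNIV (\<lambda>x :: real^'n. f' k (x $ k))" for k
    by (intro continuous_on_compose2[OF cont]) (auto intro!: continuous_intros)
  have 1: "((\<lambda>x. \<Prod>k\<in>UNIV. f k (x $ k)) has_derivative
      (\<lambda>h. (\<chi> k. f' k (x $ k) * (\<Prod>j\<in>UNIV - {k}. f j (x $ j))) \<bullet> h)) (at x)" for x :: "real^'n"
  proof -
    have "((\<lambda>x. f k (x $ k)) has_derivative (\<lambda>h. f' k (x $ k) * h $ k)) (at x)" for k
    proof -
      have "((\<lambda>x. x $ k) has_derivative (\<lambda>h. h $ k)) (at x)"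
        by (intro bounded_linear_imp_has_derivative bounded_linear_vec_nth)
      from has_derivative_compose[OF this, of "f k" "(*) (f' k (x $ k))"]
      show ?thesis using der[of k "x $ k"] by (simp add: has_field_derivative_def)
    qed
    then have "((\<lambda>x. \<Prod>k\<in>UNIV. f k (x $ k)) has_derivative
       (\<lambda>h. \<Sum>k\<in>UNIV. (f' k (x $ k) * h $ k) * (\<Prod>j\<in>UNIV - {k}. f j (x $ j)))) (at x)"
      by (intro has_derivative_prod)
    then show ?thesis
      by (simp add: inner_vec_def mult.assoc mult.commute[of _ "prod _ _"] mult.left_commute)
  qed
  have sub': "{x. (\<Prod>k\<in>UNIV. f k (x $ k)) \<noteq> 0} \<subseteq> cbox a b"
    using supp by (auto simp: mem_box_cart)
  then have "closure {x. (\<Prod>k\<in>UNIV. f k (x $ k)) \<noteq> 0} \<subseteq> cbox a b"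
    by (intro closure_minimal) auto
  then have "compact (closure {x. (\<Prod>k\<in>UNIV. f k (x $ k)) \<noteq> 0})"
    "closure {x. (\<Prod>k\<in>UNIV. f k (x $ k)) \<noteq> 0} \<subseteq> D"
    using sub bounded_subset[OF bounded_cbox sub'] by auto
  moreover have "continuous_on UNIV (\<lambda>x :: real^'n. \<chi> k. f' k (x $ k) * (\<Prod>j\<in>UNIV - {k}. f j (x $ j)))"
    by (intro continuous_intros continuous_on_prod compf compf')
  ultimately show ?thesis
    using 1 unfolding test_function_def by auto
qed

lemma test_function_continuous:
  assumes "test_function D \<phi> \<phi>'"
  shows "continuous_on UNIV \<phi>" "continuous_on UNIV \<phi>'"
  using assms has_derivative_continuous_on[of UNIV \<phi> "\<lambda>x. (\<bullet>) (\<phi>' x)"]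
  unfolding test_function_def by auto

text \<open>Outside the support the function vanishes in a neighbourhood, so its gradient vanishes as well.\<close>

lemma test_function_outside:
  assumes T: "test_function D \<phi> \<phi>'" and x: "x \<notin> D"
  shows "\<phi> x = 0" "\<phi>' x = 0"
proof -
  let ?K = "closure {x. \<phi> x \<noteq> 0}"
  have d: "(\<phi> has_derivative (\<lambda>h. \<phi>' x \<bullet> h)) (at x)" and K: "?K \<subseteq> D"
    using T by (auto simp: test_function_def)
  have ev: "\<phi> y = 0" if "y \<in> - ?K" for y
    using that closure_subset[of "{x. \<phi> x \<noteq> 0}"] by auto
  have "x \<in> - ?K" using K x by auto
  then show "\<phi> x = 0" by (rule ev)
  have "((\<lambda>_. 0) has_derivative (\<lambda>h. 0)) (at x)" by simp
  moreover have "open (- ?K)" by auto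
  ultimately have "(\<phi> has_derivative (\<lambda>h. 0)) (at x)"
    using \<open>x \<in> - ?K\<close> by (rule has_derivative_transform_within_open) (rule ev[symmetric])
  from has_derivative_unique[OF d this] have "\<phi>' x \<bullet> \<phi>' x = 0"
    by (rule fun_cong)
  then show "\<phi>' x = 0" by simp
qed

lemma test_function_bounded:
  assumes T: "test_function D \<phi> \<phi>'"
  obtains B where "\<And>x. \<bar>\<phi> x\<bar> \<le> B" "\<And>x. norm (\<phi>' x) \<le> B" "B > 0"
proof -
  let ?K = "closure {x. \<phi> x \<noteq> 0}"
  have K: "compact ?K" using T by (simp add: test_function_def)
  have out: "\<phi> x = 0" "\<phi>' x = 0" if "x \<notin> ?K" for x
    using test_function_outside[of ?K \<phi> \<phi>' x] T that by (auto simp: test_function_def)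
  have "compact (\<phi> ` ?K)" "compact (\<phi>' ` ?K)"
    using K test_function_continuous[OF T] by (auto intro!: compact_continuous_image intro: continuous_on_subset)
  then obtain B1 B2 where B: "\<And>y. y \<in> \<phi> ` ?K \<Longrightarrow> norm y \<le> B1" "\<And>y. y \<in> \<phi>' ` ?K \<Longrightarrow> norm y \<le> B2"
    by (meson compact_imp_bounded bounded_iff)
  show ?thesis
  proof
    show "\<bar>\<phi> x\<bar> \<le> max 1 (max B1 B2)" for x
      using out[of x] B(1)[of "\<phi> x"] by (cases "x \<in> ?K") auto
    show "norm (\<phi>' x) \<le> max 1 (max B1 B2)" for x
      using out[of x] B(2)[of "\<phi>' x"] by (cases "x \<in> ?K") auto
  qed simp
qed

lemma measurable_lebesgue_on_continuous:
  fixes f :: "'a::euclidean_space \<Rightarrow> 'b::real_normed_vector"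
  assumes "continuous_on UNIV f"
  shows "f \<in> borel_measurable (lebesgue_on D)"
proof -
  have "f \<in> borel_measurable lborel"
    using borel_measurable_continuous_onI[OF assms] by simp
  then show ?thesis
    by (intro measurable_restrict_space1 measurable_completion)
qed

lemma test_function_L2:
  fixes D :: "(real^'n) set"
  assumes T: "test_function D \<phi> \<phi>'" and fin: "emeasure (lebesgue_on D) (space (lebesgue_on D)) < \<infinity>"
  shows "(\<lambda>x. complex_of_real (\<phi> x)) \<in> L2 (lebesgue_on D)"
    "(\<lambda>x. complex_of_real (\<phi>' x $ k)) \<in> L2 (lebesgue_on D)"
proof -
  obtain B where B: "\<And>x. \<bar>\<phi> x\<bar> \<le> B" "\<And>x. norm (\<phi>' x) \<le> B"
    using test_function_bounded[OF T] by metis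
  show "(\<lambda>x. complex_of_real (\<phi> x)) \<in> L2 (lebesgue_on D)"
    using B(1) test_function_continuous[OF T]
    by (intro L2_bounded[OF fin, of _ B] measurable_lebesgue_on_continuous) (auto intro!: continuous_intros)
  show "(\<lambda>x. complex_of_real (\<phi>' x $ k)) \<in> L2 (lebesgue_on D)"
    using order_trans[OF component_le_norm_cart B(2)] test_function_continuous[OF T]
    by (intro L2_bounded[OF fin, of _ B] measurable_lebesgue_on_continuous) (auto intro!: continuous_intros)
qed

lemma emeasure_lebesgue_on_finite:
  fixes D :: "'a::euclidean_space set"
  assumes "open D" "bounded D"
  shows "emeasure (lebesgue_on D) (space (lebesgue_on D)) < \<infinity>"
proof -
  have "emeasure (lebesgue_on D) (space (lebesgue_on D)) = emeasure lebesgue D"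
    using assms by (subst emeasure_restrict_space) auto
  also have "\<dots> < \<infinity>"
    using emeasure_bounded_finite[OF assms(2)] assms by simp
  finally show ?thesis .
qed

text \<open>A \<open>C\<^sup>1\<close> approximation from below of the indicator function of a box.\<close>

definition box_bump :: "real^'n \<Rightarrow> real^'n \<Rightarrow> nat \<Rightarrow> real^'n \<Rightarrow> real" where
  "box_bump a b n x = (\<Prod>k\<in>UNIV. smoothstep (real n * (x $ k - a $ k)) * smoothstep (real n * (b $ k - x $ k)))"

lemma test_function_box_bump:
  assumes "cbox a b \<subseteq> D"
  obtains \<phi>' where "test_function D (box_bump a b n) \<phi>'"
proof -
  note [derivative_intros] = DERIV_chain'[OF _ DERIV_smoothstep]
  have "\<exists>\<phi>'. test_function D (box_bump a b n) \<phi>'"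
    unfolding box_bump_def[abs_def]
    by (rule exI, rule test_function_prod[where a = a and b = b
          and f' = "\<lambda>k t. smoothstep_deriv (real n * (t - a $ k)) * real n * smoothstep (real n * (b $ k - t))
             - smoothstep (real n * (t - a $ k)) * (smoothstep_deriv (real n * (b $ k - t)) * real n)"])
       (use assms smoothstep_simps(1) in \<open>auto intro!: derivative_eq_intros continuous_intros simp: mult_nonneg_nonpos not_le less_imp_le simp del: of_nat_0_le_iff
          intro: ccontr\<close>)
  then show ?thesis using that by blast
qed

lemma box_bump_bounds: "0 \<le> box_bump a b n x" "box_bump a b n x \<le> 1"
  unfolding box_bump_def using smoothstep_bounds
  by (auto intro!: prod_nonneg prod_le_1 mult_le_one)

lemma box_bump_tendsto: "(\<lambda>n. box_bump a b n x) \<longlonglongrightarrow> indicator (box a b) x"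
proof -
  have 1: "(\<lambda>n. smoothstep (real n * t)) \<longlonglongrightarrow> (if 0 < t then 1 else 0)" for t
  proof (cases "0 < t")
    case True
    obtain N where N: "1 / t \<le> real N" using real_arch_simple by blast
    have "smoothstep (real n * t) = 1" if "N \<le> n" for n
    proof (rule smoothstep_simps(3))
      have "1 / t \<le> real n" using N that by linarith
      then show "1 \<le> real n * t" using True by (simp add: field_simps)
    qed
    then show ?thesis
      using True by (auto intro!: tendsto_eventually eventually_sequentiallyI)
  next
    case False
    then have "smoothstep (real n * t) = 0" for n
      by (intro smoothstep_simps(1)) (auto simp: mult_nonneg_nonpos)
    then show ?thesis using False by simp
  qed
  have "(\<lambda>n. box_bump a b n x) \<longlonglongrightarrow> (\<Prod>k\<in>UNIV. (if 0 < x $ k - a $ k then 1 else 0) * (if 0 < b $ k - x $ k then 1 else 0))"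
    unfolding box_bump_def by (intro tendsto_intros 1)
  also have "(\<Prod>k\<in>UNIV. (if 0 < x $ k - a $ k then 1 else 0) * (if 0 < b $ k - x $ k then 1 else 0)) = indicat_real (box a b) x"
    by (auto simp: indicator_def mem_box_cart)
  finally show ?thesis .
qed

lemma integral_box_eq_0:
  fixes f :: "real^'n \<Rightarrow> complex"
  assumes D: "open D" and f: "integrable (lebesgue_on D) f"
    and test: "\<And>\<phi> \<phi>'. test_function D \<phi> \<phi>' \<Longrightarrow> (LINT x|lebesgue_on D. f x * complex_of_real (\<phi> x)) = 0"
    and sub: "cbox a b \<subseteq> D"
  shows "(LINT x|lebesgue_on D. indicator (box a b) x *\<^sub>R f x) = 0"
proof -
  have cont: "continuous_on UNIV (box_bump a b n)" for n
    using test_function_box_bump[OF sub] test_function_continuous(1) by metis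
  have [measurable]: "box_bump a b n \<in> borel_measurable (lebesgue_on D)" for n
    by (rule measurable_lebesgue_on_continuous[OF cont])
  have [measurable]: "f \<in> borel_measurable (lebesgue_on D)" using f by auto
  have [measurable]: "box a b \<inter> D \<in> sets (lebesgue_on D)" 
    using D by (subst sets_restrict_space_iff) auto
  have "(\<lambda>n. LINT x|lebesgue_on D. f x * complex_of_real (box_bump a b n x)) \<longlonglongrightarrow>
     (LINT x|lebesgue_on D. indicator (box a b) x *\<^sub>R f x)"
  proof (rule integral_dominated_convergence[where w = "\<lambda>x. norm (f x)"])
    show "(\<lambda>x. f x * complex_of_real (box_bump a b i x)) \<in> borel_measurable (lebesgue_on D)" for i
      by measurable
    have lim: "(\<lambda>i. f x * complex_of_real (box_bump a b i x)) \<longlonglongrightarrow> indicator (box a b) x *\<^sub>R f x" for x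
      using tendsto_mult[OF tendsto_const tendsto_of_real[OF box_bump_tendsto[of a b x]], of "f x"]
      by (simp add: scaleR_conv_of_real mult.commute)
    then show "AE x in lebesgue_on D. (\<lambda>i. f x * complex_of_real (box_bump a b i x)) \<longlonglongrightarrow> indicator (box a b) x *\<^sub>R f x"
      by simp
    show "(\<lambda>x. indicator (box a b) x *\<^sub>R f x) \<in> borel_measurable (lebesgue_on D)"
      by (rule borel_measurable_LIMSEQ_metric[OF _ lim]) measurable
    show "AE x in lebesgue_on D. norm (f x * complex_of_real (box_bump a b i x)) \<le> norm (f x)" for i
      using box_bump_bounds[of a b i] by (auto simp: norm_mult intro!: mult_left_le)
  qed (use f in auto)
  moreover have "(LINT x|lebesgue_on D. f x * complex_of_real (box_bump a b n x)) = 0" for n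
    using test_function_box_bump[OF sub] test by metis
  ultimately show ?thesis by (simp add: LIMSEQ_const_iff)
qed

lemma sigma_finite_lebesgue: "sigma_finite_measure (lebesgue :: 'a::euclidean_space measure)"
proof
  show "\<exists>A :: 'a set set. countable A \<and> A \<subseteq> sets lebesgue \<and> \<Union>A = space lebesgue \<and> (\<forall>a\<in>A. emeasure lebesgue a \<noteq> \<infinity>)"
    using lborel.sigma_finite_countable by (metis emeasure_completion main_part sets_completionI_sets space_completion subsetD subsetI)
qed

text \<open>Box bumps show that \<open>f\<close> integrates to zero over every box inside the domain. Boxes are stable
  under intersection and generate the Borel sets, so within a fixed box the integral of \<open>f\<close> over every
  measurable set vanishes, and \<open>f = 0\<close> almost everywhere there. Countably many boxes exhaust the domain.\<close>

lemma fundamental_lemma: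
  fixes f :: "real^'n \<Rightarrow> complex"
  assumes D: "open D" and f: "integrable (lebesgue_on D) f"
    and test: "\<And>\<phi> \<phi>'. test_function D \<phi> \<phi>' \<Longrightarrow> (LINT x|lebesgue_on D. f x * complex_of_real (\<phi> x)) = 0"
  shows "AE x in lebesgue_on D. f x = 0"
proof -
  have Ds: "D \<inter> space lebesgue \<in> sets lebesgue" using D by auto
  define F where "F x = indicator D x *\<^sub>R f x" for x
  have F: "integrable lebesgue F"
    using f Ds unfolding F_def by (subst (asm) integrable_restrict_space) (auto simp: set_integrable_def)
  have box: "AE x in lebesgue. x \<in> cbox a b \<longrightarrow> F x = 0" if sub: "cbox a b \<subseteq> D" for a b
  proof -
    define G where "G x = indicator (box a b) x *\<^sub>R F x" for x
    have G: "integrable lebesgue G"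
      unfolding G_def by (rule integrable_mult_indicator[OF _ F]) auto
    have Gbox: "(LINT x:box c d|lebesgue. G x) = 0" for c d
    proof -
      obtain e e' where e: "box c d \<inter> box a b = box e e'"
        using box_Int_box by blast
      have "(LINT x:box c d|lebesgue. G x) = (LINT x|lebesgue. indicator D x *\<^sub>R (indicator (box e e') x *\<^sub>R f x))"
        unfolding set_lebesgue_integral_def G_def F_def e[symmetric]
        by (intro Bochner_Integration.integral_cong) (auto split: split_indicator)
      also have "\<dots> = (LINT x|lebesgue_on D. indicator (box e e') x *\<^sub>R f x)"
        by (rule integral_restrict_space[OF Ds, symmetric])
      also have "\<dots> = 0"
      proof (cases "box e e' = {}")
        case False
        have "cbox e e' = closure (box e e')" using closure_box[OF False] by simp
        also have "\<dots> \<subseteq> cbox a b"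
          using e box_subset_cbox[of a b] by (intro closure_minimal) auto
        finally show ?thesis
          using sub by (intro integral_box_eq_0[OF D f test]) auto
      qed simp
      finally show ?thesis .
    qed
    have Gborel: "(LINT x:A|lebesgue. G x) = 0" if "A \<in> sets borel" for A
    proof -
      have setint: "set_integrable lebesgue B G" if "B \<in> sets lebesgue" for B
        unfolding set_integrable_def by (rule integrable_mult_indicator[OF that G])
      have A: "A \<in> sigma_sets UNIV (range (\<lambda>(a, b). box a b))"
        using that unfolding borel_eq_box by simp
      have IS: "Int_stable (range (\<lambda>(a, b). box a b :: (real^'n) set))"
      proof (rule Int_stableI)
        fix A B :: "(real^'n) set"
        assume "A \<in> range (\<lambda>(a, b). box a b)" "B \<in> range (\<lambda>(a, b). box a b)"
        then obtain a b c d where "A = box a b" "B = box c d" by auto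
        then have "A \<inter> B = case_prod box ((\<Sum>i\<in>Basis. max (a \<bullet> i) (c \<bullet> i) *\<^sub>R i), (\<Sum>i\<in>Basis. min (b \<bullet> i) (d \<bullet> i) *\<^sub>R i))"
          by (simp add: box_Int_box)
        then show "A \<inter> B \<in> range (\<lambda>(a, b). box a b)" by (rule range_eqI)
      qed
      have "range (\<lambda>(a, b). box a b :: (real^'n) set) \<subseteq> Pow UNIV" by simp
      note induct = sigma_sets_induct_disjoint[OF IS this, consumes 1, case_names basic empty compl union]
      from A have "A \<in> sets borel \<and> (LINT x:A|lebesgue. G x) = 0"
      proof (induction rule: induct)
        case (basic A)
        then show ?case using Gbox by auto
      next
        case empty
        show ?case by (simp add: set_lebesgue_integral_def)
      next
        case (compl A)
        have tot: "(LINT x|lebesgue. G x) = 0"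
        proof -
          have "(LINT x|lebesgue. G x) = (LINT x:box a b|lebesgue. G x)"
            unfolding set_lebesgue_integral_def G_def
            by (intro Bochner_Integration.integral_cong) (auto split: split_indicator)
          then show ?thesis using Gbox by simp
        qed
        have "(LINT x:UNIV - A|lebesgue. G x) = (LINT x|lebesgue. G x - indicator A x *\<^sub>R G x)"
          unfolding set_lebesgue_integral_def
          by (intro Bochner_Integration.integral_cong) (auto split: split_indicator)
        also have "\<dots> = 0"
          using compl tot setint[of A] G
          by (subst Bochner_Integration.integral_diff) (auto simp: set_lebesgue_integral_def set_integrable_def)
        finally show ?case using compl by auto
      next
        case (union A)
        then have m: "\<And>i. A i \<in> sets lebesgue" by auto
        have "(LINT x:\<Union>(range A)|lebesgue. G x) = (\<Sum>i. LINT x:A i|lebesgue. G x)"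
          using union m by (intro lebesgue_integral_countable_add setint) (auto simp: disjoint_family_on_def)
        then show ?case using union by auto
      qed
      then show ?thesis by simp
    qed
    have "AE x in lebesgue. G x = 0"
    proof (rule sigma_finite_measure.density_zero[OF sigma_finite_lebesgue G])
      fix A :: "(real^'n) set" assume "A \<in> sets lebesgue"
      then obtain S N N' where A: "A = S \<union> N" "N \<subseteq> N'" "N' \<in> null_sets lborel" "S \<in> sets lborel"
        by (rule sets_completionE)
      have "AE x in lebesgue. x \<notin> N'"
        using A(3) by (intro AE_completion AE_not_in)
      then have "AE x in lebesgue. indicator A x *\<^sub>R G x = indicator S x *\<^sub>R G x"
        using A by (auto elim!: eventually_mono split: split_indicator)
      then have "(LINT x:A|lebesgue. G x) = (LINT x:S|lebesgue. G x)"
        unfolding set_lebesgue_integral_def using G \<open>A \<in> sets lebesgue\<close> A(4)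
        by (intro integral_cong_AE borel_measurable_scaleR borel_measurable_indicator) auto
      then show "(LINT x:A|lebesgue. G x) = 0" using Gborel A(4) by simp
    qed
    moreover have "AE x in lebesgue. x \<notin> cbox a b - box a b"
      using negligible_frontier_interval[of a b] by (intro AE_not_in) (simp add: negligible_iff_null_sets)
    ultimately show ?thesis
      by eventually_elim (auto simp: G_def)
  qed
  obtain \<D> where \<D>: "countable \<D>" "\<D> \<subseteq> Pow D" "\<And>X. X \<in> \<D> \<Longrightarrow> \<exists>a b. X = cbox a b" "\<Union>\<D> = D"
    by (rule open_countable_Union_open_cbox[OF D]) blast
  have "AE x in lebesgue. \<forall>X\<in>\<D>. x \<in> X \<longrightarrow> F x = 0"
    using \<D>(1)
  proof (subst AE_ball_countable, simp, intro ballI)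
    fix X assume X: "X \<in> \<D>"
    with \<D>(3) obtain a b where "X = cbox a b" by blast
    then show "AE x in lebesgue. x \<in> X \<longrightarrow> F x = 0" using box[of a b] X \<D>(2) by auto
  qed
  then have "AE x in lebesgue. x \<in> D \<longrightarrow> f x = 0"
  proof eventually_elim
    case (elim x)
    show ?case
    proof
      assume x: "x \<in> D"
      then obtain X where "X \<in> \<D>" "x \<in> X" using \<D>(4) by blast
      then have "F x = 0" using elim by blast
      then show "f x = 0" using x by (simp add: F_def)
    qed
  qed
  then show ?thesis
    by (subst AE_restrict_space_iff[OF Ds])
qed

lemma has_weak_gradient_lincomb:
  assumes D: "open D" "bounded D"
    and u: "u \<in> L2 (lebesgue_on D)" "g \<in> L2 (lebesgue_on D)" "has_weak_gradient D u g"
    and v: "v \<in> L2 (lebesgue_on D)" "h \<in> L2 (lebesgue_on D)" "has_weak_gradient D v h"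
  shows "has_weak_gradient D (\<lambda>x. u x + \<alpha> * v x) (\<lambda>x. g x + \<alpha> *s h x)"
  unfolding has_weak_gradient_def
proof (intro allI impI)
  fix \<phi> \<phi>' k assume T: "test_function D \<phi> \<phi>'"
  note t = test_function_L2[OF T emeasure_lebesgue_on_finite[OF D]]
  have eqs: "(LINT x|lebesgue_on D. u x * complex_of_real (\<phi>' x $ k)) = - (LINT x|lebesgue_on D. g x $ k * complex_of_real (\<phi> x))"
    "(LINT x|lebesgue_on D. v x * complex_of_real (\<phi>' x $ k)) = - (LINT x|lebesgue_on D. h x $ k * complex_of_real (\<phi> x))"
    using u(3) v(3) T by (auto simp: has_weak_gradient_def)
  have "(LINT x|lebesgue_on D. (u x + \<alpha> * v x) * complex_of_real (\<phi>' x $ k)) =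
     (LINT x|lebesgue_on D. u x * complex_of_real (\<phi>' x $ k)) + \<alpha> * (LINT x|lebesgue_on D. v x * complex_of_real (\<phi>' x $ k))"
    using L2_mult_integrable[OF u(1) t(2)[of k]] L2_mult_integrable[OF v(1) t(2)[of k]]
    by (simp add: distrib_right mult.assoc)
  also have "\<dots> = - ((LINT x|lebesgue_on D. g x $ k * complex_of_real (\<phi> x)) + \<alpha> * (LINT x|lebesgue_on D. h x $ k * complex_of_real (\<phi> x)))"
    using eqs by simp
  also have "\<dots> = - (LINT x|lebesgue_on D. (g x + \<alpha> *s h x) $ k * complex_of_real (\<phi> x))"
    using L2_mult_integrable[OF L2_component[OF u(2)] t(1), of k] L2_mult_integrable[OF L2_component[OF v(2)] t(1), of k]
    by (simp add: distrib_right mult.assoc)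
  finally show "(LINT x|lebesgue_on D. (u x + \<alpha> * v x) * complex_of_real (\<phi>' x $ k)) =
     - (LINT x|lebesgue_on D. (g x + \<alpha> *s h x) $ k * complex_of_real (\<phi> x))" .
qed

lemma has_weak_gradient_unique:
  assumes D: "open D" "bounded D"
    and g: "g \<in> L2 (lebesgue_on D)" "has_weak_gradient D u g"
    and h: "h \<in> L2 (lebesgue_on D)" "has_weak_gradient D u h"
  shows "AE x in lebesgue_on D. g x = h x"
proof -
  note fin = emeasure_lebesgue_on_finite[OF D]
  have "AE x in lebesgue_on D. g x $ k - h x $ k = 0" for k
  proof (rule fundamental_lemma[OF D(1)])
    show "integrable (lebesgue_on D) (\<lambda>x. g x $ k - h x $ k)"
      using g h by (intro Bochner_Integration.integrable_diff L2_integrable[OF fin] L2_component)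
    fix \<phi> \<phi>' assume T: "test_function D \<phi> \<phi>'"
    note t = test_function_L2[OF T fin]
    have "(LINT x|lebesgue_on D. u x * complex_of_real (\<phi>' x $ k)) = - (LINT x|lebesgue_on D. g x $ k * complex_of_real (\<phi> x))"
      "(LINT x|lebesgue_on D. u x * complex_of_real (\<phi>' x $ k)) = - (LINT x|lebesgue_on D. h x $ k * complex_of_real (\<phi> x))"
      using g(2) h(2) T by (auto simp: has_weak_gradient_def)
    then show "(LINT x|lebesgue_on D. (g x $ k - h x $ k) * complex_of_real (\<phi> x)) = 0"
      using L2_mult_integrable[OF L2_component[OF g(1)] t(1), of k] L2_mult_integrable[OF L2_component[OF h(1)] t(1), of k]
      by (simp add: left_diff_distrib)
  qed
  then have "AE x in lebesgue_on D. \<forall>k\<in>UNIV. g x $ k - h x $ k = 0"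
    by (intro AE_finite_allI) auto
  then show ?thesis by eventually_elim (auto simp: vec_eq_iff)
qed

lemma W12_D:
  assumes "u \<in> W12 D"
  shows "u \<in> L2 (lebesgue_on D)" "weak_gradient D u \<in> L2 (lebesgue_on D)"
    "has_weak_gradient D u (weak_gradient D u)"
proof -
  have "\<exists>g. g \<in> L2 (lebesgue_on D) \<and> has_weak_gradient D u g"
    using assms by (auto simp: W12_def)
  from someI_ex[OF this] show "weak_gradient D u \<in> L2 (lebesgue_on D)"
    "has_weak_gradient D u (weak_gradient D u)"
    by (auto simp: weak_gradient_def)
qed (use assms in \<open>auto simp: W12_def\<close>)

text \<open>The form \<open>u + \<alpha> v\<close> covers sums, differences and multiples at once; all linearity statements
  below use it.\<close>

lemma W12_lincomb:
  assumes D: "open D" "bounded D" and u: "u \<in> W12 D" and v: "v \<in> W12 D"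
  shows "(\<lambda>x. u x + \<alpha> * v x) \<in> W12 D"
    "AE x in lebesgue_on D. weak_gradient D (\<lambda>x. u x + \<alpha> * v x) x = weak_gradient D u x + \<alpha> *s weak_gradient D v x"
proof -
  note h = has_weak_gradient_lincomb[OF D W12_D[OF u] W12_D[OF v], of \<alpha>]
  note l2 = L2_vec_lincomb[OF W12_D(2)[OF u] W12_D(2)[OF v], of \<alpha>]
  show *: "(\<lambda>x. u x + \<alpha> * v x) \<in> W12 D"
    using h l2 L2_lincomb[OF W12_D(1)[OF u] W12_D(1)[OF v], of \<alpha>] by (auto simp: W12_def)
  show "AE x in lebesgue_on D. weak_gradient D (\<lambda>x. u x + \<alpha> * v x) x = weak_gradient D u x + \<alpha> *s weak_gradient D v x"
    by (rule has_weak_gradient_unique[OF D W12_D(2,3)[OF *] l2 h])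
qed

section \<open>Lattice cells and meshes\<close>

text \<open>Cells are addressed by integer vectors relative to a base point that all levels share. Comparing cells
  of different levels then amounts to comparing integers.\<close>

definition cell :: "real^'n \<Rightarrow> real \<Rightarrow> ('n \<Rightarrow> int) \<Rightarrow> (real^'n) set" where
  "cell a H z = cube (\<chi> k. a $ k + H * real_of_int (z k)) H"

definition lattice_mesh :: "(real^'n) set \<Rightarrow> real^'n \<Rightarrow> real \<Rightarrow> (real^'n) set set \<Rightarrow> bool" where
  "lattice_mesh D a H \<T> \<longleftrightarrow> 0 < H \<and> finite \<T> \<and> \<Union>\<T> = closure D \<and> (\<forall>T\<in>\<T>. \<exists>z. T = cell a H z)"

text \<open>Away from the lattice hyperplanes every point of a cell is an interior point.\<close>

definition off_lattice :: "real^'n \<Rightarrow> real \<Rightarrow> real^'n \<Rightarrow> bool" where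
  "off_lattice a H x \<longleftrightarrow> (\<forall>k i. x $ k \<noteq> a $ k + H * real_of_int i)"

lemma cartesian_mesh_iff: "cartesian_mesh D H \<T> \<longleftrightarrow> (\<exists>a. lattice_mesh D a H \<T>)"
  by (auto simp: cartesian_mesh_def lattice_mesh_def cell_def)

lemma mem_cube: "x \<in> cube a H \<longleftrightarrow> (\<forall>k. a $ k \<le> x $ k \<and> x $ k \<le> a $ k + H)"
  by (simp add: cube_def mem_box_cart)

lemma interior_cube: "interior (cube a H) = box a (\<chi> k. a $ k + H)"
  by (simp add: cube_def)

lemma mem_cell: "x \<in> cell a H z \<longleftrightarrow> (\<forall>k. a $ k + H * of_int (z k) \<le> x $ k \<and> x $ k \<le> a $ k + H * (of_int (z k) + 1))"
  by (simp add: cell_def mem_cube algebra_simps)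

lemma mem_interior_cell:
  "x \<in> interior (cell a H z) \<longleftrightarrow> (\<forall>k. a $ k + H * of_int (z k) < x $ k \<and> x $ k < a $ k + H * (of_int (z k) + 1))"
  by (simp add: cell_def interior_cube mem_box_cart algebra_simps)

lemma corner_cube:
  assumes "0 \<le> H"
  shows "corner (cube a H) = a"
proof -
  have "(\<lambda>x. x $ k) ` cube a H = {a $ k .. a $ k + H}" for k
  proof (intro equalityI subsetI)
    fix t assume t: "t \<in> {a $ k .. a $ k + H}"
    then have "(\<chi> j. if j = k then t else a $ j) \<in> cube a H"
      using assms by (auto simp: mem_cube)
    then show "t \<in> (\<lambda>x. x $ k) ` cube a H"
      by (rule rev_image_eqI) simp
  qed (auto simp: mem_cube)
  then show ?thesis
    using assms by (simp add: corner_def vec_eq_iff)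
qed

lemma corner_cell: "0 \<le> H \<Longrightarrow> corner (cell a H z) $ k = a $ k + H * of_int (z k)"
  by (simp add: cell_def corner_cube)

lemma measure_cube:
  fixes a :: "real^'n"
  assumes "0 < H"
  shows "measure lebesgue (cube a H) = H ^ CARD('n)"
proof -
  have "a \<in> cube a H" using assms by (simp add: mem_cube)
  then show ?thesis
    unfolding cube_def by (subst measure_completion, simp) (subst content_cbox_cart, auto)
qed

lemma AE_off_lattice: "AE x in lebesgue. off_lattice (a :: real^'n) H x"
proof -
  have "AE x in lebesgue. x $ k \<noteq> a $ k + H * of_int i" for k and i :: int
  proof -
    have "negligible {x :: real^'n. x $ k = a $ k + H * of_int i}"
      using negligible_standard_hyperplane[of "axis k 1 :: real^'n" "a $ k + H * of_int i"]
      by (simp add: inner_axis axis_in_Basis_iff)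
    then have "{x :: real^'n. x $ k = a $ k + H * of_int i} \<in> null_sets lebesgue"
      by (simp add: negligible_iff_null_sets)
    from AE_not_in[OF this] show ?thesis by simp
  qed
  then have "AE x in lebesgue. \<forall>k\<in>UNIV. \<forall>i::int. x $ k \<noteq> a $ k + H * of_int i"
    by (intro AE_finite_allI) (auto simp: AE_all_countable)
  then show ?thesis by (simp add: off_lattice_def)
qed

lemma AE_lebesgue_onI:
  assumes "open D" "AE x in lebesgue. x \<in> D \<longrightarrow> P x"
  shows "AE x in lebesgue_on D. P x"
  using assms by (subst AE_restrict_space_iff) auto

lemma off_lattice_interior_cell:
  "off_lattice a H x \<Longrightarrow> x \<in> cell a H z \<Longrightarrow> x \<in> interior (cell a H z)"
  unfolding off_lattice_def mem_cell mem_interior_cell less_le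
  by (metis of_int_1 of_int_add)

lemma cell_eq_of_interior:
  assumes "0 < H" "x \<in> interior (cell a H z)" "x \<in> cell a H z'"
  shows "z' = z"
proof
  fix k
  have "H * of_int (z k) < H * (of_int (z' k) + 1)" "H * of_int (z' k) < H * (of_int (z k) + 1)"
    using assms(2,3) unfolding mem_cell mem_interior_cell by (smt (verit))+
  then have "real_of_int (z k) < of_int (z' k) + 1" "real_of_int (z' k) < of_int (z k) + 1"
    using assms(1) by auto
  then show "z' k = z k" by linarith
qed

lemma sum_indicator_mesh:
  fixes c :: "(real^'n) set \<Rightarrow> complex"
  assumes mesh: "lattice_mesh D a H \<T>" and T: "T \<in> \<T>" and x: "x \<in> interior T"
  shows "(\<Sum>S\<in>\<T>. c S * indicator S x) = c T"
proof -
  have "x \<notin> S" if S: "S \<in> \<T>" "S \<noteq> T" for S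
  proof
    assume xS: "x \<in> S"
    obtain z z' where "T = cell a H z" "S = cell a H z'"
      using mesh T S by (meson lattice_mesh_def)
    then show False
      using cell_eq_of_interior[of H x a z z'] mesh x xS S by (auto simp: lattice_mesh_def)
  qed
  then have "(\<Sum>S\<in>\<T>. c S * indicator S x) = (\<Sum>S\<in>{T}. c S * indicator S x)"
    using mesh T by (intro sum.mono_neutral_right) (auto simp: lattice_mesh_def)
  also have "\<dots> = c T"
    using subsetD[OF interior_subset x] by simp
  finally show ?thesis .
qed

lemma lattice_mesh_AE_cell:
  assumes mesh: "lattice_mesh D a H \<T>" and D: "open D"
  shows "AE x in lebesgue_on D. \<exists>T\<in>\<T>. x \<in> interior T"
proof (rule AE_lebesgue_onI[OF D])
  show "AE x in lebesgue. x \<in> D \<longrightarrow> (\<exists>T\<in>\<T>. x \<in> interior T)"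
    using AE_off_lattice[of a H]
  proof eventually_elim
    case (elim x)
    show ?case
    proof
      assume "x \<in> D"
      then have "x \<in> \<Union>\<T>" using mesh closure_subset by (auto simp: lattice_mesh_def)
      then obtain T where T: "T \<in> \<T>" "x \<in> T" by auto
      moreover from T obtain z where "T = cell a H z" using mesh by (auto simp: lattice_mesh_def)
      ultimately show "\<exists>T\<in>\<T>. x \<in> interior T"
        using off_lattice_interior_cell[OF elim] by blast
    qed
  qed
qed

text \<open>The subcells of cell \<open>z\<close> have the addresses \<open>2 z + j\<close> with \<open>j \<in> {0, 1}\<^sup>n\<close>.\<close>

lemma uniform_refinement_lattice:
  fixes a :: "real^'n"
  assumes mesh: "lattice_mesh D a H \<T>"
  shows "lattice_mesh D a (H / 2) (uniform_refinement H \<T>)"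
proof -
  have H: "0 < H" and fin: "finite \<T>" and un: "\<Union>\<T> = closure D" and c: "\<And>T. T \<in> \<T> \<Longrightarrow> \<exists>z. T = cell a H z"
    using mesh by (auto simp: lattice_mesh_def)
  have sub: "cube (\<chi> k. corner (cell a H z) $ k + H / 2 * real (j k)) (H / 2) = cell a (H / 2) (\<lambda>k. 2 * z k + int (j k))" for z and j :: "'n \<Rightarrow> nat"
    using H by (simp add: cell_def corner_cube algebra_simps)
  have "uniform_refinement H \<T> \<subseteq> (\<lambda>(T, j). cube (\<chi> k. corner T $ k + H / 2 * real (j k)) (H / 2)) ` (\<T> \<times> {j. range j \<subseteq> {0, 1}})"
    by (auto simp: uniform_refinement_def)
  moreover have "finite {j :: 'n \<Rightarrow> nat. range j \<subseteq> {0, 1}}"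
    using finite_set_of_finite_funs[of "UNIV :: 'n set" "{0, 1 :: nat}"] by (simp add: image_subset_iff)
  ultimately have 1: "finite (uniform_refinement H \<T>)"
    using fin finite_subset by blast
  have 2: "\<Union>(uniform_refinement H \<T>) = \<Union>\<T>"
  proof (intro equalityI subsetI)
    fix x assume "x \<in> \<Union>(uniform_refinement H \<T>)"
    then obtain T j where T: "T \<in> \<T>" "range j \<subseteq> {0, 1 :: nat}" "x \<in> cube (\<chi> k. corner T $ k + H / 2 * real (j k)) (H / 2)"
      by (auto simp: uniform_refinement_def)
    then obtain z where z: "T = cell a H z" using c by blast
    have "x \<in> cell a H z"
      unfolding mem_cell
    proof
      fix k
      have "j k = 0 \<or> j k = 1" using T(2) by auto
      moreover have "a $ k + H / 2 * of_int (2 * z k + int (j k)) \<le> x $ k \<and> x $ k \<le> a $ k + H / 2 * (of_int (2 * z k + int (j k)) + 1)"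
        using T(3) unfolding z sub mem_cell by blast
      ultimately show "a $ k + H * of_int (z k) \<le> x $ k \<and> x $ k \<le> a $ k + H * (of_int (z k) + 1)"
        using H by (auto simp: algebra_simps)
    qed
    then show "x \<in> \<Union>\<T>" using T z by blast
  next
    fix x assume "x \<in> \<Union>\<T>"
    then obtain T where T: "T \<in> \<T>" "x \<in> T" by blast
    then obtain z where z: "T = cell a H z" using c by blast
    define j where "j k = (if x $ k \<le> a $ k + H * (of_int (z k) + 1/2) then 0 else 1 :: nat)" for k
    have "x \<in> cell a (H / 2) (\<lambda>k. 2 * z k + int (j k))"
      using T(2) unfolding z mem_cell by (auto simp: j_def algebra_simps)
    then have "x \<in> cube (\<chi> k. corner T $ k + H / 2 * real (j k)) (H / 2)"
      unfolding z sub .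
    moreover have "range j \<subseteq> {0, 1}" by (auto simp: j_def)
    then have "cube (\<chi> k. corner T $ k + H / 2 * real (j k)) (H / 2) \<in> uniform_refinement H \<T>"
      using T(1) unfolding uniform_refinement_def by blast
    ultimately show "x \<in> \<Union>(uniform_refinement H \<T>)" by blast
  qed
  show ?thesis
    unfolding lattice_mesh_def
  proof (intro conjI ballI)
    fix S assume "S \<in> uniform_refinement H \<T>"
    then obtain T j where "T \<in> \<T>" "S = cube (\<chi> k. corner T $ k + H / 2 * real (j k)) (H / 2)"
      by (auto simp: uniform_refinement_def)
    then show "\<exists>z. S = cell a (H / 2) z" using c sub by metis
  qed (use H 1 2 un in auto)
qed

lemma mesh_size_Suc: "mesh_size H1 (Suc (Suc m)) = mesh_size H1 (Suc m) / 2"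
  by (simp add: mesh_size_def)

lemma lattice_mesh_mesh:
  assumes "lattice_mesh D a H1 \<T>1" "1 \<le> l"
  shows "lattice_mesh D a (mesh_size H1 l) (mesh H1 \<T>1 l)"
proof -
  have "lattice_mesh D a (mesh_size H1 (Suc m)) (refine_times H1 \<T>1 m)" for m
  proof (induction m)
    case 0
    show ?case using assms by (simp add: mesh_size_def)
  next
    case (Suc m)
    from uniform_refinement_lattice[OF this] show ?case
      by (simp add: mesh_size_Suc)
  qed
  from this[of "l - 1"] show ?thesis using assms(2) by (simp add: mesh_def)
qed

lemma mesh_size_multiple:
  assumes "1 \<le> k" "k \<le> l"
  shows "mesh_size H1 k = real (2 ^ (l - k)) * mesh_size H1 l"
proof -
  have "l - 1 = (l - k) + (k - 1)" using assms by linarith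
  then show ?thesis by (simp add: mesh_size_def power_add)
qed

text \<open>If the address \<open>z\<close> lies in the block of the \<open>m\<^sup>n\<close> subcells of the coarse cell, the fine cell is
  one of them; otherwise some coordinate separates the two cells.\<close>

lemma cell_nested_or_disjoint:
  assumes h: "0 < h" and m: "0 < m"
  shows "cell a h z \<subseteq> cell a (real m * h) z0 \<or> interior (cell a h z) \<inter> cell a (real m * h) z0 = {}"
proof (cases "\<forall>k. int m * z0 k \<le> z k \<and> z k < int m * z0 k + int m")
  case True
  have "cell a h z \<subseteq> cell a (real m * h) z0"
  proof (rule subsetI, unfold mem_cell, rule allI)
    fix x k assume x: "\<forall>k. a $ k + h * of_int (z k) \<le> x $ k \<and> x $ k \<le> a $ k + h * (of_int (z k) + 1)"
    have "of_int (int m * z0 k) \<le> real_of_int (z k)" "real_of_int (z k + 1) \<le> of_int (int m * z0 k + int m)"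
      using True[rule_format, of k] by (simp_all only: of_int_le_iff) linarith+
    then have "real m * of_int (z0 k) \<le> of_int (z k)" "of_int (z k) + 1 \<le> real m * (of_int (z0 k) + 1)"
      by (auto simp: algebra_simps)
    then have "h * (real m * of_int (z0 k)) \<le> h * of_int (z k)" "h * (of_int (z k) + 1) \<le> h * (real m * (of_int (z0 k) + 1))"
      using h by (simp_all add: mult_left_mono)
    then show "a $ k + real m * h * of_int (z0 k) \<le> x $ k \<and> x $ k \<le> a $ k + real m * h * (of_int (z0 k) + 1)"
      using x[rule_format, of k] by (simp add: algebra_simps)
  qed
  then show ?thesis ..
next
  case False
  then obtain k where "\<not> (int m * z0 k \<le> z k \<and> z k < int m * z0 k + int m)" by blast
  then have "z k + 1 \<le> int m * z0 k \<or> int m * z0 k + int m \<le> z k" by linarith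
  then have "real_of_int (z k + 1) \<le> of_int (int m * z0 k) \<or> of_int (int m * z0 k + int m) \<le> real_of_int (z k)"
    by (simp only: of_int_le_iff)
  then have "of_int (z k) + 1 \<le> real m * of_int (z0 k) \<or> real m * (of_int (z0 k) + 1) \<le> of_int (z k)"
    by (auto simp: algebra_simps)
  then have *: "h * (of_int (z k) + 1) \<le> h * (real m * of_int (z0 k)) \<or> h * (real m * (of_int (z0 k) + 1)) \<le> h * of_int (z k)"
    using h by (simp add: mult_left_mono)
  have "interior (cell a h z) \<inter> cell a (real m * h) z0 = {}"
  proof (rule ccontr)
    assume "interior (cell a h z) \<inter> cell a (real m * h) z0 \<noteq> {}"
    then obtain x where "x \<in> interior (cell a h z)" "x \<in> cell a (real m * h) z0" by blast
    then have "a $ k + h * of_int (z k) < x $ k" "x $ k < a $ k + h * (of_int (z k) + 1)"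
      "a $ k + real m * h * of_int (z0 k) \<le> x $ k" "x $ k \<le> a $ k + real m * h * (of_int (z0 k) + 1)"
      unfolding mem_cell mem_interior_cell by blast+
    then show False using * by (auto simp: algebra_simps)
  qed
  then show ?thesis ..
qed

text \<open>Moving a boundary point of a Lipschitz domain against the axis of the local epigraph leads
  outside the closure of the domain, so a Lipschitz domain has no slits.\<close>

lemma lipschitz_domain_regular_open:
  assumes "bounded_lipschitz_domain D"
  shows "interior (closure D) = D"
proof
  have D: "open D" using assms by (simp add: bounded_lipschitz_domain_def)
  show "D \<subseteq> interior (closure D)"
    using D by (intro interior_maximal closure_subset)
  show "interior (closure D) \<subseteq> D"
  proof (rule ccontr)
    assume "\<not> interior (closure D) \<subseteq> D"
    then obtain p where p: "p \<in> interior (closure D)" "p \<notin> D" by blast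
    then have "p \<in> frontier D"
      using D interior_subset by (auto simp: frontier_def interior_open)
    then obtain e r C and \<gamma> :: "real^'a \<Rightarrow> real" where e: "norm e = 1" and r: "r > 0" and "C-lipschitz_on UNIV \<gamma>"
      and epi: "\<And>x. x \<in> ball p r \<Longrightarrow> x \<in> D \<longleftrightarrow> \<gamma> (x - (x \<bullet> e) *\<^sub>R e) < x \<bullet> e"
      using assms by (fastforce simp: bounded_lipschitz_domain_def)
    then have cont: "continuous_on UNIV \<gamma>"
      by (metis lipschitz_on_continuous_on)
    obtain s where s: "s > 0" "ball p s \<subseteq> closure D" using p(1) by (auto simp: mem_interior)
    define t where "t = min r s / 2"
    have t: "0 < t" "t < r" "t < s" using r s by (auto simp: t_def)
    define q where "q = p - t *\<^sub>R e"
    have ee: "e \<bullet> e = 1" using e by (simp add: dot_square_norm)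
    have qe: "q \<bullet> e = p \<bullet> e - t" "q - (q \<bullet> e) *\<^sub>R e = p - (p \<bullet> e) *\<^sub>R e"
      using ee by (simp_all add: q_def inner_diff_left algebra_simps)
    have "dist p q = t" using e t by (simp add: q_def dist_norm)
    have "\<gamma> (p - (p \<bullet> e) *\<^sub>R e) \<ge> p \<bullet> e"
      using epi[of p] p(2) r by auto
    then have "q \<in> {x. x \<bullet> e < \<gamma> (x - (x \<bullet> e) *\<^sub>R e)}"
      using qe t by simp
    moreover have "open {x. x \<bullet> e < \<gamma> (x - (x \<bullet> e) *\<^sub>R e)}"
      by (intro open_Collect_less continuous_intros continuous_on_compose2[OF cont]) auto
    ultimately have "open (ball p r \<inter> {x. x \<bullet> e < \<gamma> (x - (x \<bullet> e) *\<^sub>R e)})" "q \<in> ball p r \<inter> {x. x \<bullet> e < \<gamma> (x - (x \<bullet> e) *\<^sub>R e)}"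
      using \<open>dist p q = t\<close> t by auto
    moreover have "ball p r \<inter> {x. x \<bullet> e < \<gamma> (x - (x \<bullet> e) *\<^sub>R e)} \<inter> D = {}"
      using epi by force
    ultimately have "q \<notin> closure D"
      by (meson disjoint_iff open_Int_closure_eq_empty)
    then show False using s \<open>dist p q = t\<close> t by auto
  qed
qed

lemma mesh_cell_interior_subset:
  assumes "bounded_lipschitz_domain D" "lattice_mesh D a H \<T>" "T \<in> \<T>"
  shows "interior T \<subseteq> D"
  using interior_mono[of T "closure D"] lipschitz_domain_regular_open[OF assms(1)] assms(2,3)
  by (auto simp: lattice_mesh_def)

section \<open>A weak-type trace inequality\<close>

text \<open>If \<open>\<alpha> + \<delta> \<le> \<beta> - \<epsilon>\<close>, a profile that rises over \<open>[\<alpha>, \<alpha> + \<delta>]\<close>, then equals one, and falls over \<open>[\<beta> - \<epsilon>, \<beta>]\<close>.\<close>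

definition plateau :: "real \<Rightarrow> real \<Rightarrow> real \<Rightarrow> real \<Rightarrow> real \<Rightarrow> real" where
  "plateau \<alpha> \<delta> \<beta> \<epsilon> t = smoothstep ((t - \<alpha>) / \<delta>) * smoothstep ((\<beta> - t) / \<epsilon>)"

definition plateau_deriv :: "real \<Rightarrow> real \<Rightarrow> real \<Rightarrow> real \<Rightarrow> real \<Rightarrow> real" where
  "plateau_deriv \<alpha> \<delta> \<beta> \<epsilon> t = smoothstep_deriv ((t - \<alpha>) / \<delta>) / \<delta> * smoothstep ((\<beta> - t) / \<epsilon>)
     - smoothstep ((t - \<alpha>) / \<delta>) * (smoothstep_deriv ((\<beta> - t) / \<epsilon>) / \<epsilon>)"

lemma DERIV_plateau: "(plateau \<alpha> \<delta> \<beta> \<epsilon> has_real_derivative plateau_deriv \<alpha> \<delta> \<beta> \<epsilon> t) (at t)"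
proof -
  note [derivative_intros] = DERIV_chain'[OF _ DERIV_smoothstep]
  show ?thesis
    unfolding plateau_def plateau_deriv_def
    by (auto intro!: derivative_eq_intros simp: divide_inverse)
qed

lemma continuous_plateau_deriv: "continuous_on UNIV (plateau_deriv \<alpha> \<delta> \<beta> \<epsilon>)"
  unfolding plateau_deriv_def divide_inverse by (intro continuous_intros)

lemma plateau_bounds: "0 \<le> plateau \<alpha> \<delta> \<beta> \<epsilon> t" "plateau \<alpha> \<delta> \<beta> \<epsilon> t \<le> 1"
  unfolding plateau_def using smoothstep_bounds by (auto intro!: mult_le_one)

lemma plateau_support:
  assumes "0 < \<delta>" "0 < \<epsilon>" "plateau \<alpha> \<delta> \<beta> \<epsilon> t \<noteq> 0"
  shows "\<alpha> \<le> t" "t \<le> \<beta>"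
proof -
  have "\<not> (t - \<alpha>) / \<delta> \<le> 0" "\<not> (\<beta> - t) / \<epsilon> \<le> 0"
    using assms(3) smoothstep_simps(1) unfolding plateau_def by auto
  then show "\<alpha> \<le> t" "t \<le> \<beta>"
    using assms(1,2) by (auto simp: divide_le_0_iff)
qed

lemma plateau_eq_1:
  assumes "0 < \<delta>" "0 < \<epsilon>" "\<alpha> + \<delta> \<le> t" "t \<le> \<beta> - \<epsilon>"
  shows "plateau \<alpha> \<delta> \<beta> \<epsilon> t = 1"
proof -
  have "1 \<le> (t - \<alpha>) / \<delta>" "1 \<le> (\<beta> - t) / \<epsilon>" using assms by (auto simp: le_divide_eq)
  then show ?thesis by (simp add: plateau_def smoothstep_simps(3))
qed

text \<open>The one-dimensional profile across a cell edge \<open>[c, c + H]\<close>: steep in the layer of width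
  \<open>\<delta>\<close> at one end (the side is recorded by \<open>\<sigma>\<close>), flat elsewhere.\<close>

lemma ramp_exists:
  assumes \<delta>: "0 < \<delta>" "\<delta> \<le> H / 2" and \<sigma>: "\<sigma> = 1 \<or> \<sigma> = - 1" and q: "q = (if \<sigma> = 1 then c else c + H - \<delta>)"
  obtains f f' :: "real \<Rightarrow> real" and lo hi where
    "\<And>t. (f has_real_derivative f' t) (at t)" "continuous_on UNIV f'"
    "c < lo" "hi < c + H" "\<And>t. f t \<noteq> 0 \<Longrightarrow> lo \<le> t \<and> t \<le> hi" "\<And>t. f' t \<noteq> 0 \<Longrightarrow> lo \<le> t \<and> t \<le> hi"
    "\<And>t. \<bar>f t\<bar> \<le> 1"
    "\<And>t. q \<le> t \<Longrightarrow> t \<le> q + \<delta> \<Longrightarrow> 0 \<le> \<sigma> * f' t"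
    "\<And>t. q + 3/8 * \<delta> \<le> t \<Longrightarrow> t \<le> q + 5/8 * \<delta> \<Longrightarrow> 1 / \<delta> \<le> \<sigma> * f' t"
    "\<And>t. \<not> (q \<le> t \<and> t \<le> q + \<delta>) \<Longrightarrow> \<bar>f' t\<bar> \<le> 6 / H"
proof -
  have H: "0 < H" using \<delta> by linarith
  let ?\<alpha> = "c + \<delta>/4" and ?\<beta> = "c + 3/4 * H"
  define f where "f = plateau ?\<alpha> (\<delta>/2) ?\<beta> (H/4)"
  define f' where "f' = plateau_deriv ?\<alpha> (\<delta>/2) ?\<beta> (H/4)"
  have d: "(f has_real_derivative f' t) (at t)" for t
    unfolding f_def f'_def by (rule DERIV_plateau)
  have c: "continuous_on UNIV f'"
    unfolding f'_def by (rule continuous_plateau_deriv)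
  have s: "?\<alpha> \<le> t \<and> t \<le> ?\<beta>" if "f t \<noteq> 0" for t
    using plateau_support[of "\<delta>/2" "H/4" ?\<alpha> ?\<beta> t] that \<delta> H by (auto simp: f_def)
  have low: "(t - ?\<alpha>) / (\<delta>/2) \<le> 0" if "t \<le> ?\<alpha>" for t
    using that \<delta> by (simp add: divide_le_0_iff)
  have low1: "1 \<le> (t - ?\<alpha>) / (\<delta>/2)" if "c + \<delta> \<le> t" for t
    using that \<delta> by (simp add: field_simps)
  have high: "(?\<beta> - t) / (H/4) \<le> 0" if "?\<beta> \<le> t" for t
    using that H by (simp add: divide_le_0_iff)
  have high1: "1 \<le> (?\<beta> - t) / (H/4)" if "t \<le> c + H/2" for t
    using that H by (simp add: field_simps)
  have s': "?\<alpha> \<le> t \<and> t \<le> ?\<beta>" if "f' t \<noteq> 0" for t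
  proof (rule ccontr)
    assume "\<not> ?thesis"
    then consider "t < ?\<alpha>" | "?\<beta> < t" by linarith
    then have "f' t = 0"
    proof cases
      case 1
      with low[of t] show ?thesis
        by (simp add: f'_def plateau_deriv_def smoothstep_deriv_eq_0 smoothstep_simps(1))
    next
      case 2
      with high[of t] show ?thesis
        by (simp add: f'_def plateau_deriv_def smoothstep_deriv_eq_0 smoothstep_simps(1))
    qed
    with that show False by simp
  qed
  have near: "f' t = smoothstep_deriv ((t - ?\<alpha>) / (\<delta>/2)) / (\<delta>/2)" if "t \<le> c + \<delta>" for t
    using high1[of t] that \<delta> by (simp add: f'_def plateau_deriv_def smoothstep_deriv_eq_0 smoothstep_simps(3))
  have nn: "0 \<le> f' t" if "c \<le> t" "t \<le> c + \<delta>" for t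
    unfolding near[OF that(2)] using \<delta> smoothstep_deriv_nonneg by simp
  have mid: "1 / \<delta> \<le> f' t" if "c + 3/8 * \<delta> \<le> t" "t \<le> c + 5/8 * \<delta>" for t
  proof -
    have "1/4 \<le> (t - ?\<alpha>) / (\<delta>/2)" "(t - ?\<alpha>) / (\<delta>/2) \<le> 3/4"
      using that \<delta> by (simp_all add: field_simps)
    then have 1: "1 \<le> smoothstep_deriv ((t - ?\<alpha>) / (\<delta>/2))" by (rule smoothstep_deriv_ge)
    have "t \<le> c + \<delta>" using that \<delta> by linarith
    then have "f' t = smoothstep_deriv ((t - ?\<alpha>) / (\<delta>/2)) / (\<delta>/2)" by (rule near)
    moreover have "1 / \<delta> \<le> smoothstep_deriv ((t - ?\<alpha>) / (\<delta>/2)) / (\<delta>/2)"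
      using \<delta> 1 by (simp add: field_simps)
    ultimately show ?thesis by simp
  qed
  have far: "\<bar>f' t\<bar> \<le> 6 / H" if "\<not> (c \<le> t \<and> t \<le> c + \<delta>)" for t
  proof -
    have "smoothstep_deriv ((t - ?\<alpha>) / (\<delta>/2)) = 0"
      using that low[of t] low1[of t] \<delta> by (intro smoothstep_deriv_eq_0) linarith
    then have "\<bar>f' t\<bar> = smoothstep ((t - ?\<alpha>) / (\<delta>/2)) * (smoothstep_deriv ((?\<beta> - t) / (H/4)) / (H/4))"
      using H smoothstep_bounds smoothstep_deriv_nonneg by (simp add: f'_def plateau_deriv_def abs_mult)
    also have "\<dots> \<le> 1 * ((3/2) / (H/4))"
      using H smoothstep_bounds smoothstep_deriv_nonneg smoothstep_deriv_le
      by (intro mult_mono divide_right_mono) auto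
    finally show ?thesis by simp
  qed
  show ?thesis
  proof (cases "\<sigma> = 1")
    case True
    then have [simp]: "q = c" using q by simp
    show ?thesis
      by (rule that[of f f' ?\<alpha> ?\<beta>])
         (use d c s s' nn mid far True \<delta> H plateau_bounds in \<open>auto simp: f_def\<close>)
  next
    case False
    then have \<sigma>': "\<sigma> = - 1" "q = c + H - \<delta>" using \<sigma> q by auto
    let ?r = "\<lambda>t. 2 * c + H - t"
    have 1: "((\<lambda>t. f (?r t)) has_real_derivative - f' (?r t)) (at t)" for t
    proof -
      have "(?r has_real_derivative - 1) (at t)" by (auto intro!: derivative_eq_intros)
      from DERIV_chain2[OF d this] show ?thesis by simp
    qed
    have 2: "continuous_on UNIV (\<lambda>t. - f' (?r t))"
      by (intro continuous_intros continuous_on_compose2[OF c]) auto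
    show ?thesis
    proof (rule that[of "\<lambda>t. f (?r t)" "\<lambda>t. - f' (?r t)" "?r ?\<beta>" "?r ?\<alpha>"])
      show "\<And>t. f (?r t) \<noteq> 0 \<Longrightarrow> ?r ?\<beta> \<le> t \<and> t \<le> ?r ?\<alpha>"
        using s by force
      show "\<And>t. - f' (?r t) \<noteq> 0 \<Longrightarrow> ?r ?\<beta> \<le> t \<and> t \<le> ?r ?\<alpha>"
        using s' by force
      show "\<And>t. \<bar>f (?r t)\<bar> \<le> 1" using plateau_bounds by (auto simp: f_def)
      show "\<And>t. q \<le> t \<Longrightarrow> t \<le> q + \<delta> \<Longrightarrow> 0 \<le> \<sigma> * - f' (?r t)"
        using nn \<sigma>' by auto
      show "\<And>t. q + 3/8 * \<delta> \<le> t \<Longrightarrow> t \<le> q + 5/8 * \<delta> \<Longrightarrow> 1 / \<delta> \<le> \<sigma> * - f' (?r t)"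
        using mid \<sigma>' by auto
      show "\<And>t. \<not> (q \<le> t \<and> t \<le> q + \<delta>) \<Longrightarrow> \<bar>- f' (?r t)\<bar> \<le> 6 / H"
        using far \<sigma>' by auto
    qed (use 1 2 \<delta> H in auto)
  qed
qed

text \<open>Let \<open>w\<close> stay close to a value \<open>z\<close> on a small cube \<open>Q\<close> that touches a face of a large cell, and
  let \<open>Col\<close> be the column through \<open>Q\<close> orthogonal to that face. The test function is the profile \<open>f\<close>
  along the column times plateaus across it. Its derivative along the column is of order \<open>1 / \<delta>\<close>
  inside \<open>Q\<close> and has a fixed sign there, while it is bounded by \<open>M\<close> in the rest of the column. So
  integration by parts bounds \<open>\<bar>z\<bar>\<close> times the area of the face of \<open>Q\<close> by an integral over the column.\<close>

lemma column_estimate: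
  fixes D :: "(real^'n) set" and w :: "real^'n \<Rightarrow> complex" and q :: "real^'n"
  assumes D: "open D" "bounded D"
    and w: "w \<in> L2 (lebesgue_on D)" "g \<in> L2 (lebesgue_on D)" "has_weak_gradient D w g"
    and \<delta>: "0 < \<delta>" and \<sigma>: "\<sigma> = 1 \<or> \<sigma> = - 1"
    and f: "\<And>t. (f has_real_derivative f' t) (at t)" "continuous_on UNIV f'"
    and lohi: "c < lo" "hi < c + H"
    and supp: "\<And>t. f t \<noteq> 0 \<Longrightarrow> lo \<le> t \<and> t \<le> hi" "\<And>t. f' t \<noteq> 0 \<Longrightarrow> lo \<le> t \<and> t \<le> hi"
    and f1: "\<And>t. \<bar>f t\<bar> \<le> 1"
    and near: "\<And>t. q $ k \<le> t \<Longrightarrow> t \<le> q $ k + \<delta> \<Longrightarrow> 0 \<le> \<sigma> * f' t"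
    and mid: "\<And>t. q $ k + 3/8 * \<delta> \<le> t \<Longrightarrow> t \<le> q $ k + 5/8 * \<delta> \<Longrightarrow> 1 / \<delta> \<le> \<sigma> * f' t"
    and far: "\<And>t. \<not> (q $ k \<le> t \<and> t \<le> q $ k + \<delta>) \<Longrightarrow> \<bar>f' t\<bar> \<le> M"
    and Col: "Col = box (\<chi> j. if j = k then c else q $ j) (\<chi> j. if j = k then c + H else q $ j + \<delta>)" "Col \<subseteq> D"
    and z: "z \<noteq> 0" "\<And>x. x \<in> cube q \<delta> \<Longrightarrow> x \<in> D \<Longrightarrow> norm (w x - z) \<le> norm z / 2"
  shows "norm z / 2 * \<delta> ^ (CARD('n) - 1) / 4 ^ CARD('n)
     \<le> (LINT x|lebesgue_on D. indicator Col x * (norm (g x $ k) + M * norm (w x)))"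
proof -
  let ?M = "lebesgue_on D"
  have fin: "emeasure ?M (space ?M) < \<infinity>" by (rule emeasure_lebesgue_on_finite[OF D])
  define p where "p j = plateau (q $ j + \<delta>/4) (\<delta>/8) (q $ j + 3/4 * \<delta>) (\<delta>/8)" for j
  define p' where "p' j = plateau_deriv (q $ j + \<delta>/4) (\<delta>/8) (q $ j + 3/4 * \<delta>) (\<delta>/8)" for j
  define F where "F j = (if j = k then f else p j)" for j
  define F' where "F' j = (if j = k then f' else p' j)" for j
  define \<phi> where "\<phi> x = (\<Prod>j\<in>UNIV. F j (x $ j))" for x :: "real^'n"
  define \<phi>' where "\<phi>' x = (\<chi> k. F' k (x $ k) * (\<Prod>j\<in>UNIV - {k}. F j (x $ j)))" for x :: "real^'n"
  define \<rho> where "\<rho> x = \<phi>' x $ k" for x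
  define \<zeta> where "\<zeta> x = (\<Prod>j\<in>UNIV - {k}. p j (x $ j))" for x :: "real^'n"
  have \<rho>: "\<rho> x = f' (x $ k) * \<zeta> x" for x
    unfolding \<rho>_def \<phi>'_def \<zeta>_def by (auto simp: F'_def F_def intro!: prod.cong)
  have \<phi>: "\<phi> x = f (x $ k) * \<zeta> x" for x
    unfolding \<phi>_def \<zeta>_def by (subst prod.remove[of _ k]) (auto simp: F_def intro!: prod.cong)
  have psupp: "q $ j + \<delta>/4 \<le> t \<and> t \<le> q $ j + 3/4 * \<delta>" if "p j t \<noteq> 0" for j t
    using plateau_support[of "\<delta>/8" "\<delta>/8" _ _ t] that \<delta> by (auto simp: p_def)
  have \<zeta>: "0 \<le> \<zeta> x" "\<zeta> x \<le> 1" for x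
    unfolding \<zeta>_def p_def using plateau_bounds by (auto intro!: prod_nonneg prod_le_1)
  have T: "test_function D \<phi> \<phi>'"
    unfolding \<phi>_def[abs_def] \<phi>'_def[abs_def]
  proof (rule test_function_prod[where a = "\<chi> j. if j = k then lo else q $ j + \<delta>/4" and b = "\<chi> j. if j = k then hi else q $ j + 3/4 * \<delta>"])
    show "(F j has_real_derivative F' j t) (at t)" for j t
      using f DERIV_plateau by (auto simp: F_def F'_def p_def p'_def)
    show "continuous_on UNIV (F' j)" for j
      using f continuous_plateau_deriv by (auto simp: F'_def p'_def)
    show "(\<chi> j. if j = k then lo else q $ j + \<delta>/4) $ j \<le> t \<and> t \<le> (\<chi> j. if j = k then hi else q $ j + 3/4 * \<delta>) $ j"
      if "F j t \<noteq> 0" for j t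
      using that supp(1) psupp by (auto simp: F_def split: if_splits)
    have "cbox (\<chi> j. if j = k then lo else q $ j + \<delta>/4) (\<chi> j. if j = k then hi else q $ j + 3/4 * \<delta>) \<subseteq> Col"
    proof
      fix x assume x: "x \<in> cbox (\<chi> j. if j = k then lo else q $ j + \<delta>/4) (\<chi> j. if j = k then hi else q $ j + 3/4 * \<delta>)"
      show "x \<in> Col"
        unfolding Col mem_box_cart
      proof
        fix i
        show "(\<chi> j. if j = k then c else q $ j) $ i < x $ i \<and> x $ i < (\<chi> j. if j = k then c + H else q $ j + \<delta>) $ i"
          using x[unfolded mem_box_cart, THEN spec, of i] lohi \<delta> by (auto split: if_splits)
      qed
    qed
    then show "cbox (\<chi> j. if j = k then lo else q $ j + \<delta>/4) (\<chi> j. if j = k then hi else q $ j + 3/4 * \<delta>) \<subseteq> D"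
      using Col(2) by blast
  qed
  have \<zeta>Col: "x \<in> Col" if "\<zeta> x \<noteq> 0" "lo \<le> x $ k" "x $ k \<le> hi" for x
  proof -
    have "q $ j < x $ j \<and> x $ j < q $ j + \<delta>" if "j \<noteq> k" for j
      using psupp[of j "x $ j"] \<open>\<zeta> x \<noteq> 0\<close> that \<delta> by (force simp: \<zeta>_def)
    then show ?thesis using that(2,3) lohi by (auto simp: Col mem_box_cart)
  qed
  have cont: "continuous_on UNIV \<phi>" "continuous_on UNIV \<rho>"
    using test_function_continuous[OF T] unfolding \<rho>_def by (auto intro!: continuous_intros)
  have [measurable]: "\<phi> \<in> borel_measurable ?M" "\<rho> \<in> borel_measurable ?M"
    by (auto intro!: measurable_lebesgue_on_continuous cont)
  have [measurable]: "w \<in> borel_measurable ?M" "g \<in> borel_measurable ?M" using w by auto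
  have sets: "A \<inter> D \<in> sets ?M" if "A \<in> sets borel" for A
    using that D by (subst sets_restrict_space_iff) auto
  have ind: "indicator A \<in> borel_measurable ?M" if "A \<in> sets borel" for A :: "(real^'n) set" and x
  proof -
    have "indicator A \<in> borel_measurable lebesgue" using that by (intro borel_measurable_indicator) auto
    then show ?thesis by (rule measurable_restrict_space1)
  qed
  let ?S = "cube q \<delta>"
  have bC: "Col \<in> sets borel" by (simp add: Col)
  let ?Q = "cbox (\<chi> j. q $ j + 3/8 * \<delta>) (\<chi> j. q $ j + 5/8 * \<delta>)"
  have iC [measurable]: "(indicator Col :: _ \<Rightarrow> real) \<in> borel_measurable ?M" using ind[OF bC] .
  note t2 = test_function_L2[OF T fin]
  have int_w\<rho>: "integrable ?M (\<lambda>x. w x * complex_of_real (\<rho> x))"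
    using L2_mult_integrable[OF w(1) t2(2)[of k]] by (simp add: \<rho>_def)
  have int_g\<phi>: "integrable ?M (\<lambda>x. g x $ k * complex_of_real (\<phi> x))"
    using L2_mult_integrable[OF L2_component[OF w(2)] t2(1)] .
  have int_w: "integrable ?M (\<lambda>x. norm (w x))" "integrable ?M (\<lambda>x. norm (g x $ k))"
    using L2_integrable[OF fin w(1)] L2_integrable[OF fin L2_component[OF w(2)]] by auto
  have int_C: "integrable ?M (\<lambda>x. indicator Col x * (norm (g x $ k) + M * norm (w x)))"
    by (rule Bochner_Integration.integrable_bound[OF Bochner_Integration.integrable_add[OF int_w(2) integrable_mult_right[OF int_w(1), of M]]])
      (auto split: split_indicator)
  \<comment> \<open>The phase that turns \<open>z\<close> into a positive number and compensates the sign of the profile.\<close>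
  define u where "u = of_real \<sigma> * cnj z / of_real (norm z)"
  have u: "norm u = 1" using z \<sigma> by (auto simp: u_def norm_mult norm_divide)
  have sub: "?Q \<subseteq> D"
  proof
    fix x assume x: "x \<in> ?Q"
    have x1: "q $ j + 3/8 * \<delta> \<le> x $ j \<and> x $ j \<le> q $ j + 5/8 * \<delta>" for j
      using x by (auto simp: mem_box_cart)
    have "1 / \<delta> \<le> \<sigma> * f' (x $ k)" using x1[of k] mid by auto
    then have "f' (x $ k) \<noteq> 0" using \<delta> by auto
    then have "lo \<le> x $ k \<and> x $ k \<le> hi" using supp by blast
    moreover have "q $ j < x $ j \<and> x $ j < q $ j + \<delta>" for j
      using x1[of j] \<delta> by linarith
    ultimately have "x \<in> Col" using lohi by (auto simp: Col mem_box_cart)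
    then show "x \<in> D" using Col by blast
  qed
  have mQ: "?Q \<in> sets ?M" using sets[of ?Q] sub by (simp add: Int_absorb2)
  have M: "0 \<le> M" using far[of "q $ k + \<delta> + 1"] \<delta> by (smt (verit))
  \<comment> \<open>The first summand on the right integrates to zero by the definition of the weak gradient, so this
    pointwise bound gives the claim after integration. On the left is the contribution of the middle part \<open>?Q\<close>
    of the small cube, where all plateaus equal one.\<close>
  have pt: "norm z / (2 * \<delta>) * indicator ?Q x
     \<le> Re (u * (w x * complex_of_real (\<rho> x) + g x $ k * complex_of_real (\<phi> x))) + indicator Col x * (norm (g x $ k) + M * norm (w x))"
    if x: "x \<in> D" for x
  proof -
    have "norm z / (2 * \<delta>) * indicator ?Q x - indicator Col x * (M * norm (w x)) \<le> Re (u * (w x * complex_of_real (\<rho> x)))"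
    proof (cases "x \<in> ?S")
      case True
      have "Re (cnj z * w x) = Re (cnj z * z) + Re (cnj z * (w x - z))"
        by (simp add: algebra_simps)
      moreover have "Re (cnj z * z) = (norm z)\<^sup>2"
        by (metis Re_complex_of_real complex_norm_square mult.commute)
      moreover have "\<bar>Re (cnj z * (w x - z))\<bar> \<le> (norm z)\<^sup>2 / 2"
        using z(2)[OF True x] abs_Re_le_cmod[of "cnj z * (w x - z)"]
          mult_left_mono[of "norm (w x - z)" "norm z / 2" "norm z"] by (simp add: norm_mult power2_eq_square)
      ultimately have "(norm z)\<^sup>2 / 2 \<le> Re (cnj z * w x)"
        by linarith
      then have *: "norm z / 2 \<le> Re (cnj z * w x) / norm z"
        using z(1) by (simp add: field_simps power2_eq_square)
      have eq: "Re (u * (w x * complex_of_real (\<rho> x))) = Re (cnj z * w x) / norm z * (\<sigma> * f' (x $ k) * \<zeta> x)"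
        unfolding u_def \<rho> by (simp add: Re_divide_of_real algebra_simps)
      have nn: "0 \<le> \<sigma> * f' (x $ k)"
        using near[of "x $ k"] True by (auto simp: mem_cube)
      have "norm z / (2 * \<delta>) * indicator ?Q x \<le> norm z / 2 * (\<sigma> * f' (x $ k) * \<zeta> x)"
      proof (cases "x \<in> ?Q")
        case True
        then have x1: "q $ j + 3/8 * \<delta> \<le> x $ j \<and> x $ j \<le> q $ j + 5/8 * \<delta>" for j
          by (auto simp: mem_box_cart)
        have "p j (x $ j) = 1" for j
          unfolding p_def using \<delta> x1[of j] by (intro plateau_eq_1) auto
        then have "\<zeta> x = 1" by (simp add: \<zeta>_def)
        moreover have "1 / \<delta> \<le> \<sigma> * f' (x $ k)" using x1[of k] mid by blast
        then have "norm z / 2 * (1 / \<delta>) \<le> norm z / 2 * (\<sigma> * f' (x $ k))"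
          by (intro mult_left_mono) auto
        ultimately show ?thesis using True by simp
      next
        case False
        then show ?thesis using nn \<zeta>(1) by simp
      qed
      also have "\<dots> \<le> Re (cnj z * w x) / norm z * (\<sigma> * f' (x $ k) * \<zeta> x)"
        using * nn \<zeta>(1) by (intro mult_right_mono) auto
      also have "\<dots> = Re (u * (w x * complex_of_real (\<rho> x)))" by (rule eq[symmetric])
      finally have "norm z / (2 * \<delta>) * indicator ?Q x \<le> Re (u * (w x * complex_of_real (\<rho> x)))" .
      moreover have "0 \<le> indicator Col x * (M * norm (w x))" using M by simp
      ultimately show ?thesis by linarith
    next
      case False
      then have "\<not> (\<forall>j. q $ j \<le> x $ j \<and> x $ j \<le> q $ j + \<delta>)" by (simp add: mem_cube)
      then obtain j where j: "\<not> (q $ j \<le> x $ j \<and> x $ j \<le> q $ j + \<delta>)" by blast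
      have "x \<notin> ?Q"
      proof
        assume "x \<in> ?Q"
        then have "q $ j + 3/8 * \<delta> \<le> x $ j \<and> x $ j \<le> q $ j + 5/8 * \<delta>" by (simp add: mem_box_cart)
        then show False using j \<delta> by linarith
      qed
      moreover have "\<bar>\<rho> x\<bar> * norm (w x) \<le> indicator Col x * (M * norm (w x))"
      proof (cases "\<rho> x = 0")
        case True
        then show ?thesis using M by simp
      next
        case False
        then have "f' (x $ k) \<noteq> 0" "\<zeta> x \<noteq> 0" using \<rho>[of x] by auto
        then have xC: "x \<in> Col" using supp(2) by (intro \<zeta>Col) auto
        have xj: "q $ j < x $ j \<and> x $ j < q $ j + \<delta>" if "j \<noteq> k" for j
          using xC[unfolded Col mem_box_cart, rule_format, of j] that by simp
        have "\<not> (q $ k \<le> x $ k \<and> x $ k \<le> q $ k + \<delta>)"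
        proof
          assume "q $ k \<le> x $ k \<and> x $ k \<le> q $ k + \<delta>"
          then have "q $ j \<le> x $ j \<and> x $ j \<le> q $ j + \<delta>" for j
            using xj[of j] by (cases "j = k") auto
          then show False using \<open>x \<notin> ?S\<close> by (simp add: mem_cube)
        qed
        then have "\<bar>f' (x $ k)\<bar> \<le> M" by (rule far)
        then have "\<bar>\<rho> x\<bar> \<le> M * 1" unfolding \<rho> abs_mult using \<zeta>[of x] by (intro mult_mono) auto
        then show ?thesis using xC by (simp add: mult_right_mono)
      qed
      moreover have "\<bar>Re (u * (w x * complex_of_real (\<rho> x)))\<bar> \<le> \<bar>\<rho> x\<bar> * norm (w x)"
        using abs_Re_le_cmod[of "u * (w x * complex_of_real (\<rho> x))"] by (simp add: norm_mult u mult.commute)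
      ultimately show ?thesis by simp
    qed
    moreover have "\<bar>Re (u * (g x $ k * complex_of_real (\<phi> x)))\<bar> \<le> indicator Col x * norm (g x $ k)"
    proof -
      have "\<bar>Re (u * (g x $ k * complex_of_real (\<phi> x)))\<bar> \<le> \<bar>\<phi> x\<bar> * norm (g x $ k)"
        using abs_Re_le_cmod[of "u * (g x $ k * complex_of_real (\<phi> x))"] by (simp add: norm_mult u mult.commute)
      also have "\<dots> \<le> indicator Col x * norm (g x $ k)"
      proof (cases "\<phi> x = 0")
        case False
        then have "f (x $ k) \<noteq> 0" "\<zeta> x \<noteq> 0" using \<phi>[of x] by auto
        then have "x \<in> Col" using supp(1) by (intro \<zeta>Col) auto
        moreover have "\<bar>\<phi> x\<bar> \<le> 1" using \<phi> f1 \<zeta> by (auto simp: abs_mult intro!: mult_le_one)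
        ultimately show ?thesis by (simp add: mult_left_le_one_le)
      qed simp
      finally show ?thesis .
    qed
    ultimately show ?thesis by (simp add: distrib_left)
  qed
  have zero: "(LINT x|?M. Re (u * (w x * complex_of_real (\<rho> x) + g x $ k * complex_of_real (\<phi> x)))) = 0"
    and int0: "integrable ?M (\<lambda>x. Re (u * (w x * complex_of_real (\<rho> x) + g x $ k * complex_of_real (\<phi> x))))"
  proof -
    have int: "integrable ?M (\<lambda>x. u * (w x * complex_of_real (\<rho> x) + g x $ k * complex_of_real (\<phi> x)))"
      by (intro integrable_mult_right Bochner_Integration.integrable_add int_w\<rho> int_g\<phi>)
    then show "integrable ?M (\<lambda>x. Re (u * (w x * complex_of_real (\<rho> x) + g x $ k * complex_of_real (\<phi> x))))"
      by (rule integrable_Re)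
    have "(LINT x|?M. w x * complex_of_real (\<rho> x)) = - (LINT x|?M. g x $ k * complex_of_real (\<phi> x))"
      using w(3)[unfolded has_weak_gradient_def, rule_format, OF T, of k] by (simp only: \<rho>_def)
    then show "(LINT x|?M. Re (u * (w x * complex_of_real (\<rho> x) + g x $ k * complex_of_real (\<phi> x)))) = 0"
      using int_w\<rho> int_g\<phi> by (subst integral_Re[OF int]) simp
  qed
  have "norm z / 2 * \<delta> ^ (CARD('n) - 1) / 4 ^ CARD('n) = norm z / (2 * \<delta>) * (\<delta> / 4) ^ CARD('n)"
  proof -
    have "\<delta> ^ CARD('n) = \<delta> * \<delta> ^ (CARD('n) - 1)"
      by (metis Suc_pred' power_Suc zero_less_card_finite)
    then show ?thesis using \<delta> by (simp add: power_divide)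
  qed
  also have "\<dots> = (LINT x|?M. norm z / (2 * \<delta>) * indicator ?Q x)"
  proof -
    have "measure lebesgue ?Q = (\<delta> / 4) ^ CARD('n)"
      using \<delta> by (subst measure_completion) (auto simp: content_cbox_if_cart interval_eq_empty_cart not_less)
    moreover have "(LINT x|?M. indicator ?Q x) = measure ?M ?Q"
      using sub by (simp add: space_restrict_space Int_absorb2)
    moreover have "measure ?M ?Q = measure lebesgue ?Q"
      using sub D by (intro measure_restrict_space) auto
    ultimately show ?thesis by simp
  qed
  also have "\<dots> \<le> (LINT x|?M. Re (u * (w x * complex_of_real (\<rho> x) + g x $ k * complex_of_real (\<phi> x))) + indicator Col x * (norm (g x $ k) + M * norm (w x)))"
  proof (rule integral_mono)
    show "integrable ?M (\<lambda>x. norm z / (2 * \<delta>) * indicator ?Q x)"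
      using fin emeasure_space[of ?M ?Q] by (intro integrable_mult_right integrable_real_indicator mQ) auto
  qed (use pt int0 int_C in \<open>auto simp: space_restrict_space\<close>)
  also have "\<dots> = (LINT x|?M. indicator Col x * (norm (g x $ k) + M * norm (w x)))"
    using int0 int_C zero by simp
  finally show ?thesis .
qed

lemma L2_square_integrable:
  assumes "f \<in> L2 M"
  shows "integrable M (\<lambda>x. (norm (f x))\<^sup>2)"
  using assms by (intro integrableI_bounded) (auto simp: L2_def sqnorm_def)

text \<open>Young's inequality converts the estimate of the column into one by the squares that the
  \<open>W12\<close> norm controls. The linear term that it creates is proportional to the area of the face and is
  absorbed on the left, where \<open>\<epsilon>\<close> bounds the value at \<open>p\<close> from below.\<close>

lemma column_square_estimate:
  fixes D :: "(real^'n) set" and w :: "real^'n \<Rightarrow> complex" and c :: "real^'n" and j :: "'n \<Rightarrow> nat"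
  assumes D: "open D" "bounded D"
    and w: "w \<in> L2 (lebesgue_on D)" "g \<in> L2 (lebesgue_on D)" "has_weak_gradient D w g"
    and H: "0 < H" and sub: "interior (cube c H) \<subseteq> D"
    and n: "2 \<le> n" "\<delta> = H / real n" and j: "\<And>i. j i < n" "j k = (if s then n - 1 else 0)"
    and q: "q = (\<chi> i. c $ i + \<delta> * real (j i))"
    and Col: "Col = box (\<chi> i. if i = k then c $ k else q $ i) (\<chi> i. if i = k then c $ k + H else q $ i + \<delta>)"
    and \<epsilon>: "0 < \<epsilon>" and p: "\<epsilon> < norm (w p)"
    and osc: "\<And>x. x \<in> cube q \<delta> \<Longrightarrow> x \<in> D \<Longrightarrow> norm (w x - w p) \<le> \<epsilon> / 2"
  shows "ennreal (\<delta> ^ (CARD('n) - 1)) \<le> ennreal (8 * H * 16 ^ CARD('n) / \<epsilon>\<^sup>2) *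
      (\<integral>\<^sup>+ x. ennreal ((norm (g x))\<^sup>2 + (6 / H)\<^sup>2 * (norm (w x))\<^sup>2) * indicator Col x \<partial>lebesgue_on D)"
proof -
  let ?M = "lebesgue_on D" and ?N = "CARD('n)"
  have fin: "emeasure ?M (space ?M) < \<infinity>" by (rule emeasure_lebesgue_on_finite[OF D])
  have \<delta>: "0 < \<delta>" "\<delta> \<le> H / 2"
    using n(1) H divide_left_mono[of 2 "real n" H] by (auto simp: n(2))
  have nd: "real n * \<delta> = H" using n by simp
  \<comment> \<open>The profile is increasing at a lower face and decreasing at an upper face.\<close>
  define \<sigma> :: real where "\<sigma> = (if s then - 1 else 1)"
  have \<sigma>: "\<sigma> = 1 \<or> \<sigma> = - 1" by (simp add: \<sigma>_def)
  have qk: "q $ k = (if \<sigma> = 1 then c $ k else c $ k + H - \<delta>)"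
  proof -
    have "real (n - 1) = real n - 1" using n by simp
    then have "\<delta> * real (n - 1) = H - \<delta>" using nd by (simp add: algebra_simps)
    then show ?thesis using j(2) by (simp add: q \<sigma>_def)
  qed
  have qi: "c $ i \<le> q $ i \<and> q $ i + \<delta> \<le> c $ i + H" for i
  proof -
    have "real (j i) + 1 \<le> real n" using j(1)[of i] by linarith
    then have "\<delta> * (real (j i) + 1) \<le> \<delta> * real n" using \<delta> by (intro mult_left_mono) auto
    then show ?thesis using nd \<delta> by (simp add: q algebra_simps)
  qed
  have ColD: "Col \<subseteq> D"
  proof (rule order_trans[OF _ sub], rule subsetI)
    fix x assume x: "x \<in> Col"
    have "c $ i < x $ i \<and> x $ i < c $ i + H" for i
      using x[unfolded Col mem_box_cart, rule_format, of i] qi[of i] by (auto split: if_splits)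
    then show "x \<in> interior (cube c H)" by (simp add: interior_cube mem_box_cart)
  qed
  obtain f f' lo hi where ramp:
    "\<And>t. (f has_real_derivative f' t) (at t)" "continuous_on UNIV f'"
    "c $ k < lo" "hi < c $ k + H" "\<And>t. f t \<noteq> 0 \<Longrightarrow> lo \<le> t \<and> t \<le> hi" "\<And>t. f' t \<noteq> 0 \<Longrightarrow> lo \<le> t \<and> t \<le> hi"
    "\<And>t. \<bar>f t\<bar> \<le> 1"
    "\<And>t. q $ k \<le> t \<Longrightarrow> t \<le> q $ k + \<delta> \<Longrightarrow> 0 \<le> \<sigma> * f' t"
    "\<And>t. q $ k + 3/8 * \<delta> \<le> t \<Longrightarrow> t \<le> q $ k + 5/8 * \<delta> \<Longrightarrow> 1 / \<delta> \<le> \<sigma> * f' t"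
    "\<And>t. \<not> (q $ k \<le> t \<and> t \<le> q $ k + \<delta>) \<Longrightarrow> \<bar>f' t\<bar> \<le> 6 / H"
    by (rule ramp_exists[OF \<delta> \<sigma> qk]) blast
  have "w p \<noteq> 0" using p \<epsilon> by auto
  moreover have "norm (w x - w p) \<le> norm (w p) / 2" if "x \<in> cube q \<delta>" "x \<in> D" for x
    using osc[OF that] p by linarith
  ultimately have est: "norm (w p) / 2 * \<delta> ^ (?N - 1) / 4 ^ ?N
     \<le> (LINT x|?M. indicator Col x * (norm (g x $ k) + 6 / H * norm (w x)))"
    by (intro column_estimate[OF D w \<delta>(1) \<sigma> ramp Col ColD])
  define A where "A = 1 / (4::real) ^ ?N"
  have A: "0 < A" by (simp add: A_def)
  \<comment> \<open>With this \<open>\<tau>\<close> the linear term \<open>\<tau> \<bar>Col\<bar>\<close> is half of the left-hand side.\<close>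
  define \<tau> where "\<tau> = A * \<epsilon> / (4 * H)"
  have \<tau>: "0 < \<tau>" using A \<epsilon> H by (simp add: \<tau>_def)
  define G where "G x = (norm (g x))\<^sup>2 + (6 / H)\<^sup>2 * (norm (w x))\<^sup>2" for x
  have ptw: "norm (g x $ k) + 6 / H * norm (w x) \<le> \<tau> + G x / (2 * \<tau>)" for x
  proof -
    have amgm: "t \<le> \<tau> / 2 + t\<^sup>2 / (2 * \<tau>)" for t
      using zero_le_power2[of "t - \<tau>"] \<tau> by (simp add: field_simps power2_eq_square)
    have "(norm (g x $ k))\<^sup>2 \<le> (norm (g x))\<^sup>2"
      by (intro power_mono Finite_Cartesian_Product.norm_nth_le) auto
    then have "(norm (g x $ k))\<^sup>2 / (2 * \<tau>) \<le> (norm (g x))\<^sup>2 / (2 * \<tau>)"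
      using \<tau> by (intro divide_right_mono) auto
    then have "norm (g x $ k) + 6 / H * norm (w x) \<le> (\<tau> / 2 + (norm (g x))\<^sup>2 / (2 * \<tau>)) + (\<tau> / 2 + (6 / H * norm (w x))\<^sup>2 / (2 * \<tau>))"
      using amgm[of "norm (g x $ k)"] amgm[of "6 / H * norm (w x)"] by linarith
    also have "\<dots> = \<tau> + G x / (2 * \<tau>)"
      by (simp add: G_def power_mult_distrib power_divide add_divide_distrib)
    finally show ?thesis .
  qed
  have mC: "Col \<in> sets ?M" using ColD D by (subst sets_restrict_space_iff) (auto simp: Col)
  have measC: "measure ?M Col = H * \<delta> ^ (?N - 1)"
  proof -
    have "measure ?M Col = measure lebesgue Col"
      using ColD D by (intro measure_restrict_space) auto
    also have "\<dots> = measure lborel Col" by (subst measure_completion) (auto simp: Col)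
    also have "\<dots> = (\<Prod>i\<in>UNIV. if i = k then H else \<delta>)"
      unfolding Col measure_lborel_box_eq measure_lborel_cbox_eq[symmetric]
      using H \<delta> by (subst content_cbox_cart) (auto simp: interval_ne_empty_cart intro!: prod.cong)
    also have "\<dots> = H * \<delta> ^ (?N - 1)"
      by (subst prod.remove[of _ k]) (auto simp: card_Diff_singleton)
    finally show ?thesis .
  qed
  have finC: "emeasure ?M Col < \<infinity>"
    using fin emeasure_space[of ?M Col] by (auto elim: le_less_trans)
  have intG: "integrable ?M G"
    unfolding G_def[abs_def] using w by (intro Bochner_Integration.integrable_add integrable_mult_right L2_square_integrable)
  have G0: "0 \<le> G x" for x by (simp add: G_def)
  define J where "J = (LINT x|?M. G x * indicator Col x)"
  have intGC: "integrable ?M (\<lambda>x. G x * indicator Col x)"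
    using integrable_mult_indicator[OF mC intG] by (simp add: mult.commute)
  have "A * \<epsilon> / 2 * \<delta> ^ (?N - 1) \<le> norm (w p) / 2 * \<delta> ^ (?N - 1) / 4 ^ ?N"
    using p \<delta> by (simp add: A_def field_simps)
  also note est
  also have "(LINT x|?M. indicator Col x * (norm (g x $ k) + 6 / H * norm (w x)))
      \<le> (LINT x|?M. \<tau> * indicator Col x + (1 / (2 * \<tau>)) * (G x * indicator Col x))"
  proof (rule integral_mono')
    show "integrable ?M (\<lambda>x. \<tau> * indicator Col x + (1 / (2 * \<tau>)) * (G x * indicator Col x))"
      using intGC finC mC by (intro Bochner_Integration.integrable_add integrable_mult_right integrable_real_indicator)
    show "indicator Col x * (norm (g x $ k) + 6 / H * norm (w x)) \<le> \<tau> * indicator Col x + (1 / (2 * \<tau>)) * (G x * indicator Col x)" for x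
      using ptw[of x] by (auto split: split_indicator)
    show "0 \<le> \<tau> * indicator Col x + (1 / (2 * \<tau>)) * (G x * indicator Col x)" for x
      using \<tau> G0[of x] by (auto split: split_indicator)
  qed
  also have "\<dots> = \<tau> * (H * \<delta> ^ (?N - 1)) + J / (2 * \<tau>)"
    using intGC finC mC measC
    by (subst Bochner_Integration.integral_add)
       (auto intro!: integrable_mult_right integrable_real_indicator simp: J_def Int_absorb2[OF ColD])
  also have "\<tau> * (H * \<delta> ^ (?N - 1)) = A * \<epsilon> / 4 * \<delta> ^ (?N - 1)"
    using H by (simp add: \<tau>_def)
  finally have "A * \<epsilon> / 4 * \<delta> ^ (?N - 1) \<le> J / (2 * \<tau>)" by (simp add: field_simps)
  then have "\<delta> ^ (?N - 1) \<le> (J / (2 * \<tau>)) / (A * \<epsilon> / 4)"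
    using A \<epsilon> by (subst le_divide_eq) (auto simp: mult_ac)
  also have "\<dots> = 8 * H * 16 ^ ?N / \<epsilon>\<^sup>2 * J"
  proof -
    have "A * A = 1 / 16 ^ ?N" by (simp add: A_def power_mult_distrib[symmetric])
    moreover have "(J / (2 * \<tau>)) / (A * \<epsilon> / 4) = 8 * H / (A * A * \<epsilon>\<^sup>2) * J"
      using A \<epsilon> H by (simp add: \<tau>_def field_simps power2_eq_square)
    ultimately show ?thesis by simp
  qed
  finally have "ennreal (\<delta> ^ (?N - 1)) \<le> ennreal (8 * H * 16 ^ ?N / \<epsilon>\<^sup>2) * ennreal J"
    using H by (simp add: ennreal_mult'[symmetric] ennreal_leI)
  also have "ennreal J = (\<integral>\<^sup>+ x. ennreal (G x * indicator Col x) \<partial>?M)"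
    unfolding J_def by (rule nn_integral_eq_integral[OF intGC, symmetric]) (simp add: G0)
  also have "\<dots> = (\<integral>\<^sup>+ x. ennreal (G x) * indicator Col x \<partial>?M)"
    by (intro nn_integral_cong) (auto split: split_indicator)
  finally show ?thesis unfolding G_def .
qed

lemma hausdorff_content_le_finite_cover:
  fixes C :: "'i \<Rightarrow> 'a::metric_space set"
  assumes I: "finite I" and cover: "A \<subseteq> (\<Union>i\<in>I. C i)" and \<delta>: "0 \<le> \<delta>"
    and C: "\<And>i. i \<in> I \<Longrightarrow> bounded (C i) \<and> diameter (C i) \<le> \<delta>"
  shows "hausdorff_content m \<delta> A \<le> (\<Sum>i\<in>I. ennreal (unit_ball_vol (real m) * (diameter (C i) / 2) ^ m))"
proof -
  obtain h where h: "bij_betw h {..<card I} I"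
    using ex_bij_betw_nat_finite[OF I] by (auto simp: atLeast0LessThan)
  define E where "E n = (if n < card I then C (h n) else {})" for n
  have hI: "h n \<in> I" if "n < card I" for n using h that by (auto simp: bij_betw_def)
  let ?v = "\<lambda>S :: 'a set. ennreal (unit_ball_vol (real m) * (diameter S / 2) ^ m)"
  have "A \<subseteq> (\<Union>n. E n)"
  proof
    fix x assume "x \<in> A"
    then obtain i where i: "i \<in> I" "x \<in> C i" using cover by blast
    then obtain n where "n < card I" "i = h n" using h by (auto simp: bij_betw_def)
    then show "x \<in> (\<Union>n. E n)" using i by (auto simp: E_def)
  qed
  moreover have "bounded (E n) \<and> diameter (E n) \<le> \<delta>" for n
    using C[OF hI] \<delta> by (auto simp: E_def)
  ultimately have "hausdorff_content m \<delta> A \<le> (\<Sum>n. if E n = {} then 0 else ?v (E n))"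
    unfolding hausdorff_content_def by (intro INF_lower) auto
  also have "\<dots> = (\<Sum>n<card I. if E n = {} then 0 else ?v (E n))"
    by (rule suminf_finite) (auto simp: E_def)
  also have "\<dots> \<le> (\<Sum>n<card I. ?v (C (h n)))"
    by (intro sum_mono) (auto simp: E_def)
  also have "\<dots> = (\<Sum>i\<in>I. ?v (C i))"
    by (rule sum.reindex_bij_betw[OF h])
  finally show ?thesis .
qed

text \<open>If the outer measure were not countably additive on the Borel sets, the measure built from it would
  be zero; otherwise the two sides agree on Borel sets.\<close>

lemma emeasure_hausdorff_le: "emeasure (hausdorff_measure m) A \<le> hausdorff_outer m A"
  unfolding hausdorff_measure_def emeasure_measure_of_conv by auto

lemma sets_hausdorff [simp, measurable_cong]: "sets (hausdorff_measure m) = sets borel"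
  unfolding hausdorff_measure_def
  by (simp add: sets.sigma_sets_eq[of borel, simplified])

lemma space_hausdorff [simp]: "space (hausdorff_measure m) = UNIV"
  by (simp add: hausdorff_measure_def space_measure_of_conv)

lemma subdivide_interval:
  assumes "0 \<le> t" "t \<le> real n * \<delta>" "0 < \<delta>" "0 < n"
  shows "\<exists>m<n. \<delta> * real m \<le> t \<and> t \<le> \<delta> * real m + \<delta>"
proof (cases "t = real n * \<delta>")
  case True
  have "real (n - 1) = real n - 1" using assms by simp
  then show ?thesis using True assms by (intro exI[of _ "n - 1"]) (auto simp: algebra_simps)
next
  case False
  define m where "m = nat \<lfloor>t / \<delta>\<rfloor>"
  have m: "real m \<le> t / \<delta>" "t / \<delta> < real m + 1"
    using assms by (auto simp: m_def)
  then have 1: "\<delta> * real m \<le> t" "t \<le> \<delta> * real m + \<delta>"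
    using assms by (auto simp: field_simps)
  have "t < real n * \<delta>" using assms False by linarith
  with 1(1) have "\<delta> * real m < \<delta> * real n" by (simp add: mult.commute)
  then have "m < n" using assms by simp
  with 1 show ?thesis by blast
qed

lemma diameter_cube_le:
  fixes q :: "real^'n"
  assumes "0 \<le> \<delta>"
  shows "diameter (cube q \<delta>) \<le> real CARD('n) * \<delta>"
proof (rule diameter_le)
  show "norm (x - y) \<le> real CARD('n) * \<delta>" if "x \<in> cube q \<delta>" "y \<in> cube q \<delta>" for x y
  proof -
    have "norm (x - y) \<le> (\<Sum>i\<in>UNIV. \<bar>(x - y) $ i\<bar>)" by (rule norm_le_l1_cart)
    also have "\<dots> \<le> (\<Sum>i\<in>(UNIV::'n set). \<delta>)"
    proof (rule sum_mono)
      fix i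
      show "\<bar>(x - y) $ i\<bar> \<le> \<delta>"
        using that(1)[unfolded mem_cube, rule_format, of i] that(2)[unfolded mem_cube, rule_format, of i]
        by (simp only: vector_minus_component abs_le_iff) linarith
    qed
    finally show ?thesis by simp
  qed
qed (use assms in auto)

text \<open>For a fine subdivision of all faces, each small cube that meets the set where \<open>\<bar>w\<bar>\<close> exceeds \<open>\<epsilon>\<close>
  pays for its own contribution \<open>\<delta>\<^sup>n\<^sup>-\<^sup>1\<close> to the Hausdorff content with the \<open>W12\<close> energy of the column
  behind it. The columns behind one face are disjoint, so the total payment is at most the energy of \<open>w\<close>
  for each of the finitely many faces. The constant does not depend on the subdivision.\<close>

lemma weak_trace_inequality:
  fixes D :: "(real^'n) set"
  assumes lip: "bounded_lipschitz_domain D" and mesh: "lattice_mesh D a H \<T>" and \<epsilon>: "0 < \<epsilon>"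
  obtains K where "\<And>w g. w \<in> L2 (lebesgue_on D) \<Longrightarrow> g \<in> L2 (lebesgue_on D) \<Longrightarrow> has_weak_gradient D w g \<Longrightarrow>
      continuous_on (closure D) w \<Longrightarrow>
      hausdorff_outer (CARD('n) - 1) {x \<in> frontier D. \<epsilon> < norm (w x)}
        \<le> ennreal K * (sqnorm (lebesgue_on D) g + ennreal ((6 / H)\<^sup>2) * sqnorm (lebesgue_on D) w)"
proof -
  let ?N = "CARD('n)" and ?M = "lebesgue_on D"
  have D: "open D" "bounded D" using lip by (auto simp: bounded_lipschitz_domain_def)
  have H: "0 < H" and fin: "finite \<T>" and un: "\<Union>\<T> = closure D" and cells: "\<And>T. T \<in> \<T> \<Longrightarrow> \<exists>z. T = cell a H z"
    using mesh by (auto simp: lattice_mesh_def)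
  have cubeT: "T = cube (corner T) H" if "T \<in> \<T>" for T
    using cells[OF that] H by (auto simp: cell_def corner_cube)
  define C1 where "C1 = unit_ball_vol (real (?N - 1)) * (real ?N / 2) ^ (?N - 1)"
  have C1: "0 \<le> C1" by (simp add: C1_def)
  define C2 where "C2 = 8 * H * 16 ^ ?N / \<epsilon>\<^sup>2"
  have C2: "0 \<le> C2" using H by (simp add: C2_def)
  define L where "L = \<T> \<times> (UNIV :: ('n \<times> bool) set)"
  have finL: "finite L" using fin by (simp add: L_def)
  define K where "K = real (card L) * (C1 * C2)"
  show ?thesis
  proof (rule that[of K])
    fix w :: "real^'n \<Rightarrow> complex" and g :: "real^'n \<Rightarrow> complex^'n"
    assume w: "w \<in> L2 ?M" "g \<in> L2 ?M" "has_weak_gradient D w g" and cont: "continuous_on (closure D) w"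
    define R where "R = sqnorm ?M g + ennreal ((6 / H)\<^sup>2) * sqnorm ?M w"
    define G where "G x = ennreal ((norm (g x))\<^sup>2 + (6 / H)\<^sup>2 * (norm (w x))\<^sup>2)" for x
    have [measurable]: "w \<in> borel_measurable ?M" "g \<in> borel_measurable ?M" using w by auto
    have [measurable]: "G \<in> borel_measurable ?M" unfolding G_def by measurable
    have GR: "(\<integral>\<^sup>+ x. G x \<partial>?M) = R"
      unfolding G_def R_def sqnorm_def
      by (simp add: ennreal_plus ennreal_mult nn_integral_add nn_integral_cmult)
    have "hausdorff_content (?N - 1) \<delta>' {x \<in> frontier D. \<epsilon> < norm (w x)} \<le> ennreal K * R" if \<delta>': "0 < \<delta>'" for \<delta>'
    proof -
      have "uniformly_continuous_on (closure D) w"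
        using D(2) cont by (intro compact_uniformly_continuous) auto
      then obtain \<eta> where \<eta>: "0 < \<eta>" "\<And>x y. x \<in> closure D \<Longrightarrow> y \<in> closure D \<Longrightarrow> dist x y < \<eta> \<Longrightarrow> dist (w x) (w y) < \<epsilon> / 2"
        unfolding uniformly_continuous_on_def using \<epsilon> by (metis half_gt_zero)
      \<comment> \<open>The small cubes must be admissible in the content with parameter \<open>\<delta>'\<close>, and \<open>w\<close> must vary by
        at most \<open>\<epsilon> / 2\<close> on each of them.\<close>
      obtain n0 where n0: "real ?N * H / min \<eta> \<delta>' < real n0" using reals_Archimedean2 by blast
      define n where "n = max 2 n0"
      define \<delta> where "\<delta> = H / real n"
      have n: "2 \<le> n" by (simp add: n_def)
      have \<delta>: "0 < \<delta>" using H n by (simp add: \<delta>_def)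
      have nd: "real n * \<delta> = H" using n by (simp add: \<delta>_def)
      have small: "real ?N * \<delta> < min \<eta> \<delta>'"
      proof -
        have m: "0 < min \<eta> \<delta>'" using \<eta>(1) \<delta>' by simp
        have "real ?N * H / min \<eta> \<delta>' < real n" using n0 by (simp add: n_def)
        then have "real ?N * H < real n * min \<eta> \<delta>'" using m by (simp add: divide_less_eq)
        then have "real ?N * H / real n < min \<eta> \<delta>'"
          using n by (subst pos_divide_less_eq) (auto simp: mult.commute)
        then show ?thesis by (simp only: \<delta>_def times_divide_eq_right)
      qed
      define Q where "Q T j = cube (\<chi> i. corner T $ i + \<delta> * real (j i)) \<delta>" for T :: "(real^'n) set" and j :: "'n \<Rightarrow> nat"
      \<comment> \<open>The bad small cubes at the face of \<open>T\<close> in direction \<open>k\<close>, on the upper side if \<open>s\<close> holds and on the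
        lower side otherwise.\<close>
      define J where "J T k s = {j. (\<forall>i. j i < n) \<and> j k = (if s then n - 1 else 0) \<and> (\<exists>x\<in>Q T j. \<epsilon> < norm (w x))}"
        for T :: "(real^'n) set" and k :: 'n and s :: bool
      have finJ: "finite (J T k s)" for T k s
        by (rule finite_subset[OF _ finite_set_of_finite_funs[of "UNIV :: 'n set" "{..<n}" 0]]) (auto simp: J_def)
      have QT: "Q T j \<subseteq> T" if T: "T \<in> \<T>" and j: "\<forall>i. j i < n" for T j
      proof
        fix x assume x: "x \<in> Q T j"
        have "x \<in> cube (corner T) H"
          unfolding mem_cube
        proof
          fix i
          have "real (j i) + 1 \<le> real n" using j[rule_format, of i] by linarith
          then have "\<delta> * (real (j i) + 1) \<le> \<delta> * real n" using \<delta> by (intro mult_left_mono) auto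
          then have "0 \<le> \<delta> * real (j i)" "\<delta> * real (j i) + \<delta> \<le> H" using \<delta> nd by (auto simp: algebra_simps)
          then show "corner T $ i \<le> x $ i \<and> x $ i \<le> corner T $ i + H"
            using x[unfolded Q_def mem_cube, rule_format, of i] unfolding vec_lambda_beta by linarith
        qed
        then show "x \<in> T" using cubeT[OF T] by simp
      qed
      have diamQ: "diameter (Q T j) \<le> real ?N * \<delta>" for T j
        unfolding Q_def using \<delta> by (intro diameter_cube_le) auto
      have bdQ: "bounded (Q T j)" for T j by (simp add: Q_def cube_def)
      have volQ: "ennreal (unit_ball_vol (real (?N - 1)) * (diameter (Q T j) / 2) ^ (?N - 1)) \<le> ennreal C1 * ennreal (\<delta> ^ (?N - 1))" for T j
      proof -
        have "(diameter (Q T j) / 2) ^ (?N - 1) \<le> (real ?N * \<delta> / 2) ^ (?N - 1)"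
          using diamQ[of T j] diameter_ge_0[OF bdQ[of T j]] by (intro power_mono) auto
        also have "\<dots> = (real ?N / 2) ^ (?N - 1) * \<delta> ^ (?N - 1)"
          by (simp add: power_mult_distrib power_divide)
        finally have "unit_ball_vol (real (?N - 1)) * (diameter (Q T j) / 2) ^ (?N - 1) \<le> C1 * \<delta> ^ (?N - 1)"
          unfolding C1_def mult.assoc by (intro mult_left_mono) auto
        then show ?thesis using C1 by (simp add: ennreal_mult'[symmetric] ennreal_leI)
      qed
      have face: "(\<Sum>j\<in>J T k s. ennreal (\<delta> ^ (?N - 1))) \<le> ennreal C2 * R" if T: "T \<in> \<T>" for T k s
      proof -
        define Col where "Col j = box (\<chi> i. if i = k then corner T $ k else (\<chi> i. corner T $ i + \<delta> * real (j i)) $ i)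
            (\<chi> i. if i = k then corner T $ k + H else (\<chi> i. corner T $ i + \<delta> * real (j i)) $ i + \<delta>)" for j :: "'n \<Rightarrow> nat"
        have intT: "interior (cube (corner T) H) \<subseteq> D"
          using mesh_cell_interior_subset[OF lip mesh T] cubeT[OF T] by simp
        have one: "ennreal (\<delta> ^ (?N - 1)) \<le> ennreal C2 * (\<integral>\<^sup>+ x. G x * indicator (Col j) x \<partial>?M)" if j: "j \<in> J T k s" for j
        proof -
          obtain p where p: "p \<in> Q T j" "\<epsilon> < norm (w p)" using j by (auto simp: J_def)
          have jn: "\<And>i. j i < n" "j k = (if s then n - 1 else 0)" using j by (auto simp: J_def)
          have osc: "norm (w x - w p) \<le> \<epsilon> / 2" if x: "x \<in> Q T j" for x
          proof -
            have "Q T j \<subseteq> closure D" using QT[OF T] jn T un by blast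
            moreover have "dist x p < \<eta>"
              using diameter_bounded_bound[OF bdQ x p(1)] diamQ[of T j] small by linarith
            ultimately have "dist (w x) (w p) < \<epsilon> / 2" using \<eta>(2) x p by blast
            then show ?thesis by (simp add: dist_norm)
          qed
          show ?thesis
            unfolding C2_def G_def
            by (rule column_square_estimate[where j = j and k = k and s = s and c = "corner T" and p = p, OF D w H intT n \<delta>_def jn refl _ \<epsilon> p(2)])
               (use osc in \<open>auto simp: Col_def Q_def\<close>)
        qed
        have disj: "disjoint_family_on Col (J T k s)"
          unfolding disjoint_family_on_def
        proof (intro ballI impI)
          fix j j' assume j: "j \<in> J T k s" "j' \<in> J T k s" "j \<noteq> j'"
          then obtain i where i: "j i \<noteq> j' i" by blast
          then have "i \<noteq> k" using j by (auto simp: J_def)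
          show "Col j \<inter> Col j' = {}"
          proof (rule ccontr)
            assume "Col j \<inter> Col j' \<noteq> {}"
            then obtain x where x: "x \<in> Col j" "x \<in> Col j'" by blast
            then have "\<delta> * real (j i) < \<delta> * (real (j' i) + 1)" "\<delta> * real (j' i) < \<delta> * (real (j i) + 1)"
              using x[unfolded Col_def mem_box_cart, THEN spec, of i] \<open>i \<noteq> k\<close> by (auto simp: algebra_simps)
            then have "real (j i) < real (j' i) + 1" "real (j' i) < real (j i) + 1" using \<delta> by auto
            then show False using i by linarith
          qed
        qed
        have mCol [measurable]: "(indicator (Col j) :: _ \<Rightarrow> ennreal) \<in> borel_measurable ?M" for j
        proof -
          have "(indicator (Col j) :: _ \<Rightarrow> ennreal) \<in> borel_measurable lebesgue"
            by (intro borel_measurable_indicator) (auto simp: Col_def)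
          then show ?thesis by (rule measurable_restrict_space1)
        qed
        have "(\<Sum>j\<in>J T k s. ennreal (\<delta> ^ (?N - 1))) \<le> (\<Sum>j\<in>J T k s. ennreal C2 * (\<integral>\<^sup>+ x. G x * indicator (Col j) x \<partial>?M))"
          by (intro sum_mono one)
        also have "\<dots> = ennreal C2 * (\<integral>\<^sup>+ x. (\<Sum>j\<in>J T k s. G x * indicator (Col j) x) \<partial>?M)"
          by (subst nn_integral_sum) (auto simp: sum_distrib_left)
        also have "\<dots> \<le> ennreal C2 * (\<integral>\<^sup>+ x. G x \<partial>?M)"
        proof (intro mult_left_mono nn_integral_mono)
          fix x
          have "(\<Sum>j\<in>J T k s. G x * indicator (Col j) x) = G x * indicator (\<Union>(Col ` J T k s)) x"
            by (simp add: sum_distrib_left[symmetric] indicator_UN_disjoint[OF finJ disj])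
          also have "\<dots> \<le> G x" by (auto split: split_indicator)
          finally show "(\<Sum>j\<in>J T k s. G x * indicator (Col j) x) \<le> G x" .
        qed simp
        finally show ?thesis unfolding GR .
      qed
      define I where "I = (SIGMA l:L. case l of (T, k, s) \<Rightarrow> J T k s)"
      have finI: "finite I" unfolding I_def using finL finJ by (intro finite_SigmaI) auto
      let ?C = "\<lambda>(l, j). Q (fst l) j"
      have cover: "{x \<in> frontier D. \<epsilon> < norm (w x)} \<subseteq> (\<Union>i\<in>I. ?C i)"
      proof
        fix p assume "p \<in> {x \<in> frontier D. \<epsilon> < norm (w x)}"
        then have p: "p \<in> frontier D" "\<epsilon> < norm (w p)" by auto
        then have "p \<in> closure D" "p \<notin> D" using D by (auto simp: frontier_def interior_open)
        then obtain T where T: "T \<in> \<T>" "p \<in> T" using un by blast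
        have "p \<notin> interior T"
          using mesh_cell_interior_subset[OF lip mesh T(1)] \<open>p \<notin> D\<close> by blast
        then have "\<not> (\<forall>i. corner T $ i < p $ i \<and> p $ i < corner T $ i + H)"
          using cubeT[OF T(1)] interior_cube[of "corner T" H] by (auto simp: mem_box_cart)
        then obtain k where k: "\<not> (corner T $ k < p $ k \<and> p $ k < corner T $ k + H)" by blast
        have pT: "corner T $ i \<le> p $ i \<and> p $ i \<le> corner T $ i + H" for i
          using T(2) cubeT[OF T(1)] mem_cube by metis
        define s where "s \<longleftrightarrow> p $ k \<noteq> corner T $ k"
        have "\<exists>m<n. \<delta> * real m \<le> p $ i - corner T $ i \<and> p $ i - corner T $ i \<le> \<delta> * real m + \<delta>" for i
          using pT[of i] nd \<delta> n by (intro subdivide_interval) auto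
        then obtain m where m: "\<And>i. m i < n \<and> \<delta> * real (m i) \<le> p $ i - corner T $ i \<and> p $ i - corner T $ i \<le> \<delta> * real (m i) + \<delta>"
          by metis
        define j where "j i = (if i = k then (if s then n - 1 else 0) else m i)" for i
        have "real (n - 1) = real n - 1" using n by simp
        then have dn: "\<delta> * real (n - 1) = H - \<delta>" using nd by (simp add: algebra_simps)
        have "corner T $ i + \<delta> * real (j i) \<le> p $ i \<and> p $ i \<le> corner T $ i + \<delta> * real (j i) + \<delta>" for i
        proof (cases "i = k")
          case True
          then show ?thesis using k pT[of k] dn \<delta> by (cases s) (auto simp: j_def s_def)
        next
          case False
          then show ?thesis using m[of i] by (auto simp: j_def)
        qed
        then have pQ: "p \<in> Q T j" by (simp add: Q_def mem_cube)
        have "j \<in> J T k s" using m n pQ p(2) by (auto simp: J_def j_def)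
        then have "((T, k, s), j) \<in> I" using T(1) by (auto simp: I_def L_def)
        then show "p \<in> (\<Union>i\<in>I. ?C i)" using pQ by force
      qed
      have "hausdorff_content (?N - 1) \<delta>' {x \<in> frontier D. \<epsilon> < norm (w x)}
          \<le> (\<Sum>i\<in>I. ennreal (unit_ball_vol (real (?N - 1)) * (diameter (?C i) / 2) ^ (?N - 1)))"
      proof (rule hausdorff_content_le_finite_cover[OF finI cover])
        show "bounded (?C i) \<and> diameter (?C i) \<le> \<delta>'" for i
          using bdQ diamQ[of "fst (fst i)" "snd i"] small by (auto simp: case_prod_beta)
      qed (use \<delta>' in simp)
      also have "\<dots> \<le> (\<Sum>i\<in>I. ennreal C1 * ennreal (\<delta> ^ (?N - 1)))"
        by (intro sum_mono, simp only: case_prod_beta volQ)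
      also have "\<dots> = ennreal C1 * (\<Sum>i\<in>I. ennreal (\<delta> ^ (?N - 1)))"
        by (rule sum_distrib_left[symmetric])
      also have "(\<Sum>i\<in>I. ennreal (\<delta> ^ (?N - 1))) = (\<Sum>l\<in>L. \<Sum>j\<in>(case l of (T, k, s) \<Rightarrow> J T k s). ennreal (\<delta> ^ (?N - 1)))"
        unfolding I_def using finL finJ by (subst sum.Sigma) auto
      also have "\<dots> \<le> (\<Sum>l\<in>L. ennreal C2 * R)"
      proof (rule sum_mono)
        fix l assume "l \<in> L"
        then obtain T k s where "l = (T, k, s)" "T \<in> \<T>" by (auto simp: L_def)
        then show "(\<Sum>j\<in>(case l of (T, k, s) \<Rightarrow> J T k s). ennreal (\<delta> ^ (?N - 1))) \<le> ennreal C2 * R"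
          using face[of T k s] by (simp only: prod.case)
      qed
      also have "\<dots> = of_nat (card L) * (ennreal C2 * R)" by simp
      also have "ennreal C1 * (of_nat (card L) * (ennreal C2 * R)) = ennreal K * R"
        unfolding K_def using C1 C2 by (simp add: ennreal_mult ennreal_of_nat_eq_real_of_nat mult_ac)
      finally show ?thesis by (simp add: mult_left_mono)
    qed
    then show "hausdorff_outer (?N - 1) {x \<in> frontier D. \<epsilon> < norm (w x)} \<le> ennreal K * (sqnorm ?M g + ennreal ((6 / H)\<^sup>2) * sqnorm ?M w)"
      unfolding hausdorff_outer_def R_def by (intro SUP_least) auto
  qed
qed

section \<open>Uniqueness of traces\<close>

lemma sets_surface [simp, measurable_cong]: "sets (surface_measure \<Gamma>) = sets (restrict_space borel \<Gamma>)"
  unfolding surface_measure_def by (simp add: sets_restrict_space)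

lemma measurable_surface_continuous:
  fixes f :: "real^'n \<Rightarrow> 'b::real_normed_vector"
  assumes "continuous_on \<Gamma> f"
  shows "f \<in> borel_measurable (surface_measure \<Gamma>)"
  using borel_measurable_continuous_on_restrict[OF assms]
  by (subst measurable_cong_sets[OF sets_surface refl])

lemma AE_surface_measure_mono:
  fixes \<Gamma> \<Gamma>' :: "(real^'n) set"
  assumes "AE x in surface_measure \<Gamma>. P x" "closed \<Gamma>" "closed \<Gamma>'" "\<Gamma>' \<subseteq> \<Gamma>"
  shows "AE x in surface_measure \<Gamma>'. P x"
proof -
  have m: "\<Gamma> \<inter> space (hausdorff_measure k) \<in> sets (hausdorff_measure k)"
    "\<Gamma>' \<inter> space (hausdorff_measure k) \<in> sets (hausdorff_measure k)" for k
    using assms by auto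
  show ?thesis
    using assms(1) unfolding surface_measure_def AE_restrict_space_iff[OF m(1)] AE_restrict_space_iff[OF m(2)]
    by eventually_elim (use assms(4) in blast)
qed

lemma L2_surface_measure_mono:
  fixes f :: "real^'n \<Rightarrow> complex"
  assumes "f \<in> L2 (surface_measure \<Gamma>)" "closed \<Gamma>" "closed \<Gamma>'" "\<Gamma>' \<subseteq> \<Gamma>"
  shows "f \<in> L2 (surface_measure \<Gamma>')"
proof -
  have "\<Gamma> \<in> sets (hausdorff_measure k)" "\<Gamma>' \<in> sets (hausdorff_measure k)" for k
    using assms(2,3) by (simp_all add: borel_closed)
  then show ?thesis
    using L2_restrict[OF assms(1)[unfolded surface_measure_def] _ _ assms(4)] by (simp only: surface_measure_def)
qed

lemma tendsto_zero_ennreal_sandwich: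
  fixes a b c :: "nat \<Rightarrow> ennreal"
  assumes "\<And>n. a n \<le> s * b n + t * c n" "b \<longlonglongrightarrow> 0" "c \<longlonglongrightarrow> 0" "s < \<infinity>" "t < \<infinity>"
  shows "a \<longlonglongrightarrow> 0"
proof (rule tendsto_sandwich[of "\<lambda>_. 0" a sequentially "\<lambda>n. s * b n + t * c n"])
  have "(\<lambda>n. s * b n + t * c n) \<longlonglongrightarrow> s * 0 + t * 0"
    using assms by (intro tendsto_add ennreal_tendsto_cmult) auto
  then show "(\<lambda>n. s * b n + t * c n) \<longlonglongrightarrow> 0" by simp
  show "(\<lambda>n. 0) \<longlonglongrightarrow> (0 :: ennreal)" by simp
qed (use assms(1) in \<open>simp_all add: always_eventually\<close>)

lemma chebyshev_sqnorm:
  fixes f :: "'a \<Rightarrow> 'b::{real_normed_vector, second_countable_topology}"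
  assumes [measurable]: "f \<in> borel_measurable M" and \<epsilon>: "0 < \<epsilon>"
  shows "emeasure M {x \<in> space M. \<epsilon> < norm (f x)} \<le> ennreal (1 / \<epsilon>\<^sup>2) * sqnorm M f"
proof -
  have "emeasure M {x \<in> space M. \<epsilon> < norm (f x)} \<le> emeasure M {x \<in> space M. 1 \<le> ennreal (1 / \<epsilon>\<^sup>2) * ennreal ((norm (f x))\<^sup>2)}"
  proof (rule emeasure_mono)
    show "{x \<in> space M. \<epsilon> < norm (f x)} \<subseteq> {x \<in> space M. 1 \<le> ennreal (1 / \<epsilon>\<^sup>2) * ennreal ((norm (f x))\<^sup>2)}"
    proof safe
      fix x assume "\<epsilon> < norm (f x)"
      then have "\<epsilon>\<^sup>2 \<le> (norm (f x))\<^sup>2" using \<epsilon> by (intro power_mono) auto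
      then have "1 \<le> 1 / \<epsilon>\<^sup>2 * (norm (f x))\<^sup>2" using \<epsilon> by simp
      then show "1 \<le> ennreal (1 / \<epsilon>\<^sup>2) * ennreal ((norm (f x))\<^sup>2)"
        by (simp add: ennreal_mult'[symmetric] del: ennreal_1 flip: ennreal_1)
    qed
  qed measurable
  also have "\<dots> \<le> ennreal (1 / \<epsilon>\<^sup>2) * (\<integral>\<^sup>+ x. ennreal ((norm (f x))\<^sup>2) * indicator (space M) x \<partial>M)"
    by (intro nn_integral_Markov_inequality) auto
  also have "(\<integral>\<^sup>+ x. ennreal ((norm (f x))\<^sup>2) * indicator (space M) x \<partial>M) = sqnorm M f"
    unfolding sqnorm_def by (intro nn_integral_cong) auto
  finally show ?thesis .
qed

lemma sqnorm_lincomb_diff_le: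
  fixes f h u v :: "'a \<Rightarrow> complex"
  assumes [measurable]: "f \<in> borel_measurable M" "h \<in> borel_measurable M" "u \<in> borel_measurable M" "v \<in> borel_measurable M"
  shows "sqnorm M (\<lambda>x. (f x + \<alpha> * h x) - (u x + \<alpha> * v x))
    \<le> 2 * sqnorm M (\<lambda>x. f x - u x) + (2 * ennreal ((norm \<alpha>)\<^sup>2)) * sqnorm M (\<lambda>x. h x - v x)"
proof -
  have "sqnorm M (\<lambda>x. (f x + \<alpha> * h x) - (u x + \<alpha> * v x)) = sqnorm M (\<lambda>x. (f x - u x) + \<alpha> * (h x - v x))"
    by (simp add: algebra_simps)
  also have "\<dots> \<le> 2 * sqnorm M (\<lambda>x. f x - u x) + 2 * sqnorm M (\<lambda>x. \<alpha> * (h x - v x))"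
    by (rule sqnorm_add_le) auto
  also have "sqnorm M (\<lambda>x. \<alpha> * (h x - v x)) = ennreal ((norm \<alpha>)\<^sup>2) * sqnorm M (\<lambda>x. h x - v x)"
    by (rule sqnorm_cmult) auto
  finally show ?thesis by (simp add: mult.assoc)
qed

lemma sqnorm_vec_lincomb_diff_le:
  fixes f h u v :: "'a \<Rightarrow> complex^'n"
  assumes [measurable]: "f \<in> borel_measurable M" "h \<in> borel_measurable M" "u \<in> borel_measurable M" "v \<in> borel_measurable M"
  shows "sqnorm M (\<lambda>x. (f x + \<alpha> *s h x) - (u x + \<alpha> *s v x))
    \<le> 2 * sqnorm M (\<lambda>x. f x - u x) + (2 * ennreal ((norm \<alpha>)\<^sup>2)) * sqnorm M (\<lambda>x. h x - v x)"
proof -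
  have "(f x + \<alpha> *s h x) - (u x + \<alpha> *s v x) = (f x - u x) + \<alpha> *s (h x - v x)" for x
    by (simp add: vec_eq_iff algebra_simps)
  then have "sqnorm M (\<lambda>x. (f x + \<alpha> *s h x) - (u x + \<alpha> *s v x)) = sqnorm M (\<lambda>x. (f x - u x) + \<alpha> *s (h x - v x))"
    by (simp only:)
  also have "\<dots> \<le> 2 * sqnorm M (\<lambda>x. f x - u x) + 2 * sqnorm M (\<lambda>x. \<alpha> *s (h x - v x))"
    by (rule sqnorm_add_le) auto
  also have "sqnorm M (\<lambda>x. \<alpha> *s (h x - v x)) = ennreal ((norm \<alpha>)\<^sup>2) * sqnorm M (\<lambda>x. h x - v x)"
    by (rule sqnorm_vec_cmult) auto
  finally show ?thesis by (simp add: mult.assoc)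
qed

lemma has_trace_lincomb:
  fixes D :: "(real^'n) set"
  assumes D: "open D" "bounded D" and t1: "has_trace D u g" and t2: "has_trace D v h"
  shows "has_trace D (\<lambda>x. u x + \<alpha> * v x) (\<lambda>x. g x + \<alpha> * h x)"
proof -
  let ?M = "lebesgue_on D" and ?\<mu> = "surface_measure (frontier D)" and ?wg = "weak_gradient D"
  have u: "u \<in> W12 D" "v \<in> W12 D" and gh: "g \<in> L2 ?\<mu>" "h \<in> L2 ?\<mu>"
    using t1 t2 by (auto simp: has_trace_def)
  obtain w where w: "\<And>n. w n \<in> W12 D" "\<And>n. continuous_on (closure D) (w n)"
    "(\<lambda>n. sqnorm ?M (\<lambda>x. w n x - u x)) \<longlonglongrightarrow> 0"
    "(\<lambda>n. sqnorm ?M (\<lambda>x. ?wg (w n) x - ?wg u x)) \<longlonglongrightarrow> 0"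
    "(\<lambda>n. sqnorm ?\<mu> (\<lambda>x. w n x - g x)) \<longlonglongrightarrow> 0"
    using t1 unfolding has_trace_def by blast
  obtain w' where w': "\<And>n. w' n \<in> W12 D" "\<And>n. continuous_on (closure D) (w' n)"
    "(\<lambda>n. sqnorm ?M (\<lambda>x. w' n x - v x)) \<longlonglongrightarrow> 0"
    "(\<lambda>n. sqnorm ?M (\<lambda>x. ?wg (w' n) x - ?wg v x)) \<longlonglongrightarrow> 0"
    "(\<lambda>n. sqnorm ?\<mu> (\<lambda>x. w' n x - h x)) \<longlonglongrightarrow> 0"
    using t2 unfolding has_trace_def by blast
  have frsub: "frontier D \<subseteq> closure D" by (auto simp: frontier_def)
  have [measurable]: "g \<in> borel_measurable ?\<mu>" "h \<in> borel_measurable ?\<mu>" using gh by auto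
  have [measurable]: "w n \<in> borel_measurable ?\<mu>" "w' n \<in> borel_measurable ?\<mu>" for n
    using w(2) w'(2) continuous_on_subset[OF _ frsub] by (auto intro!: measurable_surface_continuous)
  have [measurable]: "w n \<in> borel_measurable ?M" "w' n \<in> borel_measurable ?M" "u \<in> borel_measurable ?M" "v \<in> borel_measurable ?M" for n
    using W12_D(1)[OF w(1)] W12_D(1)[OF w'(1)] W12_D(1)[OF u(1)] W12_D(1)[OF u(2)] by auto
  have [measurable]: "?wg (w n) \<in> borel_measurable ?M" "?wg (w' n) \<in> borel_measurable ?M" "?wg u \<in> borel_measurable ?M" "?wg v \<in> borel_measurable ?M" for n
    using W12_D(2)[OF w(1)] W12_D(2)[OF w'(1)] W12_D(2)[OF u(1)] W12_D(2)[OF u(2)] by auto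
  show ?thesis
    unfolding has_trace_def
  proof (intro conjI exI[of _ "\<lambda>n x. w n x + \<alpha> * w' n x"] allI)
    show "(\<lambda>x. u x + \<alpha> * v x) \<in> W12 D" by (rule W12_lincomb(1)[OF D u])
    show "(\<lambda>x. g x + \<alpha> * h x) \<in> L2 ?\<mu>" by (rule L2_lincomb[OF gh])
    show "(\<lambda>x. w n x + \<alpha> * w' n x) \<in> W12 D" for n by (rule W12_lincomb(1)[OF D w(1) w'(1)])
    show "continuous_on (closure D) (\<lambda>x. w n x + \<alpha> * w' n x)" for n
      using w(2) w'(2) by (intro continuous_intros)
    show "(\<lambda>n. sqnorm ?M (\<lambda>x. (w n x + \<alpha> * w' n x) - (u x + \<alpha> * v x))) \<longlonglongrightarrow> 0"
      by (rule tendsto_zero_ennreal_sandwich[OF _ w(3) w'(3), of _ 2 "2 * ennreal ((norm \<alpha>)\<^sup>2)"])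
         (auto intro!: sqnorm_lincomb_diff_le simp: ennreal_mult_less_top)
    show "(\<lambda>n. sqnorm ?\<mu> (\<lambda>x. (w n x + \<alpha> * w' n x) - (g x + \<alpha> * h x))) \<longlonglongrightarrow> 0"
      by (rule tendsto_zero_ennreal_sandwich[OF _ w(5) w'(5), of _ 2 "2 * ennreal ((norm \<alpha>)\<^sup>2)"])
         (auto intro!: sqnorm_lincomb_diff_le simp: ennreal_mult_less_top)
    show "(\<lambda>n. sqnorm ?M (\<lambda>x. ?wg (\<lambda>x. w n x + \<alpha> * w' n x) x - ?wg (\<lambda>x. u x + \<alpha> * v x) x)) \<longlonglongrightarrow> 0"
    proof (rule tendsto_zero_ennreal_sandwich[OF _ w(4) w'(4), of _ 2 "2 * ennreal ((norm \<alpha>)\<^sup>2)"])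
      fix n
      have "sqnorm ?M (\<lambda>x. ?wg (\<lambda>x. w n x + \<alpha> * w' n x) x - ?wg (\<lambda>x. u x + \<alpha> * v x) x)
         = sqnorm ?M (\<lambda>x. (?wg (w n) x + \<alpha> *s ?wg (w' n) x) - (?wg u x + \<alpha> *s ?wg v x))"
      proof (rule sqnorm_cong_AE)
        show "AE x in ?M. ?wg (\<lambda>x. w n x + \<alpha> * w' n x) x - ?wg (\<lambda>x. u x + \<alpha> * v x) x
            = (?wg (w n) x + \<alpha> *s ?wg (w' n) x) - (?wg u x + \<alpha> *s ?wg v x)"
          using W12_lincomb(2)[OF D w(1)[of n] w'(1)[of n], of \<alpha>] W12_lincomb(2)[OF D u, of \<alpha>]
          by eventually_elim (simp only:)
      qed
      also have "\<dots> \<le> 2 * sqnorm ?M (\<lambda>x. ?wg (w n) x - ?wg u x) + 2 * ennreal ((norm \<alpha>)\<^sup>2) * sqnorm ?M (\<lambda>x. ?wg (w' n) x - ?wg v x)"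
        by (rule sqnorm_vec_lincomb_diff_le) auto
      finally show "sqnorm ?M (\<lambda>x. ?wg (\<lambda>x. w n x + \<alpha> * w' n x) x - ?wg (\<lambda>x. u x + \<alpha> * v x) x)
         \<le> 2 * sqnorm ?M (\<lambda>x. ?wg (w n) x - ?wg u x) + 2 * ennreal ((norm \<alpha>)\<^sup>2) * sqnorm ?M (\<lambda>x. ?wg (w' n) x - ?wg v x)" .
    qed (auto simp: ennreal_mult_less_top)
  qed
qed

text \<open>This is the closability of the restriction to the boundary. Along the approximating sequence the
  weak-type inequality gives convergence to \<open>0\<close> in measure, while the convergence in \<open>L2\<close> of the boundary
  gives convergence to \<open>g\<close> in measure.\<close>

lemma has_trace_zero:
  fixes D :: "(real^'n) set"
  assumes lip: "bounded_lipschitz_domain D" and mesh: "lattice_mesh D a H \<T>"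
    and tr: "has_trace D (\<lambda>x. 0) g"
  shows "AE x in surface_measure (frontier D). g x = 0"
proof -
  let ?M = "lebesgue_on D" and ?\<mu> = "surface_measure (frontier D)" and ?wg = "weak_gradient D"
  have D: "open D" "bounded D" using lip by (auto simp: bounded_lipschitz_domain_def)
  obtain w where w: "\<And>n. w n \<in> W12 D" "\<And>n. continuous_on (closure D) (w n)"
    "(\<lambda>n. sqnorm ?M (\<lambda>x. w n x - 0)) \<longlonglongrightarrow> 0"
    "(\<lambda>n. sqnorm ?M (\<lambda>x. ?wg (w n) x - ?wg (\<lambda>x. 0) x)) \<longlonglongrightarrow> 0"
    "(\<lambda>n. sqnorm ?\<mu> (\<lambda>x. w n x - g x)) \<longlonglongrightarrow> 0"
    using tr unfolding has_trace_def by blast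
  have "(\<lambda>x. 0) \<in> W12 D" using tr by (simp add: has_trace_def)
  note zero = W12_D[OF this]
  have "has_weak_gradient D (\<lambda>x. 0) (\<lambda>x. 0)" by (simp add: has_weak_gradient_def)
  then have "AE x in ?M. ?wg (\<lambda>x. 0) x = 0"
    by (intro has_weak_gradient_unique[OF D zero(2,3)]) (simp_all add: L2_def sqnorm_def)
  then have "sqnorm ?M (\<lambda>x. ?wg (w n) x - ?wg (\<lambda>x. 0) x) = sqnorm ?M (?wg (w n))" for n
    by (intro sqnorm_cong_AE) (auto elim!: eventually_mono)
  then have dw0: "(\<lambda>n. sqnorm ?M (?wg (w n))) \<longlonglongrightarrow> 0" using w(4) by simp
  have w0: "(\<lambda>n. sqnorm ?M (w n)) \<longlonglongrightarrow> 0" using w(3) by simp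
  have [measurable]: "g \<in> borel_measurable ?\<mu>" using tr by (auto simp: has_trace_def)
  have frsub: "frontier D \<subseteq> closure D" by (auto simp: frontier_def)
  have [measurable]: "w n \<in> borel_measurable ?\<mu>" for n
    using w(2) continuous_on_subset[OF _ frsub] by (auto intro!: measurable_surface_continuous)
  have sp: "space ?\<mu> = frontier D" by (simp add: surface_measure_def space_restrict_space)
  have main: "emeasure ?\<mu> {x \<in> space ?\<mu>. 2 * \<epsilon> < norm (g x)} = 0" if \<epsilon>: "0 < \<epsilon>" for \<epsilon> :: real
  proof -
    obtain K where K: "\<And>w g. w \<in> L2 ?M \<Longrightarrow> g \<in> L2 ?M \<Longrightarrow> has_weak_gradient D w g \<Longrightarrow>
      continuous_on (closure D) w \<Longrightarrow>
      hausdorff_outer (CARD('n) - 1) {x \<in> frontier D. \<epsilon> < norm (w x)}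
        \<le> ennreal K * (sqnorm ?M g + ennreal ((6 / H)\<^sup>2) * sqnorm ?M w)"
      using weak_trace_inequality[OF lip mesh \<epsilon>] by blast
    let ?E = "\<lambda>n. {x \<in> space ?\<mu>. \<epsilon> < norm (w n x)}"
    have E: "emeasure ?\<mu> (?E n) \<le> ennreal K * sqnorm ?M (?wg (w n)) + (ennreal K * ennreal ((6 / H)\<^sup>2)) * sqnorm ?M (w n)" for n
    proof -
      have "emeasure ?\<mu> (?E n) = emeasure (hausdorff_measure (CARD('n) - 1)) (?E n)"
        unfolding surface_measure_def by (rule emeasure_restrict_space) (auto simp: space_restrict_space)
      also have "\<dots> \<le> hausdorff_outer (CARD('n) - 1) (?E n)" by (rule emeasure_hausdorff_le)
      also have "\<dots> \<le> ennreal K * (sqnorm ?M (?wg (w n)) + ennreal ((6 / H)\<^sup>2) * sqnorm ?M (w n))"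
        unfolding sp by (intro K W12_D[OF w(1)] w(2))
      finally show ?thesis by (simp add: distrib_left mult.assoc)
    qed
    have E0: "(\<lambda>n. emeasure ?\<mu> (?E n)) \<longlonglongrightarrow> 0"
      by (rule tendsto_zero_ennreal_sandwich[OF E dw0 w0]) (auto simp: ennreal_mult_less_top)
    have "(\<lambda>n. emeasure ?\<mu> {x \<in> space ?\<mu>. 2 * \<epsilon> < norm (g x)}) \<longlonglongrightarrow> 0"
    proof (rule tendsto_zero_ennreal_sandwich[OF _ E0 w(5), of _ 1 "ennreal (1 / \<epsilon>\<^sup>2)"])
      fix n
      let ?A = "{x \<in> space ?\<mu>. \<epsilon> < norm (w n x - g x)}"
      have "{x \<in> space ?\<mu>. 2 * \<epsilon> < norm (g x)} \<subseteq> ?E n \<union> ?A"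
      proof
        fix x assume x: "x \<in> {x \<in> space ?\<mu>. 2 * \<epsilon> < norm (g x)}"
        have "norm (g x) \<le> norm (w n x) + norm (w n x - g x)"
          using norm_triangle_ineq4[of "w n x" "w n x - g x"] by simp
        then show "x \<in> ?E n \<union> ?A" using x by auto
      qed
      then have "emeasure ?\<mu> {x \<in> space ?\<mu>. 2 * \<epsilon> < norm (g x)} \<le> emeasure ?\<mu> (?E n \<union> ?A)"
        by (rule emeasure_mono) measurable
      also have "\<dots> \<le> emeasure ?\<mu> (?E n) + emeasure ?\<mu> ?A"
        by (rule emeasure_subadditive) measurable
      also have "\<dots> \<le> emeasure ?\<mu> (?E n) + ennreal (1 / \<epsilon>\<^sup>2) * sqnorm ?\<mu> (\<lambda>x. w n x - g x)"
        by (intro add_left_mono chebyshev_sqnorm \<epsilon>) measurable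
      finally show "emeasure ?\<mu> {x \<in> space ?\<mu>. 2 * \<epsilon> < norm (g x)}
          \<le> 1 * emeasure ?\<mu> (?E n) + ennreal (1 / \<epsilon>\<^sup>2) * sqnorm ?\<mu> (\<lambda>x. w n x - g x)"
        by simp
    qed auto
    then show ?thesis by (simp add: LIMSEQ_const_iff)
  qed
  have "AE x in ?\<mu>. \<forall>m. \<not> 2 * (inverse (real (Suc m)) / 2) < norm (g x)"
  proof (subst AE_all_countable, rule allI)
    fix m
    have "{x \<in> space ?\<mu>. 2 * (inverse (real (Suc m)) / 2) < norm (g x)} \<in> null_sets ?\<mu>"
      by (intro null_setsI main) (simp, measurable)
    from AE_not_in[OF this] AE_space show "AE x in ?\<mu>. \<not> 2 * (inverse (real (Suc m)) / 2) < norm (g x)"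
      by eventually_elim auto
  qed
  then show ?thesis
  proof eventually_elim
    case (elim x)
    show ?case
    proof (rule ccontr)
      assume "g x \<noteq> 0"
      then obtain m where "inverse (real (Suc m)) < norm (g x)"
        using reals_Archimedean[of "norm (g x)"] by auto
      then show False using elim[rule_format, of m] by simp
    qed
  qed
qed

lemma has_trace_unique:
  fixes D :: "(real^'n) set"
  assumes lip: "bounded_lipschitz_domain D" and mesh: "lattice_mesh D a H \<T>"
    and t1: "has_trace D u g1" and t2: "has_trace D u g2"
  shows "AE x in surface_measure (frontier D). g1 x = g2 x"
proof -
  have D: "open D" "bounded D" using lip by (auto simp: bounded_lipschitz_domain_def)
  have "has_trace D (\<lambda>x. 0) (\<lambda>x. g1 x - g2 x)"
    using has_trace_lincomb[OF D t1 t2, of "-1"] by simp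
  from has_trace_zero[OF lip mesh this] show ?thesis by simp
qed

section \<open>Sesquilinearity of the Helmholtz form\<close>

lemma V_space_lincomb:
  assumes D: "open D" "bounded D" and u: "u \<in> V_space D \<Gamma>D" and v: "v \<in> V_space D \<Gamma>D"
  shows "(\<lambda>x. u x + \<alpha> * v x) \<in> V_space D \<Gamma>D"
proof -
  obtain g h where g: "has_trace D u g" "AE x in surface_measure \<Gamma>D. g x = 0"
    and h: "has_trace D v h" "AE x in surface_measure \<Gamma>D. h x = 0"
    using u v unfolding V_space_def by blast
  have "AE x in surface_measure \<Gamma>D. g x + \<alpha> * h x = 0"
    using g(2) h(2) by eventually_elim simp
  moreover have "has_trace D (\<lambda>x. u x + \<alpha> * v x) (\<lambda>x. g x + \<alpha> * h x)"
    by (rule has_trace_lincomb[OF D g(1) h(1)])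
  ultimately show ?thesis
    unfolding V_space_def has_trace_def by blast
qed

lemma V_space_D:
  assumes "u \<in> V_space D \<Gamma>D"
  shows "u \<in> W12 D" "has_trace D u (boundary_trace D u)"
proof -
  obtain g where "has_trace D u g" using assms by (auto simp: V_space_def)
  then show "has_trace D u (boundary_trace D u)"
    unfolding boundary_trace_def by (rule someI[of "has_trace D u"])
  show "u \<in> W12 D" using assms by (simp add: V_space_def)
qed

text \<open>The base mesh enters through its base point \<open>a\<close>, so that all levels refer to the same lattice.\<close>

locale helmholtz_setting =
  fixes D \<Gamma>D \<Gamma>R :: "(real^'n) set" and a :: "real^'n" and H1 :: real and \<T>1 :: "(real^'n) set set" and \<kappa> :: real
  assumes lip: "bounded_lipschitz_domain D" and closed_\<Gamma>R: "closed \<Gamma>R" "\<Gamma>R \<subseteq> frontier D"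
    and base_mesh: "lattice_mesh D a H1 \<T>1"
    and \<Gamma>D_frontier: "\<Gamma>D \<subseteq> frontier D"
begin

abbreviation "V \<equiv> V_space D \<Gamma>D"
abbreviation "\<a> \<equiv> helmholtz_form D \<Gamma>R \<kappa>"

lemma D: "open D" "bounded D" using lip by (auto simp: bounded_lipschitz_domain_def)

lemma boundary_trace_L2:
  assumes "u \<in> V"
  shows "boundary_trace D u \<in> L2 (surface_measure \<Gamma>R)"
proof (rule L2_surface_measure_mono[OF _ frontier_closed closed_\<Gamma>R])
  show "boundary_trace D u \<in> L2 (surface_measure (frontier D))"
    using V_space_D(2)[OF assms] unfolding has_trace_def by blast
qed

lemma boundary_trace_lincomb:
  assumes u: "u \<in> V" and v: "v \<in> V"
  shows "AE x in surface_measure \<Gamma>R. boundary_trace D (\<lambda>x. u x + \<alpha> * v x) x = boundary_trace D u x + \<alpha> * boundary_trace D v x"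
proof -
  have "has_trace D (\<lambda>x. u x + \<alpha> * v x) (boundary_trace D (\<lambda>x. u x + \<alpha> * v x))"
    by (rule V_space_D(2)[OF V_space_lincomb[OF D u v]])
  moreover have "has_trace D (\<lambda>x. u x + \<alpha> * v x) (\<lambda>x. boundary_trace D u x + \<alpha> * boundary_trace D v x)"
    by (rule has_trace_lincomb[OF D V_space_D(2)[OF u] V_space_D(2)[OF v]])
  ultimately have "AE x in surface_measure (frontier D). boundary_trace D (\<lambda>x. u x + \<alpha> * v x) x
      = boundary_trace D u x + \<alpha> * boundary_trace D v x"
    by (rule has_trace_unique[OF lip base_mesh])
  then show ?thesis
    by (rule AE_surface_measure_mono[OF _ _ closed_\<Gamma>R]) (rule frontier_closed)
qed

lemma form_lincomb_left:
  assumes u: "u \<in> V" and v: "v \<in> V" and w: "w \<in> V"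
  shows "\<a> (\<lambda>x. u x + \<alpha> * v x) w = \<a> u w + \<alpha> * \<a> v w"
proof -
  let ?M = "lebesgue_on D" and ?\<mu> = "surface_measure \<Gamma>R" and ?wg = "weak_gradient D" and ?t = "boundary_trace D"
  let ?s = "\<lambda>x. u x + \<alpha> * v x"
  have s: "?s \<in> V" by (rule V_space_lincomb[OF D u v])
  note W = W12_D[OF V_space_D(1)[OF u]] W12_D[OF V_space_D(1)[OF v]] W12_D[OF V_space_D(1)[OF w]] W12_D[OF V_space_D(1)[OF s]]
  note t = boundary_trace_L2[OF u] boundary_trace_L2[OF v] boundary_trace_L2[OF w] boundary_trace_L2[OF s]
  have "l2_inner_vec ?M (?wg ?s) (?wg w) = l2_inner_vec ?M (\<lambda>x. ?wg u x + \<alpha> *s ?wg v x) (?wg w)"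
    by (intro l2_inner_vec_cong_AE W12_lincomb(2)[OF D V_space_D(1)[OF u] V_space_D(1)[OF v]] L2_measurable
        L2_vec_lincomb[OF W(2) W(5)] W(2,5,8,11) AE_I2 refl)
  moreover have "l2_inner ?\<mu> (?t ?s) (?t w) = l2_inner ?\<mu> (\<lambda>x. ?t u x + \<alpha> * ?t v x) (?t w)"
    by (intro l2_inner_cong_AE boundary_trace_lincomb[OF u v] L2_measurable L2_lincomb[OF t(1) t(2)] t AE_I2 refl)
  ultimately show ?thesis
    unfolding helmholtz_form_def
    by (simp only: l2_inner_vec_lincomb_left[OF W(2) W(5) W(8)] l2_inner_lincomb_left[OF W(1) W(4) W(7)]
        l2_inner_lincomb_left[OF t(1) t(2) t(3)]) (simp add: algebra_simps)
qed

lemma form_lincomb_right: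
  assumes u: "u \<in> V" and v: "v \<in> V" and w: "w \<in> V"
  shows "\<a> w (\<lambda>x. u x + \<alpha> * v x) = \<a> w u + cnj \<alpha> * \<a> w v"
proof -
  let ?M = "lebesgue_on D" and ?\<mu> = "surface_measure \<Gamma>R" and ?wg = "weak_gradient D" and ?t = "boundary_trace D"
  let ?s = "\<lambda>x. u x + \<alpha> * v x"
  have s: "?s \<in> V" by (rule V_space_lincomb[OF D u v])
  note W = W12_D[OF V_space_D(1)[OF u]] W12_D[OF V_space_D(1)[OF v]] W12_D[OF V_space_D(1)[OF w]] W12_D[OF V_space_D(1)[OF s]]
  note t = boundary_trace_L2[OF u] boundary_trace_L2[OF v] boundary_trace_L2[OF w] boundary_trace_L2[OF s]
  have "l2_inner_vec ?M (?wg w) (?wg ?s) = l2_inner_vec ?M (?wg w) (\<lambda>x. ?wg u x + \<alpha> *s ?wg v x)"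
    by (intro l2_inner_vec_cong_AE W12_lincomb(2)[OF D V_space_D(1)[OF u] V_space_D(1)[OF v]] L2_measurable
        L2_vec_lincomb[OF W(2) W(5)] W(2,5,8,11) AE_I2 refl)
  moreover have "l2_inner ?\<mu> (?t w) (?t ?s) = l2_inner ?\<mu> (?t w) (\<lambda>x. ?t u x + \<alpha> * ?t v x)"
    by (intro l2_inner_cong_AE boundary_trace_lincomb[OF u v] L2_measurable L2_lincomb[OF t(1) t(2)] t AE_I2 refl)
  ultimately show ?thesis
    unfolding helmholtz_form_def
    by (simp only: l2_inner_vec_lincomb_right[OF W(2) W(5) W(8)] l2_inner_lincomb_right[OF W(1) W(4) W(7)]
        l2_inner_lincomb_right[OF t(1) t(2) t(3)]) (simp add: algebra_simps)
qed

end

section \<open>Bubble functions belong to the energy space\<close>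

text \<open>The bubble is the derivative of the transition function, which provides its continuity and bounds.\<close>

lemma bubble1d_eq: "bubble1d = smoothstep_deriv"
  by (rule ext) (auto simp: bubble1d_def smoothstep_deriv_def max_def min_def split: split_indicator)

lemma smoothstep_deriv_lipschitz: "\<bar>smoothstep_deriv s - smoothstep_deriv t\<bar> \<le> 6 * \<bar>s - t\<bar>"
proof -
  define c where "c t = max 0 (min 1 t)" for t :: real
  have "smoothstep_deriv s - smoothstep_deriv t = 6 * ((c s - c t) * (1 - c s - c t))"
    by (simp add: smoothstep_deriv_def c_def algebra_simps)
  moreover have "\<bar>c s - c t\<bar> * \<bar>1 - c s - c t\<bar> \<le> \<bar>s - t\<bar> * 1"
    by (intro mult_mono) (auto simp: c_def)
  ultimately show ?thesis by (simp add: abs_mult)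
qed

definition bubble1d_deriv :: "real \<Rightarrow> real" where
  "bubble1d_deriv t = 6 * (1 - 2 * t) * indicator {0..1} t"

lemma DERIV_bubble1d:
  assumes "t \<noteq> 0" "t \<noteq> 1"
  shows "(bubble1d has_real_derivative bubble1d_deriv t) (at t)"
proof (cases "0 < t \<and> t < 1")
  case True
  have "\<forall>\<^sub>F x in nhds t. x \<in> {0<..<1}"
    using True by (intro eventually_nhds_in_open) auto
  then have ev: "\<forall>\<^sub>F x in nhds t. bubble1d x = 6 * x * (1 - x)"
    by eventually_elim (auto simp: bubble1d_def)
  show ?thesis
    using True by (subst DERIV_cong_ev[OF refl ev refl]) (auto intro!: derivative_eq_intros simp: bubble1d_deriv_def)
next
  case False
  have "\<forall>\<^sub>F x in nhds t. x \<in> - {0..1}"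
    using False assms by (intro eventually_nhds_in_open) auto
  then have ev: "\<forall>\<^sub>F x in nhds t. bubble1d x = 0"
    by eventually_elim (auto simp: bubble1d_def)
  show ?thesis
    using False assms by (subst DERIV_cong_ev[OF refl ev refl]) (auto simp: bubble1d_deriv_def)
qed

lemma bubble1d_bounds: "0 \<le> bubble1d t" "bubble1d t \<le> 3/2"
  by (simp_all add: bubble1d_eq smoothstep_deriv_nonneg smoothstep_deriv_le[simplified])

lemma bubble1d_eq_0: "t \<le> 0 \<or> 1 \<le> t \<Longrightarrow> bubble1d t = 0"
  by (simp add: bubble1d_eq smoothstep_deriv_eq_0)

lemma bubble1d_deriv_bound: "\<bar>bubble1d_deriv t\<bar> \<le> 6"
  by (auto simp: bubble1d_deriv_def split: split_indicator)

lemma lborel_integral_translation: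
  fixes f :: "'a::euclidean_space \<Rightarrow> 'b::{banach, second_countable_topology}"
  assumes [measurable]: "f \<in> borel_measurable borel"
  shows "(LINT x|lborel. f (x + c)) = (LINT x|lborel. f x)"
    "integrable lborel f \<Longrightarrow> integrable lborel (\<lambda>x. f (x + c))"
proof -
  have d: "distr lborel borel (\<lambda>x. x + c) = lborel"
    using lborel_distr_plus[of c] by (simp add: add.commute[of c] cong: distr_cong)
  show "(LINT x|lborel. f (x + c)) = (LINT x|lborel. f x)"
    using integral_distr[of "\<lambda>x. x + c" lborel borel f] by (simp add: d)
  show "integrable lborel f \<Longrightarrow> integrable lborel (\<lambda>x. f (x + c))"
    using integrable_distr_eq[of "\<lambda>x. x + c" lborel borel f] by (simp add: d)
qed

text \<open>The difference quotients of \<open>F\<close> have integral zero by translation invariance, and the Lipschitz bound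
  makes them converge boundedly.\<close>

lemma integral_directional_derivative_eq_0:
  fixes F F' :: "real^'n \<Rightarrow> real" and e :: "real^'n"
  assumes F [measurable]: "F \<in> borel_measurable borel" and F' [measurable]: "F' \<in> borel_measurable borel"
    and e: "norm e \<le> 1" and lip: "\<And>x h. \<bar>F (x + h *\<^sub>R e) - F x\<bar> \<le> L * \<bar>h\<bar>"
    and supp: "\<And>x. F x \<noteq> 0 \<Longrightarrow> x \<in> K" and K: "bounded K" and B: "\<And>x. \<bar>F x\<bar> \<le> B"
    and der: "AE x in lborel. ((\<lambda>h. F (x + h *\<^sub>R e)) has_real_derivative F' x) (at 0)"
  shows "(LINT x|lborel. F' x) = 0"
proof -
  obtain R where R: "\<And>x. x \<in> K \<Longrightarrow> norm x \<le> R" using K by (auto simp: bounded_iff)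
  have L: "0 \<le> L" using lip[of 0 1] by simp
  define q where "q n x = (F (x + (1 / real (Suc n)) *\<^sub>R e) - F x) / (1 / real (Suc n))" for n x
  have qb: "\<bar>q n x\<bar> \<le> L * indicator (cball 0 (R + 1)) x" for n x
  proof (cases "x \<in> cball 0 (R + 1)")
    case True
    have "\<bar>q n x\<bar> \<le> (L * \<bar>1 / real (Suc n)\<bar>) / (1 / real (Suc n))"
      unfolding q_def abs_divide using lip[of x "1 / real (Suc n)"] by (intro divide_mono) auto
    then show ?thesis using True by simp
  next
    case False
    then have x: "R + 1 < norm x" by simp
    define s where "s = (1 / real (Suc n)) *\<^sub>R e"
    have "norm s \<le> 1 * 1"
      unfolding norm_scaleR s_def using e by (intro mult_mono) auto
    moreover have "norm x \<le> norm (x + s) + norm s"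
      using norm_triangle_ineq4[of "x + s" s] by simp
    ultimately have "R < norm (x + (1 / real (Suc n)) *\<^sub>R e)"
      using x unfolding s_def by linarith
    then have "F (x + (1 / real (Suc n)) *\<^sub>R e) = 0" "F x = 0"
      using supp R x by (metis linorder_not_le, smt (verit))
    then show ?thesis using L by (simp add: q_def)
  qed
  have intK: "integrable lborel (\<lambda>x. C * indicator (cball 0 (R + 1)) x)" for C :: real
    by (intro integrable_mult_right integrable_real_indicator) (use emeasure_lborel_cball_finite in auto)
  have intF: "integrable lborel F"
  proof (rule Bochner_Integration.integrable_bound[OF intK[of B]])
    show "AE x in lborel. norm (F x) \<le> norm (B * indicator (cball 0 (R + 1)) x)"
    proof (rule AE_I2)
      fix x
      show "norm (F x) \<le> norm (B * indicator (cball 0 (R + 1)) x)"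
        using B[of x] supp[of x] R[of x] by (cases "F x = 0") (auto split: split_indicator)
    qed
  qed simp
  note trans = lborel_integral_translation(1)[OF F] and trans_int = lborel_integral_translation(2)[OF F intF]
  have q0: "(LINT x|lborel. q n x) = 0" for n
    unfolding q_def using intF trans_int by (simp add: trans del: of_nat_Suc)
  have "(\<lambda>n. LINT x|lborel. q n x) \<longlonglongrightarrow> (LINT x|lborel. F' x)"
  proof (rule integral_dominated_convergence[OF _ _ intK[of L]])
    show "F' \<in> borel_measurable lborel" by simp
    show "q n \<in> borel_measurable lborel" for n unfolding q_def by measurable
    show "AE x in lborel. norm (q n x) \<le> L * indicator (cball 0 (R + 1)) x" for n
      using qb by auto
    show "AE x in lborel. (\<lambda>n. q n x) \<longlonglongrightarrow> F' x"
      using der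
    proof eventually_elim
      case (elim x)
      then have lim: "((\<lambda>h. (F (x + h *\<^sub>R e) - F x) / h) \<longlongrightarrow> F' x) (at 0)"
        by (simp add: has_field_derivative_iff)
      have "filterlim (\<lambda>n. 1 / real (Suc n)) (at 0) sequentially"
        unfolding filterlim_at using LIMSEQ_inverse_real_of_nat by (auto simp: inverse_eq_divide)
      from filterlim_compose[OF lim this] show ?case by (simp add: q_def)
    qed
  qed
  then show ?thesis by (simp add: q0 LIMSEQ_const_iff)
qed

definition bubble_grad :: "real \<Rightarrow> real^'n \<Rightarrow> real^'n \<Rightarrow> complex^'n" where
  "bubble_grad H c x = (\<chi> k. complex_of_real (bubble1d_deriv ((x $ k - c $ k) / H) / H *
     (\<Prod>j\<in>UNIV - {k}. bubble1d ((x $ j - c $ j) / H))))"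

lemma continuous_bubble: "continuous_on A (bubble H T)"
  unfolding bubble_def bubble1d_eq divide_inverse by (intro continuous_intros)

lemma bubble_eq_0:
  assumes H: "0 < H" and x: "x \<notin> interior (cube c H)"
  shows "(\<Prod>k\<in>UNIV. bubble1d ((x $ k - c $ k) / H)) = 0"
proof -
  obtain k where "\<not> (c $ k < x $ k \<and> x $ k < c $ k + H)"
    using x by (auto simp: interior_cube mem_box_cart)
  then have "(x $ k - c $ k) / H \<le> 0 \<or> 1 \<le> (x $ k - c $ k) / H"
    using H by (auto simp: divide_le_0_iff le_divide_eq)
  then have "bubble1d ((x $ k - c $ k) / H) = 0" by (rule bubble1d_eq_0)
  then show ?thesis by (intro prod_zero) auto
qed

lemma bubble_eq_0_outside:
  assumes H: "0 < H" and x: "x \<notin> interior (cell a H z)"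
  shows "bubble H (cell a H z) x = 0"
  using bubble_eq_0[OF H x[unfolded cell_def]] H by (simp add: bubble_def cell_def corner_cube)

lemma measurable_bubble1d_deriv [measurable]: "bubble1d_deriv \<in> borel_measurable borel"
  unfolding bubble1d_deriv_def by measurable

lemma measurable_bubble1d [measurable]: "bubble1d \<in> borel_measurable borel"
  unfolding bubble1d_eq using continuous_smoothstep_deriv[OF continuous_on_id, of UNIV]
  by (intro borel_measurable_continuous_onI) simp

lemma measurable_vec_lambda:
  fixes f :: "'n::finite \<Rightarrow> 'a \<Rightarrow> complex"
  assumes [measurable]: "\<And>k. f k \<in> borel_measurable M"
  shows "(\<lambda>x. \<chi> k. f k x) \<in> borel_measurable M"
proof (subst borel_measurable_euclidean_space, rule ballI)
  fix i :: "complex^'n" assume "i \<in> Basis"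
  then obtain k b where "i = axis k b" by (auto simp: Basis_vec_def)
  then show "(\<lambda>x. (\<chi> k. f k x) \<bullet> i) \<in> borel_measurable M"
    by (simp add: inner_axis)
qed

lemma measurable_lebesgue_on_borel:
  fixes f :: "'a::euclidean_space \<Rightarrow> 'b::topological_space"
  assumes "f \<in> borel_measurable borel"
  shows "f \<in> borel_measurable (lebesgue_on D)"
  using assms by (intro measurable_restrict_space1 measurable_completion) simp

lemma bubble_grad_L2:
  fixes c :: "real^'n"
  assumes D: "open D" "bounded D" and H: "0 < H"
  shows "bubble_grad H c \<in> L2 (lebesgue_on D)"
proof (rule L2_bounded[OF emeasure_lebesgue_on_finite[OF D]])
  have "(\<lambda>x :: real^'n. \<chi> k. complex_of_real (bubble1d_deriv ((x $ k - c $ k) / H) / H *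
     (\<Prod>j\<in>UNIV - {k}. bubble1d ((x $ j - c $ j) / H)))) \<in> borel_measurable borel"
    by (rule measurable_vec_lambda) measurable
  then show "bubble_grad H c \<in> borel_measurable (lebesgue_on D)"
    unfolding bubble_grad_def[abs_def] by (rule measurable_lebesgue_on_borel)
  fix x
  have "norm (bubble_grad H c x) \<le> (\<Sum>k\<in>UNIV. norm (bubble_grad H c x $ k))"
    unfolding norm_vec_def by (rule L2_set_le_sum) auto
  also have "\<dots> \<le> (\<Sum>k\<in>(UNIV :: 'n set). 6 / H * (3/2) ^ CARD('n))"
  proof (rule sum_mono)
    fix k :: 'n
    have "(\<Prod>j\<in>UNIV - {k}. bubble1d ((x $ j - c $ j) / H)) \<le> (\<Prod>j\<in>UNIV - {k}. 3/2)"
      by (intro prod_mono conjI bubble1d_bounds)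
    also have "\<dots> \<le> (3/2) ^ CARD('n)" by (simp add: power_increasing)
    finally have 1: "(\<Prod>j\<in>UNIV - {k}. bubble1d ((x $ j - c $ j) / H)) \<le> (3/2) ^ CARD('n)" .
    have 2: "0 \<le> (\<Prod>j\<in>UNIV - {k}. bubble1d ((x $ j - c $ j) / H))"
      by (intro prod_nonneg) (simp add: bubble1d_bounds)
    have "\<bar>bubble1d_deriv ((x $ k - c $ k) / H) / H * (\<Prod>j\<in>UNIV - {k}. bubble1d ((x $ j - c $ j) / H))\<bar>
       \<le> 6 / H * (3/2) ^ CARD('n)"
      unfolding abs_mult abs_divide using 1 2 H bubble1d_deriv_bound
      by (intro mult_mono divide_mono) auto
    then show "norm (bubble_grad H c x $ k) \<le> 6 / H * (3/2) ^ CARD('n)"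
      unfolding bubble_grad_def vec_lambda_beta norm_of_real .
  qed
  finally show "norm (bubble_grad H c x) \<le> (\<Sum>k\<in>(UNIV :: 'n set). 6 / H * (3/2) ^ CARD('n))" .
qed

lemma bubble_L2:
  fixes c :: "real^'n"
  assumes D: "open D" "bounded D" and H: "0 < H"
  shows "(\<lambda>x. complex_of_real (\<Prod>k\<in>UNIV. bubble1d ((x $ k - c $ k) / H))) \<in> L2 (lebesgue_on D)"
proof (rule L2_bounded[OF emeasure_lebesgue_on_finite[OF D]])
  have "(\<lambda>x :: real^'n. complex_of_real (\<Prod>k\<in>UNIV. bubble1d ((x $ k - c $ k) / H))) \<in> borel_measurable borel"
    by measurable
  then show "(\<lambda>x. complex_of_real (\<Prod>k\<in>UNIV. bubble1d ((x $ k - c $ k) / H))) \<in> borel_measurable (lebesgue_on D)"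
    by (rule measurable_lebesgue_on_borel)
  fix x
  have "(\<Prod>k\<in>UNIV. bubble1d ((x $ k - c $ k) / H)) \<le> (\<Prod>k\<in>(UNIV :: 'n set). 3/2)"
    by (intro prod_mono conjI bubble1d_bounds)
  moreover have "0 \<le> (\<Prod>k\<in>UNIV. bubble1d ((x $ k - c $ k) / H))"
    by (intro prod_nonneg bubble1d_bounds)
  ultimately show "norm (complex_of_real (\<Prod>k\<in>UNIV. bubble1d ((x $ k - c $ k) / H))) \<le> (\<Prod>k\<in>(UNIV :: 'n set). 3/2)"
    unfolding norm_of_real by simp
qed

lemma prod_update_coordinate:
  fixes x :: "real^'n" and f :: "'n \<Rightarrow> real \<Rightarrow> real"
  shows "(\<Prod>j\<in>UNIV. f j ((x + h *\<^sub>R axis k 1) $ j)) = f k (x $ k + h) * (\<Prod>j\<in>UNIV - {k}. f j (x $ j))"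
proof -
  have "(\<Prod>j\<in>UNIV. f j ((x + h *\<^sub>R axis k 1) $ j)) = f k ((x + h *\<^sub>R axis k 1) $ k) * (\<Prod>j\<in>UNIV - {k}. f j ((x + h *\<^sub>R axis k 1) $ j))"
    by (rule prod.remove) auto
  also have "(\<Prod>j\<in>UNIV - {k}. f j ((x + h *\<^sub>R axis k 1) $ j)) = (\<Prod>j\<in>UNIV - {k}. f j (x $ j))"
    by (intro prod.cong) (auto simp: axis_def)
  finally show ?thesis by (simp add: axis_def)
qed

text \<open>For a test function \<open>\<phi>\<close>, the two sides of the integration by parts formula differ by the integral of
  the partial derivative of the Lipschitz function \<open>U \<phi>\<close>, where \<open>U\<close> is the bubble. The derivative of
  \<open>U\<close> exists off the two hyperplanes that carry the faces of the cell.\<close>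

lemma has_weak_gradient_bubble:
  fixes c :: "real^'n"
  assumes D: "open D" "bounded D" and H: "0 < H"
  shows "has_weak_gradient D (\<lambda>x. complex_of_real (\<Prod>k\<in>UNIV. bubble1d ((x $ k - c $ k) / H))) (bubble_grad H c)"
  unfolding has_weak_gradient_def
proof (intro allI impI)
  fix \<phi> \<phi>' k assume T: "test_function D \<phi> \<phi>'"
  define U where "U x = (\<Prod>k\<in>UNIV. bubble1d ((x $ k - c $ k) / H))" for x :: "real^'n"
  define P where "P x = (\<Prod>j\<in>UNIV - {k}. bubble1d ((x $ j - c $ j) / H))" for x :: "real^'n"
  define U' where "U' x = bubble1d_deriv ((x $ k - c $ k) / H) / H * P x" for x :: "real^'n"
  define F where "F x = U x * \<phi> x" for x
  define F' where "F' x = U x * (\<phi>' x $ k) + U' x * \<phi> x" for x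
  let ?e = "axis k 1 :: real^'n"
  obtain B where B: "\<And>x. \<bar>\<phi> x\<bar> \<le> B" "\<And>x. norm (\<phi>' x) \<le> B" "B > 0"
    using test_function_bounded[OF T] by metis
  have P: "0 \<le> P x" "P x \<le> (3/2) ^ CARD('n)" for x
  proof -
    show "0 \<le> P x" unfolding P_def by (intro prod_nonneg) (simp add: bubble1d_bounds)
    have "P x \<le> (\<Prod>j\<in>UNIV - {k}. 3/2)"
      unfolding P_def by (intro prod_mono conjI bubble1d_bounds)
    also have "\<dots> \<le> (3/2) ^ CARD('n)" by (simp add: power_increasing)
    finally show "P x \<le> (3/2) ^ CARD('n)" .
  qed
  define Q where "Q = (3/2 :: real) ^ CARD('n)"
  have Q: "0 \<le> Q" by (simp add: Q_def)
  have U: "U x = bubble1d ((x $ k - c $ k) / H) * P x" for x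
    unfolding U_def P_def by (rule prod.remove) auto
  have Ub: "0 \<le> U x" "U x \<le> Q" for x
  proof -
    show "0 \<le> U x" unfolding U_def by (intro prod_nonneg) (simp add: bubble1d_bounds)
    have "U x \<le> (\<Prod>j\<in>(UNIV :: 'n set). 3/2)"
      unfolding U_def by (intro prod_mono conjI bubble1d_bounds)
    then show "U x \<le> Q" by (simp add: Q_def)
  qed
  have Ush: "U (x + h *\<^sub>R ?e) = bubble1d ((x $ k + h - c $ k) / H) * P x" for x h
    unfolding U_def P_def by (rule prod_update_coordinate)
  have dphi: "((\<lambda>h. \<phi> (x + h *\<^sub>R ?e)) has_real_derivative \<phi>' (x + t *\<^sub>R ?e) $ k) (at t)" for x t
  proof -
    have "((\<lambda>h. x + h *\<^sub>R ?e) has_derivative (\<lambda>h. h *\<^sub>R ?e)) (at t)"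
      by (auto intro!: derivative_eq_intros)
    moreover have "(\<phi> has_derivative (\<lambda>h. \<phi>' (x + t *\<^sub>R ?e) \<bullet> h)) (at (x + t *\<^sub>R ?e))"
      using T by (simp add: test_function_def)
    ultimately have "((\<lambda>h. \<phi> (x + h *\<^sub>R ?e)) has_derivative (\<lambda>h. \<phi>' (x + t *\<^sub>R ?e) \<bullet> (h *\<^sub>R ?e))) (at t)"
      by (rule has_derivative_compose)
    then show ?thesis
      by (simp add: has_field_derivative_def inner_axis mult.commute[of _ "_ $ k"])
  qed
  have phi_lip: "\<bar>\<phi> (x + h *\<^sub>R ?e) - \<phi> x\<bar> \<le> B * \<bar>h\<bar>" for x h
  proof -
    have "norm (\<phi> (x + h *\<^sub>R ?e) - \<phi> (x + 0 *\<^sub>R ?e)) \<le> B * norm (h - 0)"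
    proof (rule field_differentiable_bound[of UNIV "\<lambda>h. \<phi> (x + h *\<^sub>R ?e)" "\<lambda>t. \<phi>' (x + t *\<^sub>R ?e) $ k"])
      show "norm (\<phi>' (x + t *\<^sub>R ?e) $ k) \<le> B" for t
        using component_le_norm_cart[of "\<phi>' (x + t *\<^sub>R ?e)" k] B(2)[of "x + t *\<^sub>R ?e"] by simp
    qed (use dphi in auto)
    then show ?thesis by simp
  qed
  have U_lip: "\<bar>U (x + h *\<^sub>R ?e) - U x\<bar> \<le> 6 / H * Q * \<bar>h\<bar>" for x h
  proof -
    have "U (x + h *\<^sub>R ?e) - U x = (bubble1d ((x $ k + h - c $ k) / H) - bubble1d ((x $ k - c $ k) / H)) * P x"
      by (simp only: Ush U[of x] left_diff_distrib)
    moreover have "\<bar>bubble1d ((x $ k + h - c $ k) / H) - bubble1d ((x $ k - c $ k) / H)\<bar> \<le> 6 * \<bar>(x $ k + h - c $ k) / H - (x $ k - c $ k) / H\<bar>"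
      unfolding bubble1d_eq by (rule smoothstep_deriv_lipschitz)
    moreover have "(x $ k + h - c $ k) / H - (x $ k - c $ k) / H = h / H"
      by (simp add: diff_divide_distrib[symmetric])
    ultimately have eq: "U (x + h *\<^sub>R ?e) - U x = (bubble1d ((x $ k + h - c $ k) / H) - bubble1d ((x $ k - c $ k) / H)) * P x"
      and le: "\<bar>bubble1d ((x $ k + h - c $ k) / H) - bubble1d ((x $ k - c $ k) / H)\<bar> \<le> 6 * \<bar>h / H\<bar>"
      by simp_all
    have "\<bar>U (x + h *\<^sub>R ?e) - U x\<bar> \<le> (6 * \<bar>h / H\<bar>) * Q"
      unfolding eq abs_mult Q_def using P[of x] by (intro mult_mono le) auto
    then show ?thesis using H by (simp add: abs_divide mult_ac)
  qed
  have F_lip: "\<bar>F (x + h *\<^sub>R ?e) - F x\<bar> \<le> (Q * B + 6 / H * Q * B) * \<bar>h\<bar>" for x h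
  proof -
    have "F (x + h *\<^sub>R ?e) - F x = U (x + h *\<^sub>R ?e) * (\<phi> (x + h *\<^sub>R ?e) - \<phi> x) + (U (x + h *\<^sub>R ?e) - U x) * \<phi> x"
      by (simp add: F_def algebra_simps)
    then have "\<bar>F (x + h *\<^sub>R ?e) - F x\<bar> \<le> \<bar>U (x + h *\<^sub>R ?e)\<bar> * \<bar>\<phi> (x + h *\<^sub>R ?e) - \<phi> x\<bar> + \<bar>U (x + h *\<^sub>R ?e) - U x\<bar> * \<bar>\<phi> x\<bar>"
      by (metis abs_mult abs_triangle_ineq)
    also have "\<dots> \<le> Q * (B * \<bar>h\<bar>) + (6 / H * Q * \<bar>h\<bar>) * B"
      using Ub Q H by (intro add_mono mult_mono phi_lip U_lip B) auto
    finally show ?thesis by (simp add: algebra_simps)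
  qed
  have cont: "continuous_on UNIV \<phi>" "continuous_on UNIV \<phi>'" using test_function_continuous[OF T] by auto
  have [measurable]: "\<phi> \<in> borel_measurable borel" "\<phi>' \<in> borel_measurable borel"
    using cont by (auto intro: borel_measurable_continuous_onI)
  have Um [measurable]: "U \<in> borel_measurable borel" "U' \<in> borel_measurable borel"
    unfolding U_def[abs_def] U'_def[abs_def] P_def[abs_def] by measurable
  have Fm: "F \<in> borel_measurable borel" "F' \<in> borel_measurable borel"
    unfolding F_def[abs_def] F'_def[abs_def] by measurable
  have "(LINT x|lborel. F' x) = 0"
  proof (rule integral_directional_derivative_eq_0[OF Fm _ F_lip])
    show "norm ?e \<le> 1" by simp
    show "x \<in> cube c H" if "F x \<noteq> 0" for x
    proof (rule ccontr)
      assume "x \<notin> cube c H"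
      then have "x \<notin> interior (cube c H)" using interior_subset by blast
      then have "U x = 0" unfolding U_def by (rule bubble_eq_0[OF H])
      then show False using that by (simp add: F_def)
    qed
    show "bounded (cube c H)" by (simp add: cube_def)
    show "\<bar>F x\<bar> \<le> Q * B" for x
      unfolding F_def abs_mult using Ub Q B by (intro mult_mono) auto
    have "AE x in lebesgue. off_lattice c H x" by (rule AE_off_lattice)
    then have "AE x in lborel. off_lattice c H x" by (simp add: AE_completion_iff)
    then show "AE x in lborel. ((\<lambda>h. F (x + h *\<^sub>R ?e)) has_real_derivative F' x) (at 0)"
    proof eventually_elim
      case (elim x)
      have "x $ k \<noteq> c $ k + H * of_int 0" "x $ k \<noteq> c $ k + H * of_int 1"
        using elim unfolding off_lattice_def by blast+
      then have "(x $ k - c $ k) / H \<noteq> 0" "(x $ k - c $ k) / H \<noteq> 1" using H by auto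
      then have b: "(bubble1d has_real_derivative bubble1d_deriv ((x $ k - c $ k) / H)) (at ((x $ k + 0 - c $ k) / H))"
        using DERIV_bubble1d by simp
      have "((\<lambda>h. (x $ k + h - c $ k) / H) has_real_derivative 1 / H) (at 0)"
        using H by (auto intro!: derivative_eq_intros)
      from DERIV_chain2[OF b this]
      have "((\<lambda>h. U (x + h *\<^sub>R ?e)) has_real_derivative U' x) (at 0)"
        unfolding Ush U'_def by (auto intro!: derivative_eq_intros)
      from DERIV_mult[OF this dphi[of x 0]] show ?case
        by (simp add: F_def F'_def mult_ac add_ac)
    qed
  qed
  moreover have "(LINT x|lebesgue_on D. F' x) = (LINT x|lborel. F' x)"
  proof -
    have "(LINT x|lebesgue_on D. F' x) = (LINT x|lebesgue. indicator D x *\<^sub>R F' x)"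
      using D(1) by (intro integral_restrict_space) auto
    also have "\<dots> = (LINT x|lebesgue. F' x)"
      using test_function_outside[OF T]
      by (intro Bochner_Integration.integral_cong) (auto simp: F'_def split: split_indicator)
    also have "\<dots> = (LINT x|lborel. F' x)"
      using Fm by (intro integral_completion) simp
    finally show ?thesis .
  qed
  ultimately have 0: "(LINT x|lebesgue_on D. F' x) = 0" by simp
  note L2 = bubble_L2[OF D H, of c] L2_component[OF bubble_grad_L2[OF D H], of c k] test_function_L2[OF T emeasure_lebesgue_on_finite[OF D]]
  have "(LINT x|lebesgue_on D. complex_of_real (U x) * complex_of_real (\<phi>' x $ k)) + (LINT x|lebesgue_on D. bubble_grad H c x $ k * complex_of_real (\<phi> x))
      = (LINT x|lebesgue_on D. complex_of_real (F' x))"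
    using L2_mult_integrable[OF L2(1) L2(4)[of k]] L2_mult_integrable[OF L2(2) L2(3)]
    by (subst Bochner_Integration.integral_add[symmetric]) (simp_all add: F'_def U_def U'_def P_def bubble_grad_def)
  then have "(LINT x|lebesgue_on D. complex_of_real (U x) * complex_of_real (\<phi>' x $ k)) + (LINT x|lebesgue_on D. bubble_grad H c x $ k * complex_of_real (\<phi> x)) = 0"
    by (simp add: 0)
  then show "(LINT x|lebesgue_on D. complex_of_real (\<Prod>k\<in>UNIV. bubble1d ((x $ k - c $ k) / H)) * complex_of_real (\<phi>' x $ k)) =
     - (LINT x|lebesgue_on D. bubble_grad H c x $ k * complex_of_real (\<phi> x))"
    unfolding U_def by (rule eq_neg_iff_add_eq_0[THEN iffD2])
qed

section \<open>The kernel of the projection\<close>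

text \<open>Up to the factor \<open>\<bar>T\<bar>\<close>, this is the value on \<open>T\<close> of the projection of \<open>f\<close> onto the piecewise
  constant functions.\<close>

definition cell_integral :: "(real^'n) set \<Rightarrow> (real^'n \<Rightarrow> complex) \<Rightarrow> (real^'n) set \<Rightarrow> complex" where
  "cell_integral D f T = (LINT x|lebesgue_on D. f x * indicator T x)"

lemma measurable_lebesgue_on_AE:
  fixes f g :: "real^'n \<Rightarrow> complex"
  assumes D: "open D" and f: "f \<in> borel_measurable (lebesgue_on D)" and ae: "AE x in lebesgue_on D. f x = g x"
  shows "g \<in> borel_measurable (lebesgue_on D)"
proof -
  have Ds: "D \<inter> space lebesgue \<in> sets lebesgue" using D by auto
  have "(\<lambda>x. indicator D x *\<^sub>R f x) \<in> borel_measurable lebesgue"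
    using f by (simp add: borel_measurable_restrict_space_iff[OF Ds])
  moreover have "AE x in lebesgue. indicator D x *\<^sub>R f x = indicator D x *\<^sub>R g x"
    using ae unfolding AE_restrict_space_iff[OF Ds] by eventually_elim (auto split: split_indicator)
  ultimately have "(\<lambda>x. indicator D x *\<^sub>R g x) \<in> borel_measurable lebesgue"
    by (rule borel_measurable_AE)
  then show ?thesis
    by (simp add: borel_measurable_restrict_space_iff[OF Ds])
qed

lemma measurable_indicator_cell:
  assumes "lattice_mesh D a H \<T>" "T \<in> \<T>"
  shows "(indicator T :: real^'n \<Rightarrow> 'b::real_normed_algebra_1) \<in> borel_measurable (lebesgue_on D')"
proof -
  obtain z where "T = cell a H z" using assms by (auto simp: lattice_mesh_def)
  then have "T \<in> sets borel" by (simp add: cell_def cube_def)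
  then show ?thesis by (intro measurable_lebesgue_on_borel borel_measurable_indicator)
qed

lemma step_function_AE:
  fixes q :: "real^'n \<Rightarrow> complex"
  assumes D: "open D" and mesh: "lattice_mesh D a H \<T>" and T: "T \<in> \<T>"
    and q: "AE x in lebesgue_on D. q x = (\<Sum>S\<in>\<T>. c S * indicator S x)"
  shows "AE x in lebesgue_on D. q x * indicator T x = c T * indicator T x"
  using q lattice_mesh_AE_cell[OF mesh D]
proof eventually_elim
  case (elim x)
  then obtain S where S: "S \<in> \<T>" "x \<in> interior S" by blast
  show ?case
  proof (cases "x \<in> T")
    case True
    obtain z z' where "S = cell a H z" "T = cell a H z'" using mesh S T by (meson lattice_mesh_def)
    then have "S = T"
      using cell_eq_of_interior[of H x a z z'] S True mesh by (auto simp: lattice_mesh_def)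
    then show ?thesis using elim(1) sum_indicator_mesh[OF mesh S, of c] by (simp only:)
  qed simp
qed

context
  fixes D :: "(real^'n) set" and a :: "real^'n" and H :: real and \<T> :: "(real^'n) set set"
  assumes lip: "bounded_lipschitz_domain D" and mesh: "lattice_mesh D a H \<T>"
begin

lemma D': "open D" "bounded D" using lip by (auto simp: bounded_lipschitz_domain_def)

lemma H_pos: "0 < H" using mesh by (simp add: lattice_mesh_def)

lemma cell_integral_lebesgue:
  fixes f :: "real^'n \<Rightarrow> complex"
  assumes T: "T \<in> \<T>" and f: "f \<in> borel_measurable borel" and supp: "\<And>x. x \<notin> T \<Longrightarrow> f x = 0"
  shows "(LINT x|lebesgue_on D. f x) = (LINT x|lborel. f x)"
proof -
  obtain z where z: "T = cell a H z" using mesh T by (auto simp: lattice_mesh_def)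
  have [measurable]: "f \<in> borel_measurable lebesgue" using f by (intro measurable_completion) simp
  have "(LINT x|lebesgue_on D. f x) = (LINT x|lebesgue. indicator D x *\<^sub>R f x)"
    using D' by (intro integral_restrict_space) auto
  also have "\<dots> = (LINT x|lebesgue. f x)"
  proof (rule integral_cong_AE)
    have Ds: "D \<in> sets lebesgue" using D' by auto
    show "(\<lambda>x. indicator D x *\<^sub>R f x) \<in> borel_measurable lebesgue"
      using Ds by measurable
    show "AE x in lebesgue. indicator D x *\<^sub>R f x = f x"
      using AE_off_lattice[of a H]
    proof eventually_elim
      case (elim x)
      show ?case
      proof (cases "x \<in> T")
        case True
        then have "x \<in> interior T" using elim z off_lattice_interior_cell by blast
        then have "x \<in> D" using mesh_cell_interior_subset[OF lip mesh T] by blast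
        then show ?thesis by simp
      qed (simp add: supp)
    qed
  qed simp
  also have "\<dots> = (LINT x|lborel. f x)" using f by (intro integral_completion) simp
  finally show ?thesis .
qed

lemma cell_integral_indicator:
  assumes T: "T \<in> \<T>"
  shows "(LINT x|lebesgue_on D. indicator T x :: complex) = of_real (H ^ CARD('n))"
proof -
  obtain z where z: "T = cell a H z" using mesh T by (auto simp: lattice_mesh_def)
  have Tb: "T \<in> sets borel" by (simp add: z cell_def cube_def)
  have "(LINT x|lebesgue_on D. indicator T x :: complex) = (LINT x|lborel. indicator T x)"
    by (rule cell_integral_lebesgue[OF T]) (use Tb in auto)
  also have "\<dots> = (LINT x|lborel. complex_of_real (indicator T x))"
    by (intro Bochner_Integration.integral_cong) (auto split: split_indicator)
  also have "\<dots> = of_real (measure lborel T)"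
    using Tb by simp
  also have "measure lborel T = H ^ CARD('n)"
    using measure_cube[OF H_pos, of "\<chi> k. a $ k + H * of_int (z k)"] by (simp add: z cell_def cube_def)
  finally show ?thesis .
qed

lemma step_function_measurable:
  fixes q :: "real^'n \<Rightarrow> complex"
  assumes q: "AE x in lebesgue_on D. q x = (\<Sum>S\<in>\<T>. c S * indicator S x)"
  shows "q \<in> borel_measurable (lebesgue_on D)"
proof (rule measurable_lebesgue_on_AE[OF D'(1)])
  show "(\<lambda>x. \<Sum>S\<in>\<T>. c S * indicator S x) \<in> borel_measurable (lebesgue_on D)"
    by (intro borel_measurable_sum borel_measurable_times borel_measurable_const measurable_indicator_cell[OF mesh])
  show "AE x in lebesgue_on D. (\<Sum>S\<in>\<T>. c S * indicator S x) = q x"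
    using q by eventually_elim simp
qed

lemma cell_integral_step:
  fixes q :: "real^'n \<Rightarrow> complex"
  assumes T: "T \<in> \<T>" and q: "AE x in lebesgue_on D. q x = (\<Sum>S\<in>\<T>. c S * indicator S x)"
  shows "cell_integral D q T = c T * of_real (H ^ CARD('n))"
proof -
  have "cell_integral D q T = (LINT x|lebesgue_on D. c T * indicator T x)"
    unfolding cell_integral_def
    using step_function_AE[OF D'(1) mesh T q] step_function_measurable[OF q] measurable_indicator_cell[OF mesh T, where 'b = complex]
    by (intro integral_cong_AE) auto
  then show ?thesis by (simp add: cell_integral_indicator[OF T])
qed

lemma integrable_mult_indicator_cell:
  fixes f :: "real^'n \<Rightarrow> complex"
  assumes T: "T \<in> \<T>" and f: "integrable (lebesgue_on D) f"
  shows "integrable (lebesgue_on D) (\<lambda>x. f x * indicator T x)"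
  using f measurable_indicator_cell[OF mesh T, where 'b = complex]
  by (intro Bochner_Integration.integrable_bound[OF f]) (auto split: split_indicator)

lemma l2_inner_step:
  fixes f q :: "real^'n \<Rightarrow> complex"
  assumes f: "integrable (lebesgue_on D) f" and q: "AE x in lebesgue_on D. q x = (\<Sum>S\<in>\<T>. c S * indicator S x)"
  shows "l2_inner (lebesgue_on D) f q = (\<Sum>S\<in>\<T>. cnj (c S) * cell_integral D f S)"
proof -
  have "l2_inner (lebesgue_on D) f q = (LINT x|lebesgue_on D. (\<Sum>S\<in>\<T>. cnj (c S) * (f x * indicator S x)))"
    unfolding l2_inner_def
  proof (rule integral_cong_AE)
    have [measurable]: "f \<in> borel_measurable (lebesgue_on D)" "q \<in> borel_measurable (lebesgue_on D)"
      using f step_function_measurable[OF q] by auto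
    show "(\<lambda>x. f x * cnj (q x)) \<in> borel_measurable (lebesgue_on D)" by measurable
    show "(\<lambda>x. \<Sum>S\<in>\<T>. cnj (c S) * (f x * indicator S x)) \<in> borel_measurable (lebesgue_on D)"
      by (intro borel_measurable_sum borel_measurable_times borel_measurable_const measurable_indicator_cell[OF mesh]) auto
    show "AE x in lebesgue_on D. f x * cnj (q x) = (\<Sum>S\<in>\<T>. cnj (c S) * (f x * indicator S x))"
      using q
    proof eventually_elim
      case (elim x)
      have "cnj (indicator S x) = indicator S x" for S :: "(real^'n) set" by (auto split: split_indicator)
      then show ?case by (simp add: elim sum_distrib_left mult_ac)
    qed
  qed
  also have "\<dots> = (\<Sum>S\<in>\<T>. cnj (c S) * cell_integral D f S)"
    unfolding cell_integral_def using integrable_mult_indicator_cell[OF _ f]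
    by (subst Bochner_Integration.integral_sum) auto
  finally show ?thesis .
qed

lemma cell_integral_diff:
  assumes T: "T \<in> \<T>" and f: "integrable (lebesgue_on D) f" and g: "integrable (lebesgue_on D) g"
  shows "cell_integral D (\<lambda>x. f x - g x) T = cell_integral D f T - cell_integral D g T"
  unfolding cell_integral_def left_diff_distrib
  by (intro Bochner_Integration.integral_diff integrable_mult_indicator_cell[OF T] f g)

lemma step_function_integrable:
  fixes q :: "real^'n \<Rightarrow> complex"
  assumes q: "AE x in lebesgue_on D. q x = (\<Sum>S\<in>\<T>. c S * indicator S x)"
  shows "integrable (lebesgue_on D) q"
proof -
  have one: "integrable (lebesgue_on D) (\<lambda>_. 1 :: complex)"
    using emeasure_lebesgue_on_finite[OF D'] by (auto intro!: finite_measure.integrable_const finite_measureI)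
  have "integrable (lebesgue_on D) (\<lambda>x. \<Sum>S\<in>\<T>. c S * (1 * indicator S x))"
  proof (rule Bochner_Integration.integrable_sum)
    fix S assume "S \<in> \<T>"
    from integrable_mult_right[OF integrable_mult_indicator_cell[OF this one], of "c S"]
    show "integrable (lebesgue_on D) (\<lambda>x. c S * (1 * indicator S x))" by blast
  qed
  then show ?thesis
    using step_function_measurable[OF q] q
    by (subst integrable_cong_AE) auto
qed

text \<open>The projection is characterised by its cell integrals: testing with the indicator function of a cell
  isolates one coefficient. The step function with the cell means of \<open>w\<close> witnesses that a projection
  exists, so the chosen one has the defining property.\<close>

lemma l2_projection_cell_integral:
  assumes w: "w \<in> L2 (lebesgue_on D)"
  obtains c where "AE x in lebesgue_on D. l2_projection (lebesgue_on D) (Q0 D \<T>) w x = (\<Sum>S\<in>\<T>. c S * indicator S x)"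
    "\<And>T. T \<in> \<T> \<Longrightarrow> c T * of_real (H ^ CARD('n)) = cell_integral D w T"
proof -
  let ?M = "lebesgue_on D" and ?h = "complex_of_real (H ^ CARD('n))"
  let ?P = "l2_projection ?M (Q0 D \<T>) w"
  have h: "?h \<noteq> 0" using H_pos by simp
  have wi: "integrable ?M w" by (rule L2_integrable[OF emeasure_lebesgue_on_finite[OF D'] w])
  have "\<exists>p. p \<in> Q0 D \<T> \<and> (\<forall>q\<in>Q0 D \<T>. l2_inner ?M (\<lambda>x. w x - p x) q = 0)"
  proof (intro exI conjI ballI)
    define p where "p x = (\<Sum>S\<in>\<T>. (cell_integral D w S / ?h) * indicator S x)" for x
    have p: "AE x in ?M. p x = (\<Sum>S\<in>\<T>. (cell_integral D w S / ?h) * indicator S x)"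
      by (simp add: p_def)
    show "p \<in> Q0 D \<T>" unfolding Q0_def using p by (auto intro!: exI[of _ "\<lambda>S. cell_integral D w S / ?h"])
    fix q assume "q \<in> Q0 D \<T>"
    then obtain c where c: "AE x in ?M. q x = (\<Sum>S\<in>\<T>. c S * indicator S x)" by (auto simp: Q0_def)
    have "cell_integral D (\<lambda>x. w x - p x) S = 0" if "S \<in> \<T>" for S
      using cell_integral_diff[OF that wi step_function_integrable[OF p]] cell_integral_step[OF that p] h by simp
    then show "l2_inner ?M (\<lambda>x. w x - p x) q = 0"
      by (subst l2_inner_step[OF Bochner_Integration.integrable_diff[OF wi step_function_integrable[OF p]] c]) simp
  qed
  then have P: "?P \<in> Q0 D \<T>" "\<And>q. q \<in> Q0 D \<T> \<Longrightarrow> l2_inner ?M (\<lambda>x. w x - ?P x) q = 0"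
    unfolding l2_projection_def using someI_ex[of "\<lambda>p. p \<in> Q0 D \<T> \<and> (\<forall>q\<in>Q0 D \<T>. l2_inner ?M (\<lambda>x. w x - p x) q = 0)"]
    by blast+
  then obtain c where c: "AE x in ?M. ?P x = (\<Sum>S\<in>\<T>. c S * indicator S x)" by (auto simp: Q0_def)
  show ?thesis
  proof (rule that[OF c])
    fix T assume T: "T \<in> \<T>"
    define e where "e S = (if S = T then 1 else 0 :: complex)" for S
    have q: "AE x in ?M. indicator T x = (\<Sum>S\<in>\<T>. e S * indicator S x)"
      using T mesh by (auto simp: e_def if_distrib[of "\<lambda>t. t * _"] lattice_mesh_def cong: if_cong)
    then have "(indicator T :: _ \<Rightarrow> complex) \<in> Q0 D \<T>" by (auto simp: Q0_def)
    then have "l2_inner ?M (\<lambda>x. w x - ?P x) (indicator T) = 0" by (rule P(2))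
    then have "cell_integral D (\<lambda>x. w x - ?P x) T = 0"
    proof -
      have "cnj (indicator T x) = indicator T x" for x by (auto split: split_indicator)
      then show ?thesis
        using \<open>l2_inner ?M (\<lambda>x. w x - ?P x) (indicator T) = 0\<close>
        unfolding l2_inner_def cell_integral_def by (simp only:)
    qed
    then show "c T * ?h = cell_integral D w T"
      using cell_integral_diff[OF T wi step_function_integrable[OF c]] cell_integral_step[OF T c] by simp
  qed
qed

lemma W_space_iff:
  assumes w: "w \<in> V_space D \<Gamma>D"
  shows "w \<in> W_space D \<Gamma>D \<T> \<longleftrightarrow> (\<forall>T\<in>\<T>. cell_integral D w T = 0)"
proof -
  let ?M = "lebesgue_on D" and ?h = "complex_of_real (H ^ CARD('n))"
  let ?P = "l2_projection ?M (Q0 D \<T>) w"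
  have h: "?h \<noteq> 0" using H_pos by simp
  obtain c where c: "AE x in ?M. ?P x = (\<Sum>S\<in>\<T>. c S * indicator S x)"
    and cw: "\<And>T. T \<in> \<T> \<Longrightarrow> c T * ?h = cell_integral D w T"
    by (rule l2_projection_cell_integral[OF W12_D(1)[OF V_space_D(1)[OF w]]]) blast
  show ?thesis
  proof
    assume "w \<in> W_space D \<Gamma>D \<T>"
    then have P0: "AE x in ?M. ?P x = 0" by (simp add: W_space_def)
    show "\<forall>T\<in>\<T>. cell_integral D w T = 0"
    proof
      fix T assume T: "T \<in> \<T>"
      have "cell_integral D ?P T = (LINT x|?M. 0)"
        unfolding cell_integral_def
        using P0 step_function_measurable[OF c] measurable_indicator_cell[OF mesh T, where 'b = complex]
        by (intro integral_cong_AE) auto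
      then have "c T * ?h = 0" using cell_integral_step[OF T c] by simp
      then show "cell_integral D w T = 0" using cw[OF T] H_pos by auto
    qed
  next
    assume "\<forall>T\<in>\<T>. cell_integral D w T = 0"
    then have "c T = 0" if "T \<in> \<T>" for T using cw[OF that] that h by simp
    then have "AE x in ?M. ?P x = 0" using c by simp
    then show "w \<in> W_space D \<Gamma>D \<T>" using w by (simp add: W_space_def)
  qed
qed

text \<open>A bubble is continuous and vanishes on the boundary of the domain, since no boundary point is interior
  to a cell; it is therefore its own trace.\<close>

lemma bubble_in_V_space:
  assumes T: "T \<in> \<T>" and \<Gamma>D: "\<Gamma>D \<subseteq> frontier D"
  shows "bubble H T \<in> V_space D \<Gamma>D"
proof -
  let ?M = "lebesgue_on D" and ?u = "bubble H T" and ?\<mu> = "surface_measure (frontier D)"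
  have L2: "?u \<in> L2 ?M"
    unfolding bubble_def[abs_def] by (rule bubble_L2[OF D' H_pos])
  have "has_weak_gradient D ?u (bubble_grad H (corner T))"
    unfolding bubble_def[abs_def] by (rule has_weak_gradient_bubble[OF D' H_pos])
  then have W: "?u \<in> W12 D"
    unfolding W12_def using L2 bubble_grad_L2[OF D' H_pos, of "corner T"] by blast
  obtain z where z: "T = cell a H z" using mesh T by (auto simp: lattice_mesh_def)
  have zero: "?u x = 0" if "x \<in> frontier D" for x
  proof -
    have "x \<notin> D" using that D' by (auto simp: frontier_def interior_open)
    then have "x \<notin> interior T" using mesh_cell_interior_subset[OF lip mesh T] by blast
    then show ?thesis using bubble_eq_0_outside[OF H_pos] z by simp
  qed
  have sp: "space (surface_measure \<Gamma>) = \<Gamma>" for \<Gamma> :: "(real^'n) set"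
    by (simp add: surface_measure_def space_restrict_space)
  have "sqnorm ?\<mu> ?u = (\<integral>\<^sup>+ x. 0 \<partial>?\<mu>)"
    unfolding sqnorm_def by (intro nn_integral_cong) (simp add: sp zero)
  then have L2': "?u \<in> L2 ?\<mu>"
    unfolding L2_def using measurable_surface_continuous[OF continuous_bubble[of "frontier D" H T]] by simp
  have tr: "has_trace D ?u ?u"
    unfolding has_trace_def
  proof (intro conjI exI[of _ "\<lambda>n. ?u"] allI W L2' continuous_bubble)
  qed (simp_all add: sqnorm_def)
  have "AE x in surface_measure \<Gamma>D. ?u x = 0"
    by (rule AE_I2) (use sp zero \<Gamma>D in auto)
  then show ?thesis using W tr by (auto simp: V_space_def)
qed

end

lemma V_space_sum:
  assumes D: "open D" "bounded D" and ne: "u \<in> V_space D \<Gamma>D" and A: "finite A" "\<And>i. i \<in> A \<Longrightarrow> f i \<in> V_space D \<Gamma>D"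
  shows "(\<lambda>x. \<Sum>i\<in>A. c i * f i x) \<in> V_space D \<Gamma>D"
  using A
proof (induction A rule: finite_induct)
  case empty
  show ?case using V_space_lincomb[OF D ne ne, of "-1"] by simp
next
  case (insert i A)
  have "(\<lambda>x. (\<Sum>i\<in>A. c i * f i x) + c i * f i x) \<in> V_space D \<Gamma>D"
    using insert by (intro V_space_lincomb[OF D]) auto
  then show ?case using insert by (simp add: add.commute)
qed

section \<open>Haar functions\<close>

lemma measurable_haar1d [measurable]: "haar1d j \<in> borel_measurable borel"
  unfolding haar1d_def by measurable

lemma haar1d_eq_0: "t < 0 \<or> 1 < t \<Longrightarrow> haar1d j t = 0"
  by (auto simp: haar1d_def split: split_indicator)

lemma haar1d_bound: "\<bar>haar1d j t\<bar> \<le> 1"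
  by (auto simp: haar1d_def split: split_indicator)

lemma haar1d_half_open_const:
  fixes m :: int
  assumes "of_int m < 2 * s" "2 * s < of_int m + 1" "of_int m < 2 * t" "2 * t < of_int m + 1"
  shows "haar1d j s = haar1d j t"
proof -
  consider "m \<le> - 1" | "m = 0" | "m = 1" | "2 \<le> m" by linarith
  then show ?thesis
  proof cases
    case 1
    then have "real_of_int m + 1 \<le> 0" by linarith
    then have "s < 0" "t < 0" using assms by linarith+
    then show ?thesis by (simp add: haar1d_eq_0)
  next
    case 4
    then have "2 \<le> real_of_int m" by linarith
    then have "1 < s" "1 < t" using assms by linarith+
    then show ?thesis by (simp add: haar1d_eq_0)
  qed (use assms in \<open>auto simp: haar1d_def split: split_indicator\<close>)
qed

definition haar_product :: "real^'n \<Rightarrow> real \<Rightarrow> ('n \<Rightarrow> nat) \<Rightarrow> real^'n \<Rightarrow> real" where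
  "haar_product c H j x = (\<Prod>k\<in>UNIV. haar1d (j k) ((x $ k - c $ k) / H))"

lemma measurable_haar_product [measurable]: "haar_product c H j \<in> borel_measurable borel"
  unfolding haar_product_def[abs_def] by measurable

lemma haar_product_eq_0:
  assumes H: "0 < H" and x: "x \<notin> cube c H"
  shows "haar_product c H j x = 0"
proof -
  obtain k where "\<not> (c $ k \<le> x $ k \<and> x $ k \<le> c $ k + H)"
    using x by (auto simp: mem_cube)
  then have "(x $ k - c $ k) / H < 0 \<or> 1 < (x $ k - c $ k) / H"
    using H by (auto simp: divide_less_0_iff less_divide_eq)
  then have "haar1d (j k) ((x $ k - c $ k) / H) = 0" by (rule haar1d_eq_0)
  then show ?thesis unfolding haar_product_def by (intro prod_zero) auto
qed

text \<open>In a direction with the oscillating factor, the Haar function is the difference of a function and its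
  translate by half a cell.\<close>

lemma integral_haar_product_eq_0:
  fixes c :: "real^'n"
  assumes H: "0 < H" and jk: "j k \<noteq> 0"
  shows "(LINT x|lborel. haar_product c H j x) = 0"
proof -
  define F where "F i t = (if i = k then indicator {0..1} (2 * ((t - c $ k) / H)) else haar1d (j i) ((t - c $ i) / H))" for i t
  define f where "f x = (\<Prod>i\<in>UNIV. F i (x $ i))" for x :: "real^'n"
  define P where "P x = (\<Prod>i\<in>UNIV - {k}. haar1d (j i) ((x $ i - c $ i) / H))" for x :: "real^'n"
  have PF: "(\<Prod>i\<in>UNIV - {k}. F i (x $ i)) = P x" for x
    unfolding P_def F_def by (intro prod.cong) auto
  have Fm [measurable]: "F i \<in> borel_measurable borel" for i
    unfolding F_def[abs_def] by measurable
  have fm [measurable]: "f \<in> borel_measurable borel"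
    unfolding f_def[abs_def] by measurable
  have fsh: "f (x + s *\<^sub>R axis k 1) = indicator {0..1} (2 * ((x $ k + s - c $ k) / H)) * P x" for x s
    unfolding f_def using prod_update_coordinate[of F x s k] by (simp add: PF F_def[of k])
  have F0: "F i t \<noteq> 0 \<Longrightarrow> c $ i \<le> t \<and> t \<le> c $ i + H" for i t
  proof -
    assume nz: "F i t \<noteq> 0"
    have "0 \<le> (t - c $ i) / H \<and> (t - c $ i) / H \<le> 1"
    proof (cases "i = k")
      case True
      define s where "s = (t - c $ k) / H"
      have "indicator {0..1} (2 * s) \<noteq> (0 :: real)"
        using nz True by (simp only: F_def s_def if_True simp_thms)
      then have "0 \<le> s \<and> s \<le> 1" by (auto split: split_indicator_asm)
      then show ?thesis by (simp only: s_def True)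
    next
      case False
      then have "haar1d (j i) ((t - c $ i) / H) \<noteq> 0" using nz by (simp add: F_def)
      then show ?thesis using haar1d_eq_0 by (metis linorder_not_le)
    qed
    then show ?thesis using H by (auto simp: zero_le_divide_iff divide_le_eq)
  qed
  have fle: "\<bar>f x\<bar> \<le> indicator (cube c H) x" for x
  proof (cases "x \<in> cube c H")
    case True
    have "\<bar>f x\<bar> = (\<Prod>i\<in>UNIV. \<bar>F i (x $ i)\<bar>)" unfolding f_def by (rule abs_prod)
    also have "\<dots> \<le> 1"
      using haar1d_bound by (intro prod_le_1) (auto simp: F_def split: split_indicator)
    finally show ?thesis using True by simp
  next
    case False
    then obtain i where "F i (x $ i) = 0" using F0 unfolding mem_cube by metis
    then have "f x = 0" unfolding f_def by (intro prod_zero) auto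
    then show ?thesis by simp
  qed
  have int1: "integrable lborel (\<lambda>x. indicator (cube c H) x :: real)"
    unfolding cube_def by (intro integrable_real_indicator) (use emeasure_lborel_cbox_finite in auto)
  have fi: "integrable lborel f"
  proof (rule Bochner_Integration.integrable_bound[OF int1])
    show "AE x in lborel. norm (f x) \<le> norm (indicator (cube c H) x :: real)"
      by (rule AE_I2) (use fle in \<open>simp only: real_norm_def abs_indicator\<close>)
  qed (use fm in simp)
  \<comment> \<open>The second half of the Haar profile is the first half, moved by \<open>H / 2\<close>.\<close>
  have eq: "haar_product c H j x = f x - f (x + (- (H / 2)) *\<^sub>R axis k 1)" for x
  proof -
    have "haar_product c H j x = haar1d (j k) ((x $ k - c $ k) / H) * P x"
      unfolding haar_product_def P_def by (rule prod.remove) auto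
    also have "haar1d (j k) ((x $ k - c $ k) / H) = indicator {0..1} (2 * ((x $ k - c $ k) / H)) - indicator {0..1} (2 * ((x $ k - c $ k) / H) - 1)"
      using jk by (simp add: haar1d_def)
    also have "2 * ((x $ k - c $ k) / H) - 1 = 2 * ((x $ k + - (H / 2) - c $ k) / H)"
      using H by (simp add: field_simps)
    finally have "haar_product c H j x = (indicator {0..1} (2 * ((x $ k - c $ k) / H)) - indicator {0..1} (2 * ((x $ k + - (H / 2) - c $ k) / H))) * P x" .
    then show ?thesis
      using fsh[of x 0] fsh[of x "- (H / 2)"] by (simp add: left_diff_distrib)
  qed
  show ?thesis
    unfolding eq using fi lborel_integral_translation[OF fm, of "(- (H / 2)) *\<^sub>R axis k 1"] by simp
qed

lemma haar_product_cell_const: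
  assumes h: "0 < h" and x: "x \<in> interior (cell a h z)" and y: "y \<in> interior (cell a h z)"
    and c: "c = corner (cell a (2 * h) zT)"
  shows "haar_product c (2 * h) j x = haar_product c (2 * h) j y"
  unfolding haar_product_def
proof (rule prod.cong[OF refl], rule haar1d_half_open_const)
  fix k
  let ?m = "z k - 2 * zT k"
  have ck: "c $ k = a $ k + 2 * h * of_int (zT k)" unfolding c using h by (simp add: corner_cell)
  have *: "of_int ?m < 2 * ((t - c $ k) / (2 * h)) \<and> 2 * ((t - c $ k) / (2 * h)) < of_int ?m + 1"
    if "a $ k + h * of_int (z k) < t \<and> t < a $ k + h * (of_int (z k) + 1)" for t
  proof -
    have eq: "2 * ((t - c $ k) / (2 * h)) = (t - c $ k) / h" using h by (simp add: field_simps)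
    have "of_int ?m * h < t - c $ k" "t - c $ k < (of_int ?m + 1) * h"
      using that by (simp_all add: ck algebra_simps)
    then show ?thesis
      unfolding eq pos_less_divide_eq[OF h] pos_divide_less_eq[OF h] by blast
  qed
  show "of_int ?m < 2 * ((x $ k - c $ k) / (2 * h))" "2 * ((x $ k - c $ k) / (2 * h)) < of_int ?m + 1"
    using * x unfolding mem_interior_cell by blast+
  show "of_int ?m < 2 * ((y $ k - c $ k) / (2 * h))" "2 * ((y $ k - c $ k) / (2 * h)) < of_int ?m + 1"
    using * y unfolding mem_interior_cell by blast+
qed

context helmholtz_setting
begin

abbreviation "h l \<equiv> mesh_size H1 l"
abbreviation "m l \<equiv> mesh H1 \<T>1 l"

lemma mesh_level: "1 \<le> l \<Longrightarrow> lattice_mesh D a (h l) (m l)"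
  by (rule lattice_mesh_mesh[OF base_mesh])

lemma h_pos: "1 \<le> l \<Longrightarrow> 0 < h l"
  using mesh_level by (auto simp: lattice_mesh_def)

lemma mesh_nested:
  assumes "1 \<le> k" "k \<le> l" "T0 \<in> m k" "T \<in> m l"
  shows "T \<subseteq> T0 \<or> interior T \<inter> T0 = {}"
proof -
  obtain z z0 where "T = cell a (h l) z" "T0 = cell a (h k) z0"
    using mesh_level[of k] mesh_level[of l] assms by (meson lattice_mesh_def order_trans)
  then show ?thesis
    using cell_nested_or_disjoint[of "h l" "2 ^ (l - k)" a z z0] h_pos[of l] mesh_size_multiple[OF assms(1,2), of H1] assms
    by simp
qed

lemma cell_integral_coarse:
  assumes kl: "1 \<le> k" "k \<le> l" and T0: "T0 \<in> m k" and f: "integrable (lebesgue_on D) f"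
  shows "cell_integral D f T0 = (\<Sum>T\<in>{T \<in> m l. T \<subseteq> T0}. cell_integral D f T)"
proof -
  let ?M = "lebesgue_on D" and ?S = "{T \<in> m l. T \<subseteq> T0}"
  have l: "1 \<le> l" using kl by simp
  have fin: "finite (m l)" using mesh_level[OF l] by (simp add: lattice_mesh_def)
  have int: "integrable ?M (\<lambda>x. f x * indicator T x)" if "T \<in> m l" for T
    by (rule integrable_mult_indicator_cell[OF lip mesh_level[OF l] that f])
  have "AE x in ?M. f x * indicator T0 x = (\<Sum>T\<in>?S. f x * indicator T x)"
    using lattice_mesh_AE_cell[OF mesh_level[OF l] D(1)]
  proof eventually_elim
    case (elim x)
    then obtain T where T: "T \<in> m l" "x \<in> interior T" by blast
    have xT: "x \<in> T" using T(2) interior_subset by blast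
    have "x \<in> T0 \<longleftrightarrow> T \<subseteq> T0" using mesh_nested[OF kl T0 T(1)] T(2) xT by blast
    moreover have "(\<Sum>S\<in>m l. (if S \<subseteq> T0 then f x else 0) * indicator S x) = (if T \<subseteq> T0 then f x else 0)"
      by (rule sum_indicator_mesh[OF mesh_level[OF l] T])
    moreover have "(\<Sum>S\<in>m l. (if S \<subseteq> T0 then f x else 0) * indicator S x) = (\<Sum>S\<in>?S. f x * indicator S x)"
      unfolding sum.inter_filter[OF fin] by (intro sum.cong) auto
    ultimately show ?case by simp
  qed
  then have "cell_integral D f T0 = (LINT x|?M. (\<Sum>T\<in>?S. f x * indicator T x))"
    unfolding cell_integral_def
    using integrable_mult_indicator_cell[OF lip mesh_level[OF kl(1)] T0 f] int
    by (intro integral_cong_AE borel_measurable_integrable Bochner_Integration.integrable_sum) auto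
  also have "\<dots> = (\<Sum>T\<in>?S. cell_integral D f T)"
    unfolding cell_integral_def using int by (intro Bochner_Integration.integral_sum) auto
  finally show ?thesis .
qed

lemma haar_basis_cases:
  assumes "\<phi> \<in> haar_basis H1 \<T>1 l" "2 \<le> l"
  obtains T j k where "T \<in> m (l - 1)" "j k \<noteq> 0"
    "\<phi> = (\<lambda>x. complex_of_real (haar_product (corner T) (h (l - 1)) j x / sqrt (measure lebesgue T)))"
proof -
  obtain T j where T: "T \<in> m (l - 1)" "j \<noteq> (\<lambda>_. 0)"
    "\<phi> = (\<lambda>x. complex_of_real (haar_product (corner T) (h (l - 1)) j x / sqrt (measure lebesgue T)))"
    using assms by (auto simp: haar_basis_def haar_product_def)
  then obtain k where "j k \<noteq> 0" by auto
  then show ?thesis using that T by blast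
qed

text \<open>Evaluating the Haar function at an interior point of each cell of the mesh gives its coefficients.\<close>

lemma haar_basis_step:
  assumes \<phi>: "\<phi> \<in> haar_basis H1 \<T>1 l" and l: "1 \<le> l"
  obtains c where "AE x in lebesgue_on D. \<phi> x = (\<Sum>S\<in>m l. c S * indicator S x)"
proof (cases "l = 1")
  case True
  then obtain T where T: "T \<in> m 1" "\<phi> = (\<lambda>x. complex_of_real (indicator T x / sqrt (measure lebesgue T)))"
    using \<phi> by (auto simp: haar_basis_def)
  define c where "c S = (if S = T then complex_of_real (1 / sqrt (measure lebesgue T)) else 0)" for S
  have "AE x in lebesgue_on D. \<phi> x = (\<Sum>S\<in>m l. c S * indicator S x)"
    using lattice_mesh_AE_cell[OF mesh_level[OF l] D(1)]
  proof eventually_elim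
    case (elim x)
    then obtain S where S: "S \<in> m l" "x \<in> interior S" by blast
    have "x \<in> T \<longleftrightarrow> S = T"
    proof
      assume "x \<in> T"
      obtain z z' where "S = cell a (h l) z" "T = cell a (h l) z'"
        using mesh_level[OF l] S T True by (meson lattice_mesh_def)
      then show "S = T" using cell_eq_of_interior[OF h_pos[OF l], of x a z z'] S \<open>x \<in> T\<close> by simp
    next
      assume "S = T"
      then show "x \<in> T" using S interior_subset by blast
    qed
    then show ?case
      using sum_indicator_mesh[OF mesh_level[OF l] S, of c] by (simp add: T(2) c_def)
  qed
  then show ?thesis by (rule that)
next
  case False
  then have l2: "2 \<le> l" "1 \<le> l - 1" using l by auto
  obtain T j k where T: "T \<in> m (l - 1)"
    "\<phi> = (\<lambda>x. complex_of_real (haar_product (corner T) (h (l - 1)) j x / sqrt (measure lebesgue T)))"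
    by (rule haar_basis_cases[OF \<phi> l2(1)])
  have hh: "h (l - 1) = 2 * h l"
    using mesh_size_multiple[OF l2(2), of l H1] l2 by simp
  obtain zT where zT: "T = cell a (2 * h l) zT"
    using mesh_level[OF l2(2)] T(1) hh by (auto simp: lattice_mesh_def)
  define c where "c S = \<phi> (SOME y. y \<in> interior S)" for S
  have "AE x in lebesgue_on D. \<phi> x = (\<Sum>S\<in>m l. c S * indicator S x)"
    using lattice_mesh_AE_cell[OF mesh_level[OF l] D(1)]
  proof eventually_elim
    case (elim x)
    then obtain S where S: "S \<in> m l" "x \<in> interior S" by blast
    obtain z where z: "S = cell a (h l) z" using mesh_level[OF l] S by (auto simp: lattice_mesh_def)
    have "(SOME y. y \<in> interior S) \<in> interior S" using S(2) by (rule someI)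
    then have "\<phi> x = c S"
      unfolding c_def T(2) hh
      using haar_product_cell_const[OF h_pos[OF l], of x a z _ "corner T" zT j] S(2) z zT by simp
    then show ?case using sum_indicator_mesh[OF mesh_level[OF l] S, of c] by simp
  qed
  then show ?thesis by (rule that)
qed

text \<open>A cell of level \<open>k < l\<close> either contains the support of the Haar function, which has integral zero, or
  meets it in a null set.\<close>

lemma haar_basis_mean_zero:
  assumes \<phi>: "\<phi> \<in> haar_basis H1 \<T>1 l" and kl: "1 \<le> k" "k < l" and T0: "T0 \<in> m k"
  shows "cell_integral D \<phi> T0 = 0"
proof -
  have l2: "2 \<le> l" "1 \<le> l - 1" "k \<le> l - 1" using kl by auto
  obtain T j i where T: "T \<in> m (l - 1)" "j i \<noteq> 0"
    and \<phi>': "\<phi> = (\<lambda>x. complex_of_real (haar_product (corner T) (h (l - 1)) j x / sqrt (measure lebesgue T)))"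
    by (rule haar_basis_cases[OF \<phi> l2(1)])
  note mesh = mesh_level[OF l2(2)] and H = h_pos[OF l2(2)]
  obtain z where z: "T = cell a (h (l - 1)) z" using mesh T by (auto simp: lattice_mesh_def)
  have out: "\<phi> x = 0" if "x \<notin> T" for x
    using haar_product_eq_0[OF H, of x "corner T"] that H by (simp add: \<phi>' z cell_def corner_cube)
  have \<phi>m: "\<phi> \<in> borel_measurable borel" unfolding \<phi>' by measurable
  from mesh_nested[OF kl(1) l2(3) T0 T(1)] show ?thesis
  proof
    assume sub: "T \<subseteq> T0"
    have "cell_integral D \<phi> T0 = (LINT x|lebesgue_on D. \<phi> x)"
      unfolding cell_integral_def using out sub
      by (intro Bochner_Integration.integral_cong) (auto split: split_indicator)
    also have "\<dots> = (LINT x|lborel. \<phi> x)"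
      by (rule cell_integral_lebesgue[OF lip mesh T(1) \<phi>m out])
    also have "\<dots> = complex_of_real (LINT x|lborel. haar_product (corner T) (h (l - 1)) j x / sqrt (measure lebesgue T))"
      unfolding \<phi>' by (rule integral_complex_of_real)
    also have "\<dots> = 0"
      using integral_haar_product_eq_0[OF H, of j i "corner T"] T(2) by simp
    finally show ?thesis .
  next
    assume disj: "interior T \<inter> T0 = {}"
    have "AE x in lebesgue_on D. off_lattice a (h (l - 1)) x"
      by (rule AE_lebesgue_onI[OF D(1)]) (use AE_off_lattice[of a "h (l - 1)"] in \<open>auto elim: eventually_mono\<close>)
    then have "AE x in lebesgue_on D. \<phi> x * indicator T0 x = 0"
    proof eventually_elim
      case (elim x)
      show ?case
      proof (cases "x \<in> T")
        case True
        then have "x \<in> interior T" using off_lattice_interior_cell[OF elim] z by blast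
        then show ?thesis using disj by (auto split: split_indicator)
      qed (simp add: out)
    qed
    then have "cell_integral D \<phi> T0 = (LINT x|lebesgue_on D. 0)"
      unfolding cell_integral_def
      using measurable_lebesgue_on_borel[OF \<phi>m, of D] measurable_indicator_cell[OF mesh_level[OF kl(1)] T0, where 'b = complex and D' = D]
      by (intro integral_cong_AE) auto
    then show ?thesis by simp
  qed
qed

end

section \<open>Orthogonality across levels\<close>

lemma measurable_bubble: "bubble H T \<in> borel_measurable borel"
  by (intro borel_measurable_continuous_onI continuous_bubble)

context helmholtz_setting
begin

text \<open>By translation invariance, the common integral of all bubbles of level \<open>l\<close>.\<close>

definition "bubble_mass l = (LINT x|lborel. complex_of_real (\<Prod>k\<in>(UNIV :: 'n set). bubble1d (x $ k / h l)))"

lemma integral_bubble: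
  assumes l: "1 \<le> l" and T: "T \<in> m l"
  shows "(LINT x|lebesgue_on D. bubble (h l) T x) = bubble_mass l"
proof -
  obtain z where z: "T = cell a (h l) z" using mesh_level[OF l] T by (auto simp: lattice_mesh_def)
  have out: "bubble (h l) T x = 0" if "x \<notin> T" for x
    using bubble_eq_0_outside[OF h_pos[OF l], of x a z] that interior_subset[of T] z by blast
  define b where "b x = complex_of_real (\<Prod>k\<in>UNIV. bubble1d (x $ k / h l))" for x :: "real^'n"
  have b: "b \<in> borel_measurable borel" unfolding b_def[abs_def] by measurable
  have "(LINT x|lebesgue_on D. bubble (h l) T x) = (LINT x|lborel. bubble (h l) T x)"
    by (rule cell_integral_lebesgue[OF lip mesh_level[OF l] T measurable_bubble out])
  also have "\<dots> = (LINT x|lborel. b (x + (- corner T)))"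
    by (intro Bochner_Integration.integral_cong) (simp_all add: bubble_def b_def)
  also have "\<dots> = (LINT x|lborel. b x)"
    by (rule lborel_integral_translation(1)[OF b])
  finally show ?thesis unfolding bubble_mass_def b_def .
qed

text \<open>A step function determines its coefficients, because its cell integrals do.\<close>

lemma bubble_operator_step:
  assumes l: "1 \<le> l" and q: "AE x in lebesgue_on D. q x = (\<Sum>S\<in>m l. c S * indicator S x)"
  shows "bubble_operator D (h l) (m l) q = (\<lambda>x. \<Sum>T\<in>m l. c T * bubble (h l) T x)"
  unfolding bubble_operator_def
proof (rule the_equality)
  show "\<exists>c'. (AE x in lebesgue_on D. q x = (\<Sum>T\<in>m l. c' T * indicator T x)) \<and>
      (\<lambda>x. \<Sum>T\<in>m l. c T * bubble (h l) T x) = (\<lambda>x. \<Sum>T\<in>m l. c' T * bubble (h l) T x)"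
    using q by blast
  fix v assume "\<exists>c'. (AE x in lebesgue_on D. q x = (\<Sum>T\<in>m l. c' T * indicator T x)) \<and> v = (\<lambda>x. \<Sum>T\<in>m l. c' T * bubble (h l) T x)"
  then obtain c' where c': "AE x in lebesgue_on D. q x = (\<Sum>T\<in>m l. c' T * indicator T x)"
    and v: "v = (\<lambda>x. \<Sum>T\<in>m l. c' T * bubble (h l) T x)" by blast
  have "c' T = c T" if T: "T \<in> m l" for T
    using cell_integral_step[OF lip mesh_level[OF l] T q] cell_integral_step[OF lip mesh_level[OF l] T c'] h_pos[OF l]
    by simp
  then show "v = (\<lambda>x. \<Sum>T\<in>m l. c T * bubble (h l) T x)"
    unfolding v by (intro ext sum.cong) auto
qed

lemma mesh_ne: "1 \<le> l \<Longrightarrow> m l \<noteq> {}"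
proof
  assume l: "1 \<le> l" and "m l = {}"
  then have "closure D = {}" using mesh_level[OF l] by (auto simp: lattice_mesh_def)
  then show False using lip by (simp add: bounded_lipschitz_domain_def)
qed

lemma bubble_in_V: "1 \<le> l \<Longrightarrow> T \<in> m l \<Longrightarrow> bubble (h l) T \<in> V"
  by (rule bubble_in_V_space[OF lip mesh_level _ \<Gamma>D_frontier])

lemma bubble_sum_in_V:
  assumes l: "1 \<le> l"
  shows "(\<lambda>x. \<Sum>T\<in>m l. c T * bubble (h l) T x) \<in> V"
proof -
  obtain T where "T \<in> m l" using mesh_ne[OF l] by blast
  moreover have "finite (m l)" using mesh_level[OF l] by (simp add: lattice_mesh_def)
  ultimately show ?thesis
    using bubble_in_V[OF l] by (intro V_space_sum[OF D, of "bubble (h l) T"]) auto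
qed

lemma V_integrable: "u \<in> V \<Longrightarrow> integrable (lebesgue_on D) u"
  by (rule L2_integrable[OF emeasure_lebesgue_on_finite[OF D] W12_D(1)[OF V_space_D(1)]])

lemma cell_integral_bubble_sum:
  assumes l: "1 \<le> l" and T: "T \<in> m l"
  shows "cell_integral D (\<lambda>x. \<Sum>S\<in>m l. c S * bubble (h l) S x) T = c T * bubble_mass l"
proof -
  have fin: "finite (m l)" using mesh_level[OF l] by (simp add: lattice_mesh_def)
  have "(\<Sum>S\<in>m l. c S * bubble (h l) S x) * indicator T x = c T * bubble (h l) T x" for x
  proof -
    have "bubble (h l) S x * indicator T x = (if S = T then bubble (h l) T x else 0)" if S: "S \<in> m l" for S
    proof -
      obtain z z' where z: "S = cell a (h l) z" "T = cell a (h l) z'"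
        using mesh_level[OF l] S T by (meson lattice_mesh_def)
      show ?thesis
      proof (cases "x \<in> interior S")
        case True
        have "x \<in> T \<longleftrightarrow> S = T"
          using cell_eq_of_interior[OF h_pos[OF l], of x a z z'] z True interior_subset by auto
        then show ?thesis by simp
      next
        case False
        then have "bubble (h l) S x = 0" using bubble_eq_0_outside[OF h_pos[OF l]] z by simp
        then show ?thesis by auto
      qed
    qed
    then have "(\<Sum>S\<in>m l. c S * (bubble (h l) S x * indicator T x)) = (\<Sum>S\<in>m l. c S * (if S = T then bubble (h l) T x else 0))"
      by (intro sum.cong) auto
    also have "\<dots> = c T * bubble (h l) T x" using fin T by (simp add: if_distrib cong: if_cong)
    finally show ?thesis by (simp add: sum_distrib_right mult.assoc)
  qed
  then have "cell_integral D (\<lambda>x. \<Sum>S\<in>m l. c S * bubble (h l) S x) T = (LINT x|lebesgue_on D. c T * bubble (h l) T x)"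
    unfolding cell_integral_def by simp
  then show ?thesis by (simp add: integral_bubble[OF l T])
qed

text \<open>On cells of level \<open>l\<close> the cell integrals of the bubble function are a fixed multiple of those of the Haar
  function. Both are additive over the subcells of a coarser cell.\<close>

lemma bubble_operator_haar:
  assumes \<phi>: "\<phi> \<in> haar_basis H1 \<T>1 l" and l: "1 \<le> l"
  shows "bubble_operator D (h l) (m l) \<phi> \<in> V"
    and "\<And>k T0. 1 \<le> k \<Longrightarrow> k < l \<Longrightarrow> T0 \<in> m k \<Longrightarrow> cell_integral D (bubble_operator D (h l) (m l) \<phi>) T0 = 0"
proof -
  obtain c where c: "AE x in lebesgue_on D. \<phi> x = (\<Sum>S\<in>m l. c S * indicator S x)"
    by (rule haar_basis_step[OF \<phi> l])
  let ?v = "bubble_operator D (h l) (m l) \<phi>"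
  have v: "?v = (\<lambda>x. \<Sum>T\<in>m l. c T * bubble (h l) T x)"
    by (rule bubble_operator_step[OF l c])
  show V: "?v \<in> V" unfolding v by (rule bubble_sum_in_V[OF l])
  fix k T0 assume k: "1 \<le> k" "k < l" and T0: "T0 \<in> m k"
  have kl: "k \<le> l" using k by simp
  let ?s = "bubble_mass l / complex_of_real (h l ^ CARD('n))"
  have "cell_integral D ?v T = ?s * cell_integral D \<phi> T" if T: "T \<in> m l" for T
    using cell_integral_bubble_sum[OF l T, of c] cell_integral_step[OF lip mesh_level[OF l] T c] h_pos[OF l]
    by (simp add: v)
  then have "(\<Sum>T\<in>{T \<in> m l. T \<subseteq> T0}. cell_integral D ?v T) = ?s * (\<Sum>T\<in>{T \<in> m l. T \<subseteq> T0}. cell_integral D \<phi> T)"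
    unfolding sum_distrib_left by (intro sum.cong) auto
  then have "cell_integral D ?v T0 = ?s * cell_integral D \<phi> T0"
    using cell_integral_coarse[OF k(1) kl T0 V_integrable[OF V]]
      cell_integral_coarse[OF k(1) kl T0 step_function_integrable[OF lip mesh_level[OF l] c]] by simp
  then show "cell_integral D ?v T0 = 0"
    using haar_basis_mean_zero[OF \<phi> k T0] by simp
qed

lemma W_space_V: "w \<in> W_space D \<Gamma>D \<T> \<Longrightarrow> w \<in> V"
  by (simp add: W_space_def)

text \<open>This is the key inclusion: a corrected bubble function of level \<open>l\<close> lies in the kernel of the projection
  of each coarser level.\<close>

lemma corrected_bubble_in_coarse_W:
  assumes \<phi>: "\<phi> \<in> haar_basis H1 \<T>1 l" and k: "1 \<le> k" "k < l"
    and c: "c \<in> W_space D \<Gamma>D (m l)"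
  shows "(\<lambda>x. bubble_operator D (h l) (m l) \<phi> x - c x) \<in> W_space D \<Gamma>D (m k)"
proof -
  let ?v = "bubble_operator D (h l) (m l) \<phi>"
  have l: "1 \<le> l" and kl: "k \<le> l" using k by auto
  note v = bubble_operator_haar[OF \<phi> l]
  have cV: "c \<in> V" by (rule W_space_V[OF c])
  have c0: "cell_integral D c T = 0" if "T \<in> m l" for T
    using c that by (simp add: W_space_iff[OF lip mesh_level[OF l] cV])
  have dV: "(\<lambda>x. ?v x - c x) \<in> V"
    using V_space_lincomb[OF D v(1) cV, of "-1"] by simp
  have "cell_integral D (\<lambda>x. ?v x - c x) T0 = 0" if T0: "T0 \<in> m k" for T0
  proof -
    have "cell_integral D c T0 = 0"
      unfolding cell_integral_coarse[OF k(1) kl T0 V_integrable[OF cV]] using c0 by (intro sum.neutral) auto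
    then show ?thesis
      using cell_integral_diff[OF lip mesh_level[OF k(1)] T0 V_integrable[OF v(1)] V_integrable[OF cV]] v(2)[OF k T0]
      by simp
  qed
  then show ?thesis by (simp add: W_space_iff[OF lip mesh_level[OF k(1)] dV])
qed

lemma form_diff_left:
  assumes "u \<in> V" "v \<in> V" "w \<in> V"
  shows "\<a> (\<lambda>x. u x - v x) w = \<a> u w - \<a> v w"
  using form_lincomb_left[OF assms, of "-1"] by simp

lemma form_diff_right:
  assumes "u \<in> V" "v \<in> V" "w \<in> V"
  shows "\<a> w (\<lambda>x. u x - v x) = \<a> w u - \<a> w v"
  using form_lincomb_right[OF assms, of "-1"] by simp

text \<open>The factor of the finer level is an admissible test function in the defining equation of the corrector of the
  coarser level.\<close>

lemma generators_orthogonal: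
  assumes lev: "1 \<le> k" "1 \<le> l" "k \<noteq> l"
    and \<phi>: "\<phi> \<in> haar_basis H1 \<T>1 k" "v = bubble_operator D (h k) (m k) \<phi>" "c \<in> corrector D \<Gamma>D \<Gamma>R \<kappa> (m k) v"
    and \<psi>: "\<psi> \<in> haar_basis H1 \<T>1 l" "w = bubble_operator D (h l) (m l) \<psi>" "d \<in> adjoint_corrector D \<Gamma>D \<Gamma>R \<kappa> (m l) w"
  shows "\<a> (\<lambda>x. v x - c x) (\<lambda>x. w x - d x) = 0"
proof -
  have v: "v \<in> V" unfolding \<phi>(2) by (rule bubble_operator_haar(1)[OF \<phi>(1) lev(1)])
  have w: "w \<in> V" unfolding \<psi>(2) by (rule bubble_operator_haar(1)[OF \<psi>(1) lev(2)])
  have c: "c \<in> W_space D \<Gamma>D (m k)" "\<And>y. y \<in> W_space D \<Gamma>D (m k) \<Longrightarrow> \<a> c y = \<a> v y"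
    using \<phi>(3) by (auto simp: corrector_def)
  have d: "d \<in> W_space D \<Gamma>D (m l)" "\<And>y. y \<in> W_space D \<Gamma>D (m l) \<Longrightarrow> \<a> y d = \<a> y w"
    using \<psi>(3) by (auto simp: adjoint_corrector_def)
  show ?thesis
  proof (cases "k < l")
    case True
    have y: "(\<lambda>x. w x - d x) \<in> W_space D \<Gamma>D (m k)"
      unfolding \<psi>(2) by (rule corrected_bubble_in_coarse_W[OF \<psi>(1) lev(1) True d(1)])
    show ?thesis
      unfolding form_diff_left[OF v W_space_V[OF c(1)] W_space_V[OF y]] by (simp add: c(2)[OF y])
  next
    case False
    then have "l < k" using lev by simp
    then have y: "(\<lambda>x. v x - c x) \<in> W_space D \<Gamma>D (m l)"
      unfolding \<phi>(2) by (intro corrected_bubble_in_coarse_W[OF \<phi>(1) lev(2) _ c(1)])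
    show ?thesis
      unfolding form_diff_right[OF w W_space_V[OF d(1)] W_space_V[OF y]] by (simp add: d(2)[OF y])
  qed
qed

text \<open>Formulated for a map \<open>F\<close> that is linear up to a map \<open>p\<close> on the scalars, so that it applies to both arguments of
  the sesquilinear form.\<close>

lemma sum_annihilated:
  assumes F: "\<And>u v \<alpha>. u \<in> V \<Longrightarrow> v \<in> V \<Longrightarrow> F (\<lambda>x. u x + \<alpha> * v x) = F u + p \<alpha> * F v"
    and p: "p 1 = (1 :: complex)" and ne: "V \<noteq> {}"
    and A: "finite A" "A \<subseteq> V" "\<And>g. g \<in> A \<Longrightarrow> F g = 0"
  shows "F (\<lambda>x. \<Sum>g\<in>A. c g * g x) = 0"
proof -
  obtain e where e: "e \<in> V" using ne by blast
  note sumV = V_space_sum[OF D e, where f = "\<lambda>g. g"]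
  show ?thesis
    using A
  proof (induction A rule: finite_induct)
    case empty
    have z: "(\<lambda>x. 0) \<in> V" using sumV[of "{}"] by simp
    show ?case using F[OF z z, of 1] p by simp
  next
    case (insert g A)
    have eq: "(\<lambda>x. \<Sum>g\<in>insert g A. c g * g x) = (\<lambda>x. (\<Sum>g\<in>A. c g * g x) + c g * g x)"
      using insert by (simp add: add.commute)
    have "(\<lambda>x. \<Sum>g\<in>A. c g * g x) \<in> V" "g \<in> V"
      using insert by (auto intro!: sumV)
    then show ?case
      unfolding eq using F[of "\<lambda>x. \<Sum>g\<in>A. c g * g x" g "c g"] insert by simp
  qed
qed

lemma cspan_orthogonal:
  assumes AB: "A \<subseteq> V" "B \<subseteq> V" and 0: "\<And>f g. f \<in> A \<Longrightarrow> g \<in> B \<Longrightarrow> \<a> f g = 0"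
    and u: "u \<in> cspan A" and w: "w \<in> cspan B" and ne: "V \<noteq> {}"
  shows "\<a> u w = 0"
proof -
  obtain A' c where A': "finite A'" "A' \<subseteq> A" "u = (\<lambda>x. \<Sum>g\<in>A'. c g * g x)"
    using u by (auto simp: cspan_def)
  obtain B' d where B': "finite B'" "B' \<subseteq> B" "w = (\<lambda>x. \<Sum>g\<in>B'. d g * g x)"
    using w by (auto simp: cspan_def)
  have sub: "A' \<subseteq> V" "B' \<subseteq> V" using A'(2) B'(2) AB by auto
  obtain e where e: "e \<in> V" using ne by blast
  have wV: "w \<in> V"
    unfolding B'(3) by (rule V_space_sum[OF D e B'(1)]) (use sub in auto)
  have "\<a> f w = 0" if f: "f \<in> A'" for f
    unfolding B'(3)
  proof (rule sum_annihilated[OF _ _ ne B'(1) sub(2), where p = cnj])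
    show "\<a> f (\<lambda>x. u x + \<alpha> * v x) = \<a> f u + cnj \<alpha> * \<a> f v" if "u \<in> V" "v \<in> V" for u v \<alpha>
      using form_lincomb_right[OF that] f sub(1) by blast
    show "\<a> f g = 0" if "g \<in> B'" for g using 0 f that A'(2) B'(2) by blast
  qed simp
  then show ?thesis
    unfolding A'(3) using form_lincomb_left[OF _ _ wV]
    by (intro sum_annihilated[where F = "\<lambda>f. \<a> f w" and p = "\<lambda>\<alpha>. \<alpha>", OF _ _ ne A'(1) sub(1)]) auto
qed

lemma trial_test_orthogonal:
  assumes lev: "1 \<le> k" "1 \<le> l" "k \<noteq> l"
    and \<phi>: "\<phi> \<in> trial_space D \<Gamma>D \<Gamma>R \<kappa> H1 \<T>1 k" and \<psi>: "\<psi> \<in> test_space D \<Gamma>D \<Gamma>R \<kappa> H1 \<T>1 l"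
  shows "\<a> \<phi> \<psi> = 0"
proof (rule cspan_orthogonal[OF _ _ _ \<phi>[unfolded trial_space_def] \<psi>[unfolded test_space_def]])
  have diffV: "(\<lambda>x. v x - c x) \<in> V" if "v \<in> V" "c \<in> V" for v c
    using V_space_lincomb[OF D that, of "-1"] by simp
  show "{\<lambda>x. v x - c x |\<phi> v c. \<phi> \<in> haar_basis H1 \<T>1 k \<and> v = bubble_operator D (h k) (m k) \<phi> \<and> c \<in> corrector D \<Gamma>D \<Gamma>R \<kappa> (m k) v} \<subseteq> V"
    using bubble_operator_haar(1)[OF _ lev(1)] by (auto simp: corrector_def intro!: diffV dest: W_space_V)
  show "{\<lambda>x. v x - c x |\<phi> v c. \<phi> \<in> haar_basis H1 \<T>1 l \<and> v = bubble_operator D (h l) (m l) \<phi> \<and> c \<in> adjoint_corrector D \<Gamma>D \<Gamma>R \<kappa> (m l) v} \<subseteq> V"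
    using bubble_operator_haar(1)[OF _ lev(2)] by (auto simp: adjoint_corrector_def intro!: diffV dest: W_space_V)
  show "V \<noteq> {}" using bubble_sum_in_V[OF lev(1)] by blast
qed (use generators_orthogonal[OF lev] in blast)

end

theorem lemma4p8:
  fixes D \<Gamma>D \<Gamma>N \<Gamma>R :: "(real^'n) set"
    and \<T>1 :: "(real^'n) set set"
    and \<kappa> \<kappa>0 H1 :: real
    and L k l :: nat
    and \<phi> \<psi> :: "real^'n \<Rightarrow> complex"
  assumes "CARD('n) \<in> {1, 2, 3}"
    and "bounded_lipschitz_domain D"
    and "boundary_decomposition D \<Gamma>D \<Gamma>N \<Gamma>R"
    and "0 < \<kappa>0" and "\<kappa>0 < \<kappa>"
    and "cartesian_mesh D H1 \<T>1"
    and "H1 * \<kappa> \<le> pi / sqrt 2"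
    and "k \<in> {1..L}" and "l \<in> {1..L}" and "k \<noteq> l"
    and "\<phi> \<in> trial_space D \<Gamma>D \<Gamma>R \<kappa> H1 \<T>1 k"
    and "\<psi> \<in> test_space D \<Gamma>D \<Gamma>R \<kappa> H1 \<T>1 l"
  shows "helmholtz_form D \<Gamma>R \<kappa> \<phi> \<psi> = 0"
proof -
  obtain a where "lattice_mesh D a H1 \<T>1"
    using assms(6) by (auto simp: cartesian_mesh_iff)
  then interpret helmholtz_setting D \<Gamma>D \<Gamma>R a H1 \<T>1 \<kappa>
    using assms(2,3) by unfold_locales (auto simp: boundary_decomposition_def)
  show ?thesis
    using assms(8-12) by (intro trial_test_orthogonal) auto
qed

end
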